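(* Let $p$ be an odd prime and let $G$ be a multi-edge spinal group acting on the regular $p$-adic rooted tree. Suppose that $G$ is torsion. Then every maximal subgroup of $G$ is normal of finite index $p$ in $G$.
   Context: Let $p$ be an odd prime and $X=\{1,\ldots,p\}$. The regular $p$-adic rooted tree $T$ has as vertices the finite words over $X$, with root the empty word and an edge from $v$ to $vx$ for each word $v$ and each $x\in X$. $\operatorname{Aut}(T)$ is the group of automorphisms of the rooted tree $T$, acting on the right. For a vertex $u$, the full subtree $T_u$ of words with prefix $u$ is identified with $T$ by deleting the prefix $u$. The section of $f\in\operatorname{Aut}(T)$ at $u$ is the automorphism $f_u$ of $T$ with $(uv)^f=u^f v^{f_u}$ for all words $v$. $\operatorname{Stab}_{\operatorname{Aut}(T)}(1)$ is the subgroup fixing all vertices of length $1$, and $\psi_1\colon \operatorname{Stab}_{\operatorname{Aut}(T)}(1)\to \operatorname{Aut}(T)\times\overset{p}{\ldots}\times\operatorname{Aut}(T)$ is the isomorphism $f\mapsto(f_1,\ldots,f_p)$, where $f_x$ is the section at the vertex $x\in X$. Let $a$ be the rooted automorphism corresponding to the $p$-cycle $(1\,2\,\ldots\,p)$, i.e. $(xv)^a=x^{(1\,2\,\ldots\,p)}v$ for $x\in X$ and words $v$. Given $r\ge 1$ and an $r$-tuple $\mathbf{E}$ of $(\mathbb{Z}/p\mathbb{Z})$-linearly independent vectors $\mathbf{e}_i=(e_{i,1},\ldots,e_{i,p-1})\in(\mathbb{Z}/p\mathbb{Z})^{p-1}$, $i\in\{1,\ldots,r\}$, define recursively $b_1,\ldots,b_r\in\operatorname{Stab}_{\operatorname{Aut}(T)}(1)$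 by $\psi_1(b_i)=(a^{e_{i,1}},\ldots,a^{e_{i,p-1}},b_i)$. The multi-edge spinal group associated to $\mathbf{E}$ is $G_{\mathbf{E}}=\langle a,b_1,\ldots,b_r\rangle\le\operatorname{Aut}(T)$. *)

theory Defs
  imports
    "HOL-Algebra.Algebra"
    "HOL-Number_Theory.Cong"
    "HOL-Computational_Algebra.Primes"
begin

section \<open>The rooted tree and its automorphism group\<close>

definition letters :: "nat \<Rightarrow> nat set" where
  "letters p = {1..p}"

definition words :: "nat \<Rightarrow> nat list set" where
  "words p = lists (letters p)"

definition adjacent :: "nat \<Rightarrow> nat list \<Rightarrow> nat list \<Rightarrow> bool" where
  "adjacent p u v \<longleftrightarrow> (\<exists>x\<in>letters p. v = u @ [x] \<or> u = v @ [x])"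

text \<open>Graph automorphisms that fix the root. As in \<^const>\<open>Bij\<close>, maps are extensional, so that
  equality of automorphisms is equality on the vertices.\<close>

definition tree_auts :: "nat \<Rightarrow> (nat list \<Rightarrow> nat list) set" where
  "tree_auts p = {f \<in> Bij (words p). f [] = [] \<and>
     (\<forall>u\<in>words p. \<forall>v\<in>words p. adjacent p (f u) (f v) \<longleftrightarrow> adjacent p u v)}"

text \<open>Automorphisms act on the right: the product of \<open>f\<close> and \<open>g\<close> applies \<open>f\<close> first.\<close>

definition Aut_tree :: "nat \<Rightarrow> (nat list \<Rightarrow> nat list) monoid" where
  "Aut_tree p = \<lparr>carrier = tree_auts p,
                 monoid.mult = \<lambda>f g. compose (words p) g f,
                 one = \<lambda>u\<in>words p. u\<rparr>"

text \<open>Since automorphisms preserve levels, removing the first \<open>length u\<close> letters of the image of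
  \<open>u @ v\<close> removes exactly the image of \<open>u\<close>; see \<open>section_eq\<close> below.\<close>

definition section_at :: "nat \<Rightarrow> (nat list \<Rightarrow> nat list) \<Rightarrow> nat list \<Rightarrow> nat list \<Rightarrow> nat list" where
  "section_at p f u = (\<lambda>v\<in>words p. drop (length u) (f (u @ v)))"

definition level_one_stab :: "nat \<Rightarrow> (nat list \<Rightarrow> nat list) set" where
  "level_one_stab p = {f \<in> tree_auts p. \<forall>u\<in>words p. length u = 1 \<longrightarrow> f u = u}"

text \<open>A \<open>p\<close>-tuple of automorphisms is an extensional function on \<^term>\<open>letters p\<close>.\<close>

definition psi1 :: "nat \<Rightarrow> (nat list \<Rightarrow> nat list) \<Rightarrow> nat \<Rightarrow> nat list \<Rightarrow> nat list" where
  "psi1 p f = (\<lambda>x\<in>letters p. section_at p f [x])"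


section \<open>Multi-edge spinal groups\<close>

definition rooted_gen :: "nat \<Rightarrow> nat list \<Rightarrow> nat list" where
  "rooted_gen p = (\<lambda>w\<in>words p. case w of [] \<Rightarrow> []
     | x # v \<Rightarrow> (if x = p then 1 else x + 1) # v)"

text \<open>Vectors over the integers modulo \<open>p\<close> are given by integer representatives of their entries;
  \<open>e j\<close> is the \<open>j\<close>-th entry, for \<open>j\<close> in \<open>{1..p-1}\<close>. The powers of the rooted generator depend only
  on the residue classes of the exponents. The description is unique by
  \<open>ex1_directed_gen\<close> below.\<close>

definition directed_gen :: "nat \<Rightarrow> (nat \<Rightarrow> int) \<Rightarrow> nat list \<Rightarrow> nat list" where
  "directed_gen p e = (THE b. b \<in> level_one_stab p \<and>
     psi1 p b = (\<lambda>x\<in>letters p. if x < p then rooted_gen p [^]\<^bsub>Aut_tree p\<^esub> e x else b))"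

text \<open>\<open>E i\<close> is the \<open>i\<close>-th vector of the tuple, for \<open>i\<close> in \<open>{1..r}\<close>.\<close>

definition lin_indep_mod :: "nat \<Rightarrow> nat \<Rightarrow> (nat \<Rightarrow> nat \<Rightarrow> int) \<Rightarrow> bool" where
  "lin_indep_mod p r E \<longleftrightarrow> (\<forall>c :: nat \<Rightarrow> int.
     (\<forall>j\<in>{1..p-1}. [(\<Sum>i\<in>{1..r}. c i * E i j) = 0] (mod int p)) \<longrightarrow>
     (\<forall>i\<in>{1..r}. [c i = 0] (mod int p)))"

definition multi_edge_spinal_group ::
    "nat \<Rightarrow> nat \<Rightarrow> (nat \<Rightarrow> nat \<Rightarrow> int) \<Rightarrow> (nat list \<Rightarrow> nat list) monoid" where
  "multi_edge_spinal_group p r E =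
     subgroup_generated (Aut_tree p) (insert (rooted_gen p) ((\<lambda>i. directed_gen p (E i)) ` {1..r}))"


section \<open>Torsion groups and maximal subgroups\<close>

definition torsion_group :: "('a, 'b) monoid_scheme \<Rightarrow> bool" where
  "torsion_group G \<longleftrightarrow> group G \<and> (\<forall>g\<in>carrier G. \<exists>n::nat. n > 0 \<and> g [^]\<^bsub>G\<^esub> n = \<one>\<^bsub>G\<^esub>)"

definition maximal_subgroup :: "'a set \<Rightarrow> ('a, 'b) monoid_scheme \<Rightarrow> bool" where
  "maximal_subgroup M G \<longleftrightarrow> subgroup M G \<and> M \<noteq> carrier G \<and>
     (\<forall>K. subgroup K G \<and> M \<subseteq> K \<longrightarrow> K = M \<or> K = carrier G)"


section \<open>Well-definedness\<close>

lemma Nil_words [simp]: "[] \<in> words p"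
  by (simp add: words_def)

lemma Cons_words [simp]: "x # v \<in> words p \<longleftrightarrow> x \<in> letters p \<and> v \<in> words p"
  by (simp add: words_def)

lemma append_words [simp]: "u @ v \<in> words p \<longleftrightarrow> u \<in> words p \<and> v \<in> words p"
  by (simp add: words_def)

lemma tree_auts_mem: "f \<in> tree_auts p \<Longrightarrow> u \<in> words p \<Longrightarrow> f u \<in> words p"
  by (auto simp: tree_auts_def Bij_def bij_betw_def)

lemma tree_auts_inj: "f \<in> tree_auts p \<Longrightarrow> inj_on f (words p)"
  by (auto simp: tree_auts_def Bij_def bij_betw_def)

lemma tree_auts_ext: "f \<in> tree_auts p \<Longrightarrow> f \<in> extensional (words p)"
  by (auto simp: tree_auts_def Bij_def)

lemma tree_auts_Nil: "f \<in> tree_auts p \<Longrightarrow> f [] = []"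
  by (auto simp: tree_auts_def)

lemma tree_auts_adj: "f \<in> tree_auts p \<Longrightarrow> u \<in> words p \<Longrightarrow> v \<in> words p \<Longrightarrow>
    adjacent p (f u) (f v) \<longleftrightarrow> adjacent p u v"
  by (auto simp: tree_auts_def)

lemma tree_auts_inv:
  assumes f: "f \<in> tree_auts p"
  shows "(\<lambda>u\<in>words p. inv_into (words p) f u) \<in> tree_auts p" (is "?g \<in> _")
proof -
  have fB: "f \<in> Bij (words p)" and bij: "bij_betw f (words p) (words p)"
    using f by (auto simp: tree_auts_def Bij_def)
  have gB: "?g \<in> Bij (words p)"
    using fB by (rule restrict_inv_into_Bij)
  have fg: "f (?g u) = u" "?g u \<in> words p" if "u \<in> words p" for u
    using bij that by (auto simp: bij_betw_def f_inv_into_f inv_into_into)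
  have "?g [] = []"
    using inv_into_f_f[of f "words p" "[]"] tree_auts_inj[OF f] tree_auts_Nil[OF f] by simp
  moreover have "adjacent p (?g u) (?g v) \<longleftrightarrow> adjacent p u v"
    if "u \<in> words p" "v \<in> words p" for u v
    using tree_auts_adj[OF f fg(2)[OF that(1)] fg(2)[OF that(2)]] fg(1) that by metis
  ultimately show ?thesis
    using gB by (simp add: tree_auts_def)
qed

lemma group_Aut_tree: "group (Aut_tree p)"
proof (rule groupI)
  fix f g assume "f \<in> carrier (Aut_tree p)" "g \<in> carrier (Aut_tree p)"
  then have fg: "f \<in> tree_auts p" "g \<in> tree_auts p"
    by (auto simp: Aut_tree_def)
  then have "compose (words p) g f \<in> Bij (words p)"
    by (intro compose_Bij) (auto simp: tree_auts_def)
  with fg show "f \<otimes>\<^bsub>Aut_tree p\<^esub> g \<in> carrier (Aut_tree p)"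
    by (auto simp: Aut_tree_def tree_auts_def compose_eq tree_auts_mem[OF fg(1)])
next
  show "\<one>\<^bsub>Aut_tree p\<^esub> \<in> carrier (Aut_tree p)"
    by (auto simp: Aut_tree_def tree_auts_def id_Bij)
next
  fix f g h
  assume "f \<in> carrier (Aut_tree p)" "g \<in> carrier (Aut_tree p)" "h \<in> carrier (Aut_tree p)"
  then show "f \<otimes>\<^bsub>Aut_tree p\<^esub> g \<otimes>\<^bsub>Aut_tree p\<^esub> h = f \<otimes>\<^bsub>Aut_tree p\<^esub> (g \<otimes>\<^bsub>Aut_tree p\<^esub> h)"
    by (auto simp: Aut_tree_def compose_def restrict_def fun_eq_iff tree_auts_mem)
next
  fix f assume f: "f \<in> carrier (Aut_tree p)"
  then have f': "f \<in> tree_auts p" by (simp add: Aut_tree_def)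
  have "compose (words p) f (\<lambda>u\<in>words p. u) = restrict f (words p)"
    by (simp add: compose_def cong: restrict_cong)
  then show "\<one>\<^bsub>Aut_tree p\<^esub> \<otimes>\<^bsub>Aut_tree p\<^esub> f = f"
    by (simp add: Aut_tree_def extensional_restrict[OF tree_auts_ext[OF f']])
  have "bij_betw f (words p) (words p)"
    using f' by (auto simp: tree_auts_def Bij_def)
  then have "compose (words p) f (\<lambda>u\<in>words p. inv_into (words p) f u) = (\<lambda>u\<in>words p. u)"
    by (auto simp: compose_def restrict_def fun_eq_iff bij_betw_def f_inv_into_f)
  then show "\<exists>g\<in>carrier (Aut_tree p). g \<otimes>\<^bsub>Aut_tree p\<^esub> f = \<one>\<^bsub>Aut_tree p\<^esub>"
    using tree_auts_inv[OF f'] by (auto simp: Aut_tree_def)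
qed

lemma tree_auts_snoc:
  assumes f: "f \<in> tree_auts p" and w: "u @ [x] \<in> words p"
  shows "\<exists>y\<in>letters p. f (u @ [x]) = f u @ [y]"
  using w
proof (induction u arbitrary: x rule: rev_induct)
  case Nil
  then show ?case
    using tree_auts_adj[OF f, of "[]" "[x]"] tree_auts_Nil[OF f] by (auto simp: adjacent_def)
next
  case (snoc z u)
  then obtain y where y: "f (u @ [z]) = f u @ [y]" by fastforce
  have "adjacent p (f (u @ [z])) (f (u @ [z, x]))"
    using tree_auts_adj[OF f, of "u @ [z]" "u @ [z, x]"] snoc.prems by (auto simp: adjacent_def)
  moreover have "f u \<noteq> f (u @ [z, x])"
    using inj_onD[OF tree_auts_inj[OF f], of u "u @ [z, x]"] snoc.prems by auto
  ultimately show ?case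
    using y by (auto simp: adjacent_def)
qed

lemma tree_auts_append:
  assumes f: "f \<in> tree_auts p" and w: "u @ v \<in> words p"
  shows "\<exists>v'\<in>words p. length v' = length v \<and> f (u @ v) = f u @ v'"
  using w
proof (induction v rule: rev_induct)
  case (snoc x v)
  then obtain v' where v': "v' \<in> words p" "length v' = length v" "f (u @ v) = f u @ v'"
    by auto
  obtain y where "y \<in> letters p" "f ((u @ v) @ [x]) = f (u @ v) @ [y]"
    using tree_auts_snoc[OF f, of "u @ v" x] snoc.prems by auto
  with v' show ?case by (intro bexI[of _ "v' @ [y]"]) auto
qed simp

lemma tree_auts_length: "f \<in> tree_auts p \<Longrightarrow> u \<in> words p \<Longrightarrow> length (f u) = length u"
  using tree_auts_append[of f p "[]" u] by (auto simp: tree_auts_Nil)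

lemma section_eq:
  assumes "f \<in> tree_auts p" "u \<in> words p" "v \<in> words p"
  shows "f (u @ v) = f u @ section_at p f u v"
  using tree_auts_append[of f p u v] tree_auts_length[of f p u] assms
  by (auto simp: section_at_def)

lemma adjacent_Cons: "adjacent p (x # u) (y # v) \<longleftrightarrow> x = y \<and> adjacent p u v"
  by (auto simp: adjacent_def)

lemma adjacent_Nil: "adjacent p [] (y # v) \<longleftrightarrow> y \<in> letters p \<and> v = []"
  "adjacent p (y # v) [] \<longleftrightarrow> y \<in> letters p \<and> v = []" "\<not> adjacent p [] []"
  by (auto simp: adjacent_def)

lemma rooted_gen_tree_auts: "rooted_gen p \<in> tree_auts p"
proof -
  define s where "s x = (if x = p then 1 else x + 1)" for x :: nat
  define t where "t x = (if x = 1 then p else x - 1)" for x :: nat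
  have s: "s x \<in> letters p" "t x \<in> letters p" "t (s x) = x" "s (t x) = x" if "x \<in> letters p" for x
    using that by (auto simp: s_def t_def letters_def)
  have s_eq: "s x = s y \<longleftrightarrow> x = y" if "x \<in> letters p" "y \<in> letters p" for x y
    using s(3) that by metis
  define g where "g w = (case w of [] \<Rightarrow> [] | x # v \<Rightarrow> s x # v)" for w
  define h where "h w = (case w of [] \<Rightarrow> [] | x # v \<Rightarrow> t x # v)" for w
  have ag: "rooted_gen p = restrict g (words p)"
    by (auto simp: rooted_gen_def g_def s_def restrict_def fun_eq_iff split: list.splits)
  have "bij_betw g (words p) (words p)"
    by (rule bij_betw_byWitness[where f' = h])
       (auto simp: g_def h_def s split: list.splits)
  then have "rooted_gen p \<in> Bij (words p)"
    by (simp add: ag Bij_def cong: bij_betw_cong)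
  moreover have "adjacent p (g u) (g v) \<longleftrightarrow> adjacent p u v" if "u \<in> words p" "v \<in> words p" for u v
    using that
    by (cases u; cases v) (auto simp: g_def adjacent_Cons adjacent_Nil s s_eq)
  ultimately show ?thesis
    by (auto simp: tree_auts_def ag) (auto simp: g_def)
qed

context
  fixes p :: nat and c :: "nat \<Rightarrow> nat list \<Rightarrow> nat list"
begin

primrec spine_map :: "nat list \<Rightarrow> nat list" where
  "spine_map [] = []"
| "spine_map (x # v) = x # (if x < p then c x v else spine_map v)"

lemma spine_map_level_one_stab:
  assumes c: "\<And>x. x \<in> letters p \<Longrightarrow> c x \<in> tree_auts p"
  shows "restrict spine_map (words p) \<in> level_one_stab p"
proof -
  have mem: "spine_map u \<in> words p" if "u \<in> words p" for u
    using that by (induction u) (auto simp: tree_auts_mem[OF c])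
  have inj: "u = v" if "u \<in> words p" "v \<in> words p" "spine_map u = spine_map v" for u v
    using that
  proof (induction u arbitrary: v)
    case Nil then show ?case by (cases v) auto
  next
    case (Cons x u)
    then obtain v' where v': "v = x # v'" "x \<in> letters p" "u \<in> words p" "v' \<in> words p"
      by (cases v) auto
    show ?case
    proof (cases "x < p")
      case True
      with Cons.prems v' have "c x u = c x v'" by simp
      with v' show ?thesis using inj_onD[OF tree_auts_inj[OF c[OF v'(2)]]] by blast
    next
      case False
      with Cons.prems Cons.IH[of v'] v' show ?thesis by simp
    qed
  qed
  have surj: "\<exists>u\<in>words p. spine_map u = v" if "v \<in> words p" for v
    using that
  proof (induction v)
    case Nil show ?case by (intro bexI[of _ "[]"]) auto
  next
    case (Cons x v)
    then have xv: "x \<in> letters p" "v \<in> words p" by auto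
    then have "v \<in> c x ` words p"
      using c[of x] by (auto simp: tree_auts_def Bij_def bij_betw_def)
    then obtain u where u: "u \<in> words p" "c x u = v" by auto
    from Cons xv obtain u' where u': "u' \<in> words p" "spine_map u' = v" by auto
    show ?case
      by (rule bexI[of _ "x # (if x < p then u else u')"]) (use u u' xv in auto)
  qed
  have "bij_betw spine_map (words p) (words p)"
    unfolding bij_betw_def
  proof
    show "inj_on spine_map (words p)" using inj by (auto intro: inj_onI)
    show "spine_map ` words p = words p" using mem surj by blast
  qed
  then have B: "restrict spine_map (words p) \<in> Bij (words p)"
    by (simp add: Bij_def cong: bij_betw_cong)
  have Nil_iff: "spine_map u = [] \<longleftrightarrow> u = []" for u by (cases u) auto
  have c_Nil: "c x u = [] \<longleftrightarrow> u = []" if "x \<in> letters p" "u \<in> words p" for x u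
    using tree_auts_length[OF c[OF that(1)] that(2)] by auto
  have adj: "adjacent p (spine_map u) (spine_map v) \<longleftrightarrow> adjacent p u v"
    if "u \<in> words p" "v \<in> words p" for u v
    using that
  proof (induction u arbitrary: v)
    case Nil then show ?case
      by (cases v) (auto simp: adjacent_Nil Nil_iff c_Nil)
  next
    case (Cons x u)
    then show ?case
      by (cases v) (auto simp: adjacent_Nil adjacent_Cons Nil_iff c_Nil tree_auts_adj[OF c])
  qed
  have "spine_map u = u" if u: "u \<in> words p" "length u = 1" for u
  proof -
    obtain x where "u = [x]" using u(2) by (cases u) auto
    with u show ?thesis by (auto simp: tree_auts_Nil[OF c])
  qed
  with B adj show ?thesis
    by (auto simp: level_one_stab_def tree_auts_def)
qed

lemma psi1_spine_map:
  assumes c: "\<And>x. x \<in> letters p \<Longrightarrow> c x \<in> tree_auts p"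
  shows "psi1 p (restrict spine_map (words p)) =
    (\<lambda>x\<in>letters p. if x < p then c x else restrict spine_map (words p))"
proof (rule ext)
  fix x
  have cx: "restrict (c x) (words p) = c x" if "x \<in> letters p"
    using tree_auts_ext[OF c[OF that]] by (rule extensional_restrict)
  have "section_at p (restrict spine_map (words p)) [x] =
      restrict (if x < p then c x else spine_map) (words p)" if "x \<in> letters p"
    unfolding section_at_def by (rule restrict_ext) (simp add: that)
  then show "psi1 p (restrict spine_map (words p)) x =
      (\<lambda>x\<in>letters p. if x < p then c x else restrict spine_map (words p)) x"
    by (cases "x \<in> letters p"; cases "x < p") (simp_all add: psi1_def cx)
qed

lemma psi1_unique:
  assumes b: "b \<in> level_one_stab p"
    and eq: "psi1 p b = (\<lambda>x\<in>letters p. if x < p then c x else b)"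
  shows "b = restrict spine_map (words p)"
proof -
  have bt: "b \<in> tree_auts p" using b by (simp add: level_one_stab_def)
  have "b w = spine_map w" if "w \<in> words p" for w
    using that
  proof (induction w)
    case Nil show ?case by (simp add: tree_auts_Nil[OF bt])
  next
    case (Cons x v)
    then have xv: "x \<in> letters p" "v \<in> words p" by auto
    have "b [x] = [x]" using b xv by (auto simp: level_one_stab_def)
    then have "b (x # v) = x # section_at p b [x] v"
      using section_eq[OF bt, of "[x]" v] xv by simp
    moreover have "section_at p b [x] = (if x < p then c x else b)"
      using fun_cong[OF eq, of x] xv by (simp add: psi1_def)
    ultimately show ?case using Cons xv by auto
  qed
  then have "restrict b (words p) = restrict spine_map (words p)"
    by (rule restrict_ext)
  then show ?thesis
    by (simp only: extensional_restrict[OF tree_auts_ext[OF bt]])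
qed

end

lemma ex1_directed_gen:
  fixes e :: "nat \<Rightarrow> int"
  shows "\<exists>!b. b \<in> level_one_stab p \<and>
     psi1 p b = (\<lambda>x\<in>letters p. if x < p then rooted_gen p [^]\<^bsub>Aut_tree p\<^esub> e x else b)"
proof -
  let ?c = "\<lambda>x. rooted_gen p [^]\<^bsub>Aut_tree p\<^esub> e x"
  have c: "?c x \<in> tree_auts p" for x
    using group.int_pow_closed[OF group_Aut_tree, of "rooted_gen p" p "e x"] rooted_gen_tree_auts
    by (simp add: Aut_tree_def)
  show ?thesis
  proof (rule ex1I, rule conjI)
    show "restrict (spine_map p ?c) (words p) \<in> level_one_stab p"
      by (rule spine_map_level_one_stab) (rule c)
    show "psi1 p (restrict (spine_map p ?c) (words p)) =
        (\<lambda>x\<in>letters p. if x < p then ?c x else restrict (spine_map p ?c) (words p))"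
      by (rule psi1_spine_map) (rule c)
    show "b = restrict (spine_map p ?c) (words p)"
      if "b \<in> level_one_stab p \<and> psi1 p b = (\<lambda>x\<in>letters p. if x < p then ?c x else b)" for b
      using that by (intro psi1_unique) simp_all
  qed
qed

lemma directed_gen:
  "directed_gen p e \<in> level_one_stab p"
  "psi1 p (directed_gen p e) =
     (\<lambda>x\<in>letters p. if x < p then rooted_gen p [^]\<^bsub>Aut_tree p\<^esub> e x else directed_gen p e)"
  using theI'[OF ex1_directed_gen[of p e], folded directed_gen_def]
  by (rule conjunct1, rule conjunct2)

end

theory Submission
  imports Defs "HOL-Library.Function_Algebras"
begin

text \<open>
  Call a subgroup \<open>M\<close> full modulo \<open>G'\<close> if no proper subgroup contains both \<open>M\<close> and \<open>G'\<close>. A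
  maximal subgroup is either full modulo \<open>G'\<close> or contains \<open>G'\<close>, and in the latter case it is
  normal of prime index, equal to \<open>p\<close> because \<open>G\<close> is generated by elements of order \<open>p\<close>. So it is
  enough that \<open>M = G\<close> whenever \<open>M\<close> is full modulo \<open>G'\<close>.

  Since \<open>G\<close> is torsion, it is a \<open>p\<close>-group, and its proper quotients are finite by a branching
  argument. By the Frattini argument for finite \<open>p\<close>-groups, a full \<open>M\<close> then supplements every
  nontrivial normal subgroup, so for each letter \<open>x\<close> the group \<open>M\<^sub>x\<close> of sections at \<open>x\<close> of the
  elements of \<open>M\<close> that fix level one is full again. Two facts finish the proof. First, \<open>M\<^sub>x = G\<close>
  implies \<open>M = G\<close>: iterated commutators of elements with a prescribed trivial section produce
  elements of \<open>M\<close> supported below \<open>x\<close>, and these fill a normal subgroup of finite index. Second,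
  torsion forces the defining vectors to have coordinate sum zero; this makes the number of directed
  generators needed to write an element drop under taking sections, so that by passing to sections
  and conjugates one finds a subgroup that contains first one directed generator, then also the
  rooted generator, and finally everything.
\<close>

section \<open>Finite index and finite quotients\<close>

text \<open>The obstacle is that \<open>M\<close> is not known to have finite index, so it can be
  compared with \<open>G\<close> only through products with normal subgroups of finite index.
  Maximality does not evidently pass to sections; being full does, and it also passes to conjugates,
  which are needed because sections yield the generators only up to conjugation.

  Each descent tracks the length of an expression in the directed generators together with the total
  of their vectors. Both are additive over the letters, so some section inherits the relevant
  property of the total (a nontrivial directed generator, or one outside the subgroup). Its length
  drops unless all syllables fall below one letter, and then the element is a directed generator up
  to powers of \<open>a\<close>. Vanishing coordinate sums enter twice: a nonzero vector has at
  least two nonzero entries, and the rotations of the sections of an element add up to 0, so that a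
  section moving the letters can be traded, through its \<open>p\<close>-th power, for one fixing
  them.\<close>

context group
begin

lemma inv_mult_cancel [simp]:
  assumes "x \<in> carrier G" "y \<in> carrier G"
  shows "inv x \<otimes> (x \<otimes> y) = y" "x \<otimes> (inv x \<otimes> y) = y"
  using assms by (simp_all flip: m_assoc)

lemma derived_incl_iff:
  assumes "subgroup N G" "H \<subseteq> carrier G"
  shows "derived G H \<subseteq> N \<longleftrightarrow> (\<forall>x\<in>H. \<forall>y\<in>H. x \<otimes> y \<otimes> inv x \<otimes> inv y \<in> N)"
proof
  assume "derived G H \<subseteq> N"
  then show "\<forall>x\<in>H. \<forall>y\<in>H. x \<otimes> y \<otimes> inv x \<otimes> inv y \<in> N"
    unfolding derived_def by (blast intro: generate.incl)
next
  assume "\<forall>x\<in>H. \<forall>y\<in>H. x \<otimes> y \<otimes> inv x \<otimes> inv y \<in> N"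
  then have "derived_set G H \<subseteq> N" by auto
  then show "derived G H \<subseteq> N"
    unfolding derived_def using assms(1) by (rule generate_subgroup_incl)
qed

lemma commutator_in_derived:
  "\<lbrakk>x \<in> H; y \<in> H\<rbrakk> \<Longrightarrow> x \<otimes> y \<otimes> inv x \<otimes> inv y \<in> derived G H"
  unfolding derived_def by (blast intro: generate.incl)

lemma normal_if_derived_le:
  assumes "subgroup N G" "derived G (carrier G) \<subseteq> N"
  shows "N \<lhd> G"
  unfolding normal_inv_iff
proof (intro conjI ballI)
  fix x h assume x: "x \<in> carrier G" and h: "h \<in> N"
  have hc: "h \<in> carrier G" using h assms(1) by (rule subgroup.mem_carrier[rotated])
  have "x \<otimes> h \<otimes> inv x \<otimes> inv h \<in> N"
    using commutator_in_derived[OF x hc] assms(2) by blast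
  then have "x \<otimes> h \<otimes> inv x \<otimes> inv h \<otimes> h \<in> N"
    using h assms(1) by (simp add: subgroup.m_closed)
  then show "x \<otimes> h \<otimes> inv x \<in> N"
    using x hc by (simp add: m_assoc)
qed (rule assms)

lemma commutator_mult:
  assumes "x \<in> carrier G" "y \<in> carrier G" "z \<in> carrier G"
  shows "(x \<otimes> y) \<otimes> z \<otimes> inv (x \<otimes> y) \<otimes> inv z =
    (x \<otimes> (y \<otimes> z \<otimes> inv y \<otimes> inv z) \<otimes> inv x) \<otimes> (x \<otimes> z \<otimes> inv x \<otimes> inv z)"
  using assms by (simp add: m_assoc inv_mult_group)

lemma commutator_inv:
  assumes "x \<in> carrier G" "y \<in> carrier G"
  shows "inv (x \<otimes> y \<otimes> inv x \<otimes> inv y) = y \<otimes> x \<otimes> inv y \<otimes> inv x"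
  using assms by (simp add: m_assoc inv_mult_group)

lemma commutator_sym:
  assumes "subgroup N G" "x \<in> carrier G" "y \<in> carrier G"
  shows "x \<otimes> y \<otimes> inv x \<otimes> inv y \<in> N \<longleftrightarrow> y \<otimes> x \<otimes> inv y \<otimes> inv x \<in> N"
  using subgroup.m_inv_closed[OF assms(1)] commutator_inv assms(2,3) by metis

text \<open>Preimage of the centralizer of the coset of \<open>g\<close> in \<open>G / N\<close>,
  written with commutators to stay inside \<open>G\<close>.\<close>

lemma centralizer_mod_subgroup:
  assumes N: "N \<lhd> G" and g: "g \<in> carrier G"
  shows "subgroup {x \<in> carrier G. x \<otimes> g \<otimes> inv x \<otimes> inv g \<in> N} G"
proof -
  interpret N: normal N G by fact
  show ?thesis
  proof (rule subgroupI)
    show "{x \<in> carrier G. x \<otimes> g \<otimes> inv x \<otimes> inv g \<in> N} \<noteq> {}"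
      using g by (auto intro!: exI[of _ \<one>])
  next
    fix x assume "x \<in> {x \<in> carrier G. x \<otimes> g \<otimes> inv x \<otimes> inv g \<in> N}"
    then have x: "x \<in> carrier G" "x \<otimes> g \<otimes> inv x \<otimes> inv g \<in> N" by auto
    have "inv x \<otimes> inv (x \<otimes> g \<otimes> inv x \<otimes> inv g) \<otimes> x \<in> N"
      using x by (intro N.inv_op_closed1) auto
    moreover have "inv x \<otimes> inv (x \<otimes> g \<otimes> inv x \<otimes> inv g) \<otimes> x = inv x \<otimes> g \<otimes> inv (inv x) \<otimes> inv g"
      using x(1) g by (simp add: m_assoc inv_mult_group)
    ultimately show "inv x \<in> {x \<in> carrier G. x \<otimes> g \<otimes> inv x \<otimes> inv g \<in> N}"
      using x by simp
  next
    fix x y assume "x \<in> {x \<in> carrier G. x \<otimes> g \<otimes> inv x \<otimes> inv g \<in> N}"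
      "y \<in> {x \<in> carrier G. x \<otimes> g \<otimes> inv x \<otimes> inv g \<in> N}"
    then show "x \<otimes> y \<in> {x \<in> carrier G. x \<otimes> g \<otimes> inv x \<otimes> inv g \<in> N}"
      using g by (simp add: commutator_mult N.inv_op_closed2 del: inv_mult_group)
  qed auto
qed

text \<open>The elements commuting with a fixed element modulo \<open>N\<close> form a subgroup, so
  commuting spreads from the generators to the whole group, one argument at a time.\<close>

lemma derived_le_normal:
  assumes N: "N \<lhd> G" and S: "S \<subseteq> carrier G" and gen: "carrier G = generate G S"
    and comm: "\<And>x y. \<lbrakk>x \<in> S; y \<in> S\<rbrakk> \<Longrightarrow> x \<otimes> y \<otimes> inv x \<otimes> inv y \<in> N"
  shows "derived G (carrier G) \<subseteq> N"
proof -
  note sub = normal_imp_subgroup[OF N]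
  have 1: "g \<otimes> y \<otimes> inv g \<otimes> inv y \<in> N" if "y \<in> S" "g \<in> carrier G" for g y
    using generate_subgroup_incl[OF _ centralizer_mod_subgroup[OF N], of S y] that comm S gen
    by blast
  have 2: "x \<otimes> g \<otimes> inv x \<otimes> inv g \<in> N" if "x \<in> carrier G" "g \<in> carrier G" for x g
    using generate_subgroup_incl[OF _ centralizer_mod_subgroup[OF N], of S g] that gen S
      1 commutator_sym[OF sub] by blast
  then show ?thesis
    by (simp add: derived_incl_iff[OF sub])
qed

subsection \<open>Subgroups of finite index\<close>

lemma rcos_eq_iff:
  assumes "subgroup K G" "x \<in> carrier G" "y \<in> carrier G"
  shows "K #> x = K #> y \<longleftrightarrow> x \<otimes> inv y \<in> K"
  using assms by (metis is_group repr_independence rcos_self subgroup.rcos_module subgroup.subset)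

lemma finite_rcosets_iff:
  "finite (rcosets K) \<longleftrightarrow> finite ((\<lambda>x. K #> x) ` carrier G)"
  unfolding RCOSETS_def by (rule arg_cong[of _ _ finite]) auto

lemma finite_rcosetsI:
  assumes K: "subgroup K G" and fin: "finite (f ` carrier G)"
    and sep: "\<And>x y. \<lbrakk>x \<in> carrier G; y \<in> carrier G; f x = f y\<rbrakk> \<Longrightarrow> x \<otimes> inv y \<in> K"
  shows "finite (rcosets K)"
  unfolding finite_rcosets_iff
proof (rule finite_surj[OF fin, of _ "\<lambda>v. K #> (SOME x. x \<in> carrier G \<and> f x = v)"])
  show "(\<lambda>x. K #> x) ` carrier G \<subseteq> (\<lambda>v. K #> (SOME x. x \<in> carrier G \<and> f x = v)) ` (f ` carrier G)"
  proof (rule image_subsetI)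
    fix x assume x: "x \<in> carrier G"
    let ?y = "SOME y. y \<in> carrier G \<and> f y = f x"
    have "?y \<in> carrier G \<and> f ?y = f x" by (rule someI[of _ x]) (use x in simp)
    then have "K #> x = K #> ?y" using x sep by (simp add: rcos_eq_iff[OF K])
    then show "K #> x \<in> (\<lambda>v. K #> (SOME x. x \<in> carrier G \<and> f x = v)) ` (f ` carrier G)"
      using x by blast
  qed
qed

lemma finite_rcosets_mono:
  assumes "subgroup K G" "subgroup L G" "K \<subseteq> L" "finite (rcosets K)"
  shows "finite (rcosets L)"
  using assms
  by (intro finite_rcosetsI[of L "\<lambda>x. K #> x"])
     (auto simp: rcos_eq_iff finite_rcosets_iff)

lemma finite_rcosets_INT:
  assumes "finite I" "I \<noteq> {}"
    and "\<And>i. i \<in> I \<Longrightarrow> K i \<lhd> G" "\<And>i. i \<in> I \<Longrightarrow> finite (rcosets (K i))"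
  shows "(\<Inter>i\<in>I. K i) \<lhd> G \<and> finite (rcosets (\<Inter>i\<in>I. K i))"
proof
  note sub = normal_imp_subgroup[OF assms(3)]
  have s: "subgroup (\<Inter>i\<in>I. K i) G"
    using subgroups_Inter[of "K ` I"] assms(2) sub by auto
  show "(\<Inter>i\<in>I. K i) \<lhd> G"
    unfolding normal_inv_iff using s assms(3) by (auto simp: normal_inv_iff)
  show "finite (rcosets (\<Inter>i\<in>I. K i))"
  proof (rule finite_rcosetsI[OF s, of "\<lambda>x. \<lambda>i\<in>I. K i #> x"])
    have "(\<lambda>x. \<lambda>i\<in>I. K i #> x) ` carrier G \<subseteq> PiE I (\<lambda>i. rcosets (K i))"
      by (auto simp: RCOSETS_def)
    then show "finite ((\<lambda>x. \<lambda>i\<in>I. K i #> x) ` carrier G)"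
      by (rule finite_subset) (intro finite_PiE assms)
    fix x y assume xy: "x \<in> carrier G" "y \<in> carrier G"
      "(\<lambda>i\<in>I. K i #> x) = (\<lambda>i\<in>I. K i #> y)"
    then have "K i #> x = K i #> y" if "i \<in> I" for i
      using that by (metis restrict_apply')
    then show "x \<otimes> inv y \<in> (\<Inter>i\<in>I. K i)"
      using xy sub by (auto simp: rcos_eq_iff)
  qed
qed

section \<open>Derived subgroups of finite index in finitely generated torsion groups\<close>

text \<open>Modulo \<open>D\<close> the elements of \<open>J\<close> commute, so \<open>Y\<close>
  generates a finitely generated abelian torsion group there, which is finite. The induction adjoins
  one generator, whose powers contribute finitely many cosets.\<close>

lemma finite_cover_generate:
  assumes J: "subgroup J G" and D: "D \<lhd> G" and DJ: "derived G J \<subseteq> D"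
    and tor: "\<And>g. g \<in> carrier G \<Longrightarrow> \<exists>n::nat. n > 0 \<and> g [^] n = \<one>"
    and Y: "finite Y" "Y \<subseteq> J"
  shows "\<exists>F. finite F \<and> F \<subseteq> carrier G \<and> generate G Y \<subseteq> D <#> F"
  using Y
proof (induction Y)
  case empty
  interpret D: normal D G by fact
  have "generate G {} \<subseteq> D <#> {\<one>}"
    using D.subset by (auto simp: generate_empty set_mult_def)
  then show ?case by (intro exI[of _ "{\<one>}"]) auto
next
  case (insert y Y)
  interpret D: normal D G by fact
  interpret J: subgroup J G by fact
  from insert obtain F where F: "finite F" "F \<subseteq> carrier G" "generate G Y \<subseteq> D <#> F" by auto
  have y: "y \<in> J" "y \<in> carrier G" using insert.prems J.subset by auto
  obtain N :: nat where N: "N > 0" "y [^] N = \<one>" using tor[OF y(2)] by auto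
  define H where "H = generate G Y"
  have H: "subgroup H G" "H \<subseteq> J"
    unfolding H_def
    using insert.prems J.subset by (blast intro!: generate_is_subgroup generate_subgroup_incl[OF _ J])+
  have Hc: "h \<in> carrier G" if "h \<in> H" for h using that H(2) J.subset by auto
  \<comment> \<open>Closed under products because, modulo \<open>D\<close>, powers of
    \<open>y\<close> can be moved past \<open>h\<close>.\<close>
  define U where "U = {d \<otimes> h \<otimes> y [^] n | d h (n::nat). d \<in> D \<and> h \<in> H}"
  have yJ: "y [^] n \<in> J" for n :: nat
    by (induction n) (use y in auto)
  have swap: "\<exists>d\<in>D. u \<otimes> v = d \<otimes> v \<otimes> u" if "u \<in> J" "v \<in> J" for u v
  proof (rule bexI)
    show "u \<otimes> v = (u \<otimes> v \<otimes> inv u \<otimes> inv v) \<otimes> v \<otimes> u" using that by (simp add: m_assoc J.mem_carrier)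
    show "u \<otimes> v \<otimes> inv u \<otimes> inv v \<in> D" using commutator_in_derived[OF that] DJ by blast
  qed
  have UI: "d \<otimes> h \<otimes> y [^] n \<in> U" if "d \<in> D" "h \<in> H" for d h and n :: nat
    unfolding U_def using that by blast
  have UE: "\<exists>d h. \<exists>n::nat. u = d \<otimes> h \<otimes> y [^] n \<and> d \<in> D \<and> h \<in> H" if "u \<in> U" for u
    using that unfolding U_def by blast
  note H1 = subgroup.one_closed[OF H(1)]
  have U: "subgroup U G"
  proof (rule subgroupI)
    show "U \<subseteq> carrier G" using y Hc D.subset by (auto simp: U_def)
    show "U \<noteq> {}" using UI[OF D.one_closed H1] by blast
  next
    fix u v assume "u \<in> U" "v \<in> U"
    then obtain d h n d' h' n' where u: "u = d \<otimes> h \<otimes> y [^] (n::nat)" "d \<in> D" "h \<in> H"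
      and v: "v = d' \<otimes> h' \<otimes> y [^] (n'::nat)" "d' \<in> D" "h' \<in> H" using UE by meson
    obtain e where e: "e \<in> D" "y [^] n \<otimes> h' = e \<otimes> h' \<otimes> y [^] n"
      using swap[OF yJ] v(3) H(2) by blast
    have c: "d \<in> carrier G" "d' \<in> carrier G" "h \<in> carrier G" "h' \<in> carrier G" "e \<in> carrier G"
      using u v e Hc by auto
    define w where "w = h \<otimes> y [^] n"
    have w: "w \<in> carrier G" using c y by (simp add: w_def)
    have "u \<otimes> v = d \<otimes> (w \<otimes> d' \<otimes> inv w) \<otimes> (h \<otimes> (y [^] n \<otimes> h') \<otimes> y [^] n')"
      using c y by (simp add: u v w_def m_assoc inv_mult_group)
    also have "\<dots> = (d \<otimes> (w \<otimes> d' \<otimes> inv w) \<otimes> (h \<otimes> e \<otimes> inv h)) \<otimes> (h \<otimes> h') \<otimes> y [^] (n + n')"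
      using c y w by (simp add: e m_assoc nat_pow_mult[symmetric])
    finally show "u \<otimes> v \<in> U"
      using u v e c w by (simp only:) (intro UI D.m_closed D.inv_op_closed2 subgroup.m_closed[OF H(1)])
  next
    fix u assume "u \<in> U"
    then obtain d h n where u: "u = d \<otimes> h \<otimes> y [^] (n::nat)" "d \<in> D" "h \<in> H" using UE by meson
    have hJ: "inv h \<in> H" using u H(1) by (simp add: subgroup.m_inv_closed)
    \<comment> \<open>Torsion turns the inverse of a power of \<open>y\<close> into a power with
      natural exponent, which has the shape required by \<open>U\<close>.\<close>
    have "y [^] (n * (N - 1)) \<otimes> y [^] n = (y [^] N) [^] n"
      using y N(1) by (simp add: nat_pow_mult nat_pow_pow) (metis Suc_pred add.commute mult.commute mult_Suc)
    then have inv_y: "inv (y [^] n) = y [^] (n * (N - 1))"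
      using y N by (metis inv_equality nat_pow_closed nat_pow_one)
    obtain e where e: "e \<in> D" "y [^] (n * (N - 1)) \<otimes> inv h = e \<otimes> inv h \<otimes> y [^] (n * (N - 1))"
      using swap[OF yJ] hJ H(2) by blast
    have c: "d \<in> carrier G" "h \<in> carrier G" "e \<in> carrier G" using u e Hc by auto
    define w where "w = y [^] (n * (N - 1)) \<otimes> inv h"
    have w: "w \<in> carrier G" using c y by (simp add: w_def)
    have "inv u = (w \<otimes> inv d \<otimes> inv w) \<otimes> w"
      using c y w by (simp add: u inv_mult_group inv_y m_assoc w_def)
    also have "\<dots> = ((w \<otimes> inv d \<otimes> inv w) \<otimes> e) \<otimes> inv h \<otimes> y [^] (n * (N - 1))"
      using c y w e(2) unfolding w_def[symmetric] by (simp add: m_assoc)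
    finally show "inv u \<in> U"
      using u e w hJ by (simp only:) (intro UI D.m_closed D.inv_op_closed2 D.m_inv_closed)
  qed
  have "insert y Y \<subseteq> U"
  proof -
    have "y \<in> U" using UI[OF D.one_closed H1, of 1] y by simp
    moreover have "x \<in> U" if "x \<in> Y" for x
    proof -
      have xH: "x \<in> H" using that by (auto simp: H_def generate.incl)
      then show ?thesis using UI[OF D.one_closed xH, of 0] Hc by simp
    qed
    ultimately show ?thesis by auto
  qed
  then have gU: "generate G (insert y Y) \<subseteq> U" using U by (rule generate_subgroup_incl)
  define F' where "F' = (\<lambda>(f, n). f \<otimes> y [^] n) ` (F \<times> {..<N})"
  have "U \<subseteq> D <#> F'"
  proof
    fix u assume "u \<in> U"
    then obtain d h n where u: "u = d \<otimes> h \<otimes> y [^] (n::nat)" "d \<in> D" "h \<in> H" using UE by meson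
    then obtain d' f where f: "d' \<in> D" "f \<in> F" "h = d' \<otimes> f"
      using F(3) unfolding H_def set_mult_def by blast
    have "n = n mod N + N * (n div N)" by simp
    then have "y [^] n = y [^] (n mod N) \<otimes> (y [^] N) [^] (n div N)"
      using y by (metis nat_pow_mult nat_pow_pow)
    then have yn: "y [^] n = y [^] (n mod N)" using y N(2) by simp
    have "u = (d \<otimes> d') \<otimes> (f \<otimes> y [^] (n mod N))"
      using u f F(2) y yn D.subset by (simp add: m_assoc subset_iff)
    moreover have "f \<otimes> y [^] (n mod N) \<in> F'" using f(2) N(1) by (auto simp: F'_def)
    ultimately show "u \<in> D <#> F'" unfolding set_mult_def using u f by blast
  qed
  moreover have "finite F'" "F' \<subseteq> carrier G" using F y by (auto simp: F'_def)
  ultimately show ?case using gU by blast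
qed

text \<open>Schreier's rewriting: multiplying by one more generator replaces the representative in
  \<open>T\<close> and adds a factor from \<open>Y\<close> on its left.\<close>

lemma schreier:
  assumes S: "finite S" "S \<subseteq> carrier G" "carrier G = generate G S"
    and J: "subgroup J G" "finite (rcosets J)"
  shows "\<exists>Y T. finite Y \<and> Y \<subseteq> J \<and> finite T \<and> T \<subseteq> carrier G \<and> carrier G \<subseteq> generate G Y <#> T"
proof -
  interpret J: subgroup J G by fact
  define t where "t C = (SOME x. x \<in> carrier G \<and> C = J #> x)" for C
  \<comment> \<open>\<open>\<one>\<close> is added so that the rewriting can start there.
    Representatives are then not unique, and \<open>Y\<close> collects all products that land in
    \<open>J\<close>.\<close>
  define T where "T = insert \<one> (t ` (rcosets J))"
  have t: "t C \<in> carrier G" "C = J #> t C" if "C \<in> rcosets J" for C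
    using someI_ex[of "\<lambda>x. x \<in> carrier G \<and> C = J #> x"] that
    unfolding t_def RCOSETS_def by blast+
  have T: "finite T" "T \<subseteq> carrier G" using J t by (auto simp: T_def)
  have rep: "\<exists>u\<in>T. x \<otimes> inv u \<in> J" if "x \<in> carrier G" for x
  proof -
    have "J #> x \<in> rcosets J" using that J.subset by (rule rcosetsI[rotated])
    then have "J #> x = J #> t (J #> x)" "t (J #> x) \<in> T" "t (J #> x) \<in> carrier G"
      using t by (auto simp: T_def)
    then show ?thesis using rcos_eq_iff[OF J(1)] that by blast
  qed
  define S' where "S' = S \<union> m_inv G ` S"
  have S': "finite S'" "S' \<subseteq> carrier G" using S(1,2) by (auto simp: S'_def)
  define Y where "Y = J \<inter> (\<lambda>(u, x, v). u \<otimes> x \<otimes> inv v) ` (T \<times> S' \<times> T)"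
  have Yc: "Y \<subseteq> carrier G" using J.subset by (auto simp: Y_def)
  have step: "w \<otimes> x \<in> generate G Y <#> T" if w: "w \<in> generate G Y <#> T" and x: "x \<in> S'" for w x
  proof -
    obtain h u where h: "h \<in> generate G Y" "u \<in> T" "w = h \<otimes> u" using w by (auto simp: set_mult_def)
    have hc: "h \<in> carrier G" "u \<in> carrier G" "x \<in> carrier G"
      using generate_in_carrier[OF Yc h(1)] h T x S' by auto
    obtain v where v: "v \<in> T" "u \<otimes> x \<otimes> inv v \<in> J" using rep[of "u \<otimes> x"] hc by auto
    have vc: "v \<in> carrier G" using v T by auto
    have "u \<otimes> x \<otimes> inv v \<in> Y" unfolding Y_def using h v x by force
    then have "h \<otimes> (u \<otimes> x \<otimes> inv v) \<in> generate G Y" using h(1) by (blast intro: generate.intros)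
    moreover have "w \<otimes> x = h \<otimes> (u \<otimes> x \<otimes> inv v) \<otimes> v" using hc vc h by (simp add: m_assoc)
    ultimately show ?thesis using v(1) by (auto simp: set_mult_def)
  qed
  have gen: "w \<otimes> g \<in> generate G Y <#> T" if "g \<in> generate G S" "w \<in> generate G Y <#> T" for g w
    using that
  proof (induction g arbitrary: w rule: generate.induct)
    case one
    then have "w \<in> carrier G" using generate_incl[OF Yc] T by (auto simp: set_mult_def)
    then show ?case using one by simp
  next
    case (incl h) then show ?case by (intro step) (auto simp: S'_def)
  next
    case (inv h) then show ?case by (intro step) (auto simp: S'_def)
  next
    case (eng g h)
    have "w \<in> carrier G" using eng.prems generate_incl[OF Yc] T by (auto simp: set_mult_def)
    moreover have "g \<in> carrier G" "h \<in> carrier G"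
      using eng generate_in_carrier[OF S(2)] by auto
    ultimately show ?case using eng.IH(2)[OF eng.IH(1)[OF eng.prems]] by (simp add: m_assoc)
  qed
  have one: "\<one> \<in> generate G Y <#> T"
    unfolding set_mult_def using generate.one[of G Y] by (auto simp: T_def intro!: bexI[of _ \<one>])
  have "carrier G \<subseteq> generate G Y <#> T"
  proof
    fix g assume "g \<in> carrier G"
    then show "g \<in> generate G Y <#> T" using gen[OF _ one, of g] S(3) by simp
  qed
  moreover have "finite Y" "Y \<subseteq> J" using T S' by (auto simp: Y_def)
  ultimately show ?thesis using T by blast
qed

text \<open>The quotient of \<open>J\<close> by its derived subgroup is an abelian torsion group,
  and Schreier generators make it finitely generated, hence finite.\<close>

lemma finite_rcosets_derived:
  assumes S: "finite S" "S \<subseteq> carrier G" "carrier G = generate G S"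
    and tor: "\<And>g. g \<in> carrier G \<Longrightarrow> \<exists>n::nat. n > 0 \<and> g [^] n = \<one>"
    and J: "J \<lhd> G" "finite (rcosets J)"
  shows "finite (rcosets (derived G J))"
proof -
  note Js = normal_imp_subgroup[OF J(1)]
  have D: "derived G J \<lhd> G" using J(1) by (rule derived_is_normal)
  interpret D: normal "derived G J" G by fact
  obtain Y T where YT: "finite Y" "Y \<subseteq> J" "finite T" "T \<subseteq> carrier G"
    "carrier G \<subseteq> generate G Y <#> T"
    using schreier[OF S Js J(2)] by auto
  obtain F where F: "finite F" "F \<subseteq> carrier G" "generate G Y \<subseteq> derived G J <#> F"
    using finite_cover_generate[OF Js D subset_refl tor YT(1,2)] by auto
  have "(\<lambda>x. derived G J #> x) ` carrier G \<subseteq> (\<lambda>(f, t). derived G J #> (f \<otimes> t)) ` (F \<times> T)"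
  proof clarify
    fix g assume g: "g \<in> carrier G"
    then obtain y t where 1: "y \<in> generate G Y" "t \<in> T" "g = y \<otimes> t"
      using YT(5) unfolding set_mult_def by blast
    then obtain d f where 2: "d \<in> derived G J" "f \<in> F" "y = d \<otimes> f"
      using F(3) unfolding set_mult_def by blast
    have c: "d \<in> carrier G" "f \<in> carrier G" "t \<in> carrier G" using 1 2 F YT by auto
    have "g \<otimes> inv (f \<otimes> t) = d" using 1 2 c by (simp add: m_assoc inv_mult_group)
    then have "derived G J #> g = derived G J #> (f \<otimes> t)"
      using rcos_eq_iff[OF D.subgroup_axioms] 2 c g by simp
    then show "derived G J #> g \<in> (\<lambda>(f, t). derived G J #> (f \<otimes> t)) ` (F \<times> T)"
      using 1 2 by auto
  qed
  then show ?thesis unfolding finite_rcosets_iff using F YT by (meson finite_SigmaI finite_imageI finite_subset)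
qed

end

section \<open>Finite p-groups\<close>

text \<open>Cauchy's theorem, taken from Sylow's theorem with exponent 1: a prime \<open>q\<close>
  dividing the order yields an element of order \<open>q\<close>, which must divide a power of
  \<open>p\<close>.\<close>

lemma (in group) order_eq_prime_power:
  assumes p: "Factorial_Ring.prime p" and fin: "finite (carrier G)"
    and pow: "\<And>g. g \<in> carrier G \<Longrightarrow> \<exists>k::nat. g [^] (p ^ k) = \<one>"
  shows "\<exists>k. order G = p ^ k"
proof -
  have pos: "order G > 0" using fin by (simp add: order_gt_0_iff_finite)
  have "q = p" if q: "Factorial_Ring.prime q" "q dvd order G" for q
  proof -
    obtain m where "order G = q * m" using q(2) by (rule dvdE)
    then have "order G = q ^ 1 * m" by simp
    then obtain H where H: "subgroup H G" "card H = q ^ 1"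
      using sylow_thm[OF q(1) is_group, of 1 m] fin by blast
    have "H \<noteq> {\<one>}" using H(2) q(1) by auto
    then obtain h where h: "h \<in> H" "h \<noteq> \<one>" using subgroup.one_closed[OF H(1)] by blast
    have hc: "h \<in> carrier G" using h(1) H(1) by (rule subgroup.mem_carrier[rotated])
    interpret H: group "G\<lparr>carrier := H\<rparr>" using H(1) by (rule subgroup_imp_group)
    have "h [^] q = \<one>"
      using H.pow_order_eq_1[of h] h(1) H(2) by (simp add: order_def flip: nat_pow_consistent)
    moreover obtain k where "h [^] (p ^ k) = \<one>" using pow[OF hc] by auto
    ultimately have dv: "ord h dvd q" "ord h dvd p ^ k" using hc by (simp_all add: pow_eq_id)
    have "ord h \<noteq> 1" using h(2) ord_eq_1[OF hc] by blast
    then have "ord h = q" using dv(1) q(1) by (meson prime_nat_iff)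
    then have "q dvd p" using dv(2) q(1) prime_dvd_power by blast
    then show ?thesis using p q(1) by (simp add: primes_dvd_imp_eq)
  qed
  note only_p = this
  have "\<not> is_unit p" using p by auto
  then obtain m where m: "order G = p ^ multiplicity p (order G) * m" "\<not> p dvd m"
    using multiplicity_decompose'[of "order G" p] pos by auto
  have "m = 1"
  proof (rule ccontr)
    assume "m \<noteq> 1"
    then obtain q where q: "Factorial_Ring.prime q" "q dvd m" using prime_factor_nat by blast
    then have "q dvd order G" using m(1) by (metis dvd_mult)
    then show False using only_p q m(2) by blast
  qed
  then show ?thesis using m(1) by (metis mult_1_right)
qed

text \<open>Class equation: if only \<open>\<one>\<close> were central, all other conjugacy classes
  would have size divisible by \<open>p\<close>, and the order would be 1 modulo
  \<open>p\<close>.\<close>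

lemma (in group) prime_power_order_center:
  assumes p: "Factorial_Ring.prime p" and fin: "finite (carrier G)"
    and ord: "order G = p ^ k" "k > 0"
  shows "\<exists>z\<in>carrier G. z \<noteq> \<one> \<and> (\<forall>g\<in>carrier G. g \<otimes> z = z \<otimes> g)"
proof (rule ccontr)
  assume neg: "\<not> ?thesis"
  define \<phi> where "\<phi> = (\<lambda>g. (\<lambda>h\<in>carrier G. g \<otimes> h \<otimes> inv g))"
  interpret act: group_action G "carrier G" \<phi>
    unfolding \<phi>_def by (rule action_by_conjugation)
  let ?O = "orbits G (carrier G) \<phi>"
  have orb1: "orbit G \<phi> \<one> = {\<one>}" by (force simp: orbit_def \<phi>_def)
  then have O1: "{\<one>} \<in> ?O" unfolding orbits_def by blast
  have finO: "finite ?O" unfolding orbits_def using fin by simp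
  have dvd: "p dvd card Ob" if "Ob \<in> ?O - {{\<one>}}" for Ob
  proof -
    from that obtain x where x: "x \<in> carrier G" "Ob = orbit G \<phi> x"
      unfolding orbits_def by (elim DiffE CollectE exE conjE)
    have xX: "x \<in> Ob" using x act.orbit_refl by simp
    have "x \<noteq> \<one>" using that x orb1 by blast
    then obtain g where g: "g \<in> carrier G" "g \<otimes> x \<noteq> x \<otimes> g" using neg x by blast
    have "g \<otimes> x \<otimes> inv g \<noteq> x" using g x by (metis inv_solve_right m_closed)
    moreover have "g \<otimes> x \<otimes> inv g \<in> Ob" using g x by (auto simp: orbit_def \<phi>_def)
    ultimately have "card Ob \<noteq> 1" using xX by (metis card_1_singletonE singletonD)
    moreover have "card Ob dvd p ^ k"
      using act.orbit_stabilizer_theorem[OF x(1)] ord x by (metis dvd_triv_left)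
    ultimately show ?thesis
      using p by (metis (no_types, lifting) divides_primepow_nat dvd_power not_gr_zero power_0)
  qed
  have "order G = (\<Sum>Ob\<in>?O. card Ob)"
    using act.disjoint_sum[OF fin, of "\<lambda>_. 1::nat"] by (simp add: order_def)
  also have "\<dots> = 1 + (\<Sum>Ob\<in>?O - {{\<one>}}. card Ob)"
    using sum.remove[OF finO O1, of card] by simp
  finally have "order G = 1 + (\<Sum>Ob\<in>?O - {{\<one>}}. card Ob)" .
  moreover have "p dvd (\<Sum>Ob\<in>?O - {{\<one>}}. card Ob)" by (rule dvd_sum) (rule dvd)
  moreover have "p dvd order G" using ord by simp
  ultimately have "p dvd 1" by (metis dvd_add_left_iff)
  then show False using p by simp
qed

subsection \<open>Subgroups that are full modulo the derived subgroup\<close>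

context group
begin

text \<open>Equivalent to \<open>M\<close> mapping onto the abelianization. Quantifying over
  overgroups makes the negation hand over a proper subgroup that contains both \<open>M\<close> and
  the derived subgroup.\<close>

definition full_mod_derived :: "'a set \<Rightarrow> bool" where
  "full_mod_derived M \<longleftrightarrow> subgroup M G \<and>
    (\<forall>N. subgroup N G \<and> M \<subseteq> N \<and> derived G (carrier G) \<subseteq> N \<longrightarrow> N = carrier G)"

lemma full_mod_derived_subgroup: "full_mod_derived M \<Longrightarrow> subgroup M G"
  by (simp add: full_mod_derived_def)

lemma full_mod_derivedD:
  "\<lbrakk>full_mod_derived M; subgroup N G; M \<subseteq> N; derived G (carrier G) \<subseteq> N\<rbrakk> \<Longrightarrow> N = carrier G"
  by (simp add: full_mod_derived_def)

lemma subgroup_mult_normal: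
  assumes M: "subgroup M G" and K: "K \<lhd> G"
  shows "subgroup {m \<otimes> k | m k. m \<in> M \<and> k \<in> K} G"
proof -
  interpret M: subgroup M G by fact
  interpret K: normal K G by fact
  let ?P = "{m \<otimes> k | m k. m \<in> M \<and> k \<in> K}"
  have PI: "m \<otimes> k \<in> ?P" if "m \<in> M" "k \<in> K" for m k using that by blast
  have PE: "\<exists>m k. x = m \<otimes> k \<and> m \<in> M \<and> k \<in> K" if "x \<in> ?P" for x using that by blast
  show ?thesis
  proof (rule subgroupI)
    show "?P \<noteq> {}" using PI[OF M.one_closed K.one_closed] by blast
    show "?P \<subseteq> carrier G"
    proof
      fix x assume "x \<in> ?P" then show "x \<in> carrier G" using PE[of x] by force
    qed
  next
    fix x assume "x \<in> ?P"
    from PE[OF this] obtain m k where x: "x = m \<otimes> k" "m \<in> M" "k \<in> K" by (elim exE conjE)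
    have "inv x = inv m \<otimes> (m \<otimes> inv k \<otimes> inv m)"
      using x by (simp add: inv_mult_group m_assoc)
    then show "inv x \<in> ?P"
      using x PI[of "inv m" "m \<otimes> inv k \<otimes> inv m"] K.inv_op_closed2[of m "inv k"] by simp
  next
    fix x y assume xy: "x \<in> ?P" "y \<in> ?P"
    from PE[OF xy(1)] obtain m k where x: "x = m \<otimes> k" "m \<in> M" "k \<in> K" by (elim exE conjE)
    from PE[OF xy(2)] obtain m' k' where y: "y = m' \<otimes> k'" "m' \<in> M" "k' \<in> K" by (elim exE conjE)
    have "x \<otimes> y = (m \<otimes> m') \<otimes> ((inv m' \<otimes> k \<otimes> m') \<otimes> k')"
      using x y by (simp add: m_assoc)
    moreover have "(inv m' \<otimes> k \<otimes> m') \<otimes> k' \<in> K" "m \<otimes> m' \<in> M"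
      using x y K.inv_op_closed1[of m' k] by simp_all
    ultimately show "x \<otimes> y \<in> ?P" using PI by (simp only:)
  qed
qed

text \<open>The induction replaces \<open>K\<close> by the preimage of the centre of \<open>G / K\<close>, which is larger than
  \<open>K\<close> because \<open>G / K\<close> is a finite \<open>p\<close>-group.\<close>

lemma full_mod_derived_supplement:
  fixes p :: nat
  assumes p: "Factorial_Ring.prime p"
    and pow: "\<And>g. g \<in> carrier G \<Longrightarrow> \<exists>k::nat. g [^] (p ^ k) = \<one>"
    and M: "full_mod_derived M" and K: "K \<lhd> G" "finite (rcosets K)"
    and g: "g \<in> carrier G"
  shows "\<exists>m\<in>M. \<exists>k\<in>K. g = m \<otimes> k"
  using K g
proof (induction "card (rcosets K)" arbitrary: K g rule: less_induct)
  case less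
  interpret K: normal K G by fact
  interpret M: subgroup M G using M by (rule full_mod_derived_subgroup)
  show ?case
  proof (cases "K = carrier G")
    case True
    then have "\<one> \<in> M" "g \<in> K" "g = \<one> \<otimes> g" using less.prems by simp_all
    then show ?thesis by (intro bexI)
  next
    case False
    interpret Q: group "G Mod K" by (rule K.factorgroup_is_group)
    have fin: "finite (carrier (G Mod K))" using less.prems by (simp add: FactGroup_def)
    have "\<exists>k::nat. C [^]\<^bsub>G Mod K\<^esub> (p ^ k) = \<one>\<^bsub>G Mod K\<^esub>" if C: "C \<in> carrier (G Mod K)" for C
    proof -
      obtain x where x: "x \<in> carrier G" "C = K #> x" using C by (auto simp: carrier_FactGroup)
      obtain k where "x [^] (p ^ k) = \<one>" using pow[OF x(1)] by auto
      then have "C [^]\<^bsub>G Mod K\<^esub> (p ^ k) = \<one>\<^bsub>G Mod K\<^esub>"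
        using K.FactGroup_pow[OF x(1)] x(2) K.subset by (simp add: coset_mult_one)
      then show ?thesis ..
    qed
    then obtain k where k: "order (G Mod K) = p ^ k"
      using Q.order_eq_prime_power[OF p fin] by blast
    have "k \<noteq> 0"
    proof
      assume "k = 0"
      then have "carrier (G Mod K) = {\<one>\<^bsub>G Mod K\<^esub>}" using k Q.order_one_triv_iff by simp
      then have "K #> x = K" if "x \<in> carrier G" for x using that by (auto simp: carrier_FactGroup)
      then have "carrier G \<subseteq> K" by (metis K.subgroup_axioms rcos_self subsetI)
      then show False using False K.subset by blast
    qed
    then obtain C where C: "C \<in> carrier (G Mod K)" "C \<noteq> \<one>\<^bsub>G Mod K\<^esub>"
      and comm: "\<And>B. B \<in> carrier (G Mod K) \<Longrightarrow> B \<otimes>\<^bsub>G Mod K\<^esub> C = C \<otimes>\<^bsub>G Mod K\<^esub> B"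
      using Q.prime_power_order_center[OF p fin k] by blast
    obtain z where z: "z \<in> carrier G" "C = K #> z" using C by (auto simp: carrier_FactGroup)
    define Z where "Z = (\<Inter>x\<in>carrier G. {w \<in> carrier G. w \<otimes> x \<otimes> inv w \<otimes> inv x \<in> K})"
    have Zs: "subgroup Z G" unfolding Z_def
      by (rule subgroups_Inter) (use centralizer_mod_subgroup[OF less.prems(1)] in auto)
    have ZI: "w \<in> Z \<longleftrightarrow> w \<in> carrier G \<and> (\<forall>x\<in>carrier G. w \<otimes> x \<otimes> inv w \<otimes> inv x \<in> K)" for w
      unfolding Z_def using one_closed by blast
    have KZ: "K \<subseteq> Z"
    proof
      fix w assume w: "w \<in> K"
      have "w \<otimes> (x \<otimes> inv w \<otimes> inv x) \<in> K" if "x \<in> carrier G" for x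
        using w that by (intro K.m_closed K.inv_op_closed2) auto
      then show "w \<in> Z" using w by (simp add: ZI m_assoc)
    qed
    have zZ: "z \<in> Z"
    proof -
      have "K #> (z \<otimes> x) = K #> (x \<otimes> z)" if "x \<in> carrier G" for x
        using comm[of "K #> x"] that z K.rcos_sum by (simp add: carrier_FactGroup)
      then have "z \<otimes> x \<otimes> inv (x \<otimes> z) \<in> K" if "x \<in> carrier G" for x
        using that z by (simp add: rcos_eq_iff[OF K.subgroup_axioms] del: inv_mult_group)
      then show ?thesis using z by (simp add: ZI inv_mult_group m_assoc)
    qed
    have ZN: "Z \<lhd> G" unfolding normal_inv_iff
    proof (intro conjI ballI Zs)
      fix x w assume x: "x \<in> carrier G" and w: "w \<in> Z"
      have wc: "w \<in> carrier G" using w ZI by simp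
      have "w \<otimes> x \<otimes> inv w \<otimes> inv x \<in> K" using w x ZI by simp
      then have "x \<otimes> w \<otimes> inv x \<otimes> inv w \<in> Z"
        using commutator_sym[OF K.subgroup_axioms wc x] KZ by blast
      then have "(x \<otimes> w \<otimes> inv x \<otimes> inv w) \<otimes> w \<in> Z" using w Zs by (simp add: subgroup.m_closed)
      then show "x \<otimes> w \<otimes> inv x \<in> Z" using x wc by (simp add: m_assoc)
    qed
    have finZ: "finite (rcosets Z)"
      using finite_rcosets_mono[OF K.subgroup_axioms Zs KZ less.prems(2)] .
    have "card (rcosets Z) < card (rcosets K)"
    proof -
      define f where "f C = Z #> (SOME x. x \<in> carrier G \<and> C = K #> x)" for C
      have f: "f (K #> x) = Z #> x" if x: "x \<in> carrier G" for x
      proof -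
        let ?y = "SOME y. y \<in> carrier G \<and> K #> x = K #> y"
        have y: "?y \<in> carrier G \<and> K #> x = K #> ?y" by (rule someI[of _ x]) (use x in simp)
        then have "x \<otimes> inv ?y \<in> Z" using rcos_eq_iff[OF K.subgroup_axioms x] KZ by blast
        then show ?thesis unfolding f_def using rcos_eq_iff[OF Zs x] y by metis
      qed
      have im: "f ` (rcosets K) = rcosets Z" unfolding RCOSETS_def using f by force
      have "f (K #> z) = f (K #> \<one>)"
        using f[OF z(1)] f[OF one_closed] zZ z(1) by (simp add: rcos_eq_iff[OF Zs])
      moreover have "K #> z \<noteq> K #> \<one>" using C z K.subset by simp
      ultimately have "\<not> inj_on f (rcosets K)"
        using z(1) unfolding inj_on_def RCOSETS_def by blast
      then have "card (f ` (rcosets K)) \<noteq> card (rcosets K)"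
        using less.prems(2) eq_card_imp_inj_on by blast
      then show ?thesis using im card_image_le[OF less.prems(2), of f] by simp
    qed
    note IH = less.hyps[OF this ZN finZ]
    define N where "N = {m \<otimes> k | m k. m \<in> M \<and> k \<in> K}"
    have N: "subgroup N G" unfolding N_def
      by (rule subgroup_mult_normal[OF M.subgroup_axioms less.prems(1)])
    have NI: "m \<otimes> k \<in> N" if "m \<in> M" "k \<in> K" for m k unfolding N_def using that by blast
    have MN: "M \<subseteq> N"
    proof
      fix m assume "m \<in> M"
      then show "m \<in> N" using NI[OF _ K.one_closed, of m] by simp
    qed
    have KN: "K \<subseteq> N"
    proof
      fix k assume "k \<in> K"
      then show "k \<in> N" using NI[OF M.one_closed, of k] by simp
    qed
    \<comment> \<open>By the induction hypothesis \<open>x\<close> and \<open>y\<close> are elements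
      of \<open>M\<close> times elements that are central modulo \<open>K\<close>. Their commutator
      therefore agrees modulo \<open>K\<close> with a commutator of elements of
      \<open>M\<close>.\<close>
    have "x \<otimes> y \<otimes> inv x \<otimes> inv y \<in> N" if xy: "x \<in> carrier G" "y \<in> carrier G" for x y
    proof -
      from IH[OF xy(1)] obtain m w where x: "m \<in> M" "w \<in> Z" "x = m \<otimes> w" by (elim bexE)
      from IH[OF xy(2)] obtain m' w' where y: "m' \<in> M" "w' \<in> Z" "y = m' \<otimes> w'" by (elim bexE)
      have c: "w \<in> carrier G" "w' \<in> carrier G" "m \<in> carrier G" "m' \<in> carrier G" using x y ZI by auto
      have mm: "m' \<otimes> m \<otimes> inv m' \<otimes> inv m \<in> N" using x(1) y(1) by (intro subsetD[OF MN]) simp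
      have cen: "u \<otimes> (v \<otimes> t \<otimes> inv v \<otimes> inv t) \<otimes> inv u \<in> N"
        if "u \<in> carrier G" "v \<in> Z" "t \<in> carrier G" for u v t
        using that by (intro subsetD[OF KN] K.inv_op_closed2) (simp_all add: ZI)
      have "y \<otimes> m \<otimes> inv y \<otimes> inv m \<in> N"
        unfolding y(3) commutator_mult[OF c(4,2,3)]
        by (rule subgroup.m_closed[OF N cen[OF c(4) y(2) c(3)] mm])
      then have my: "m \<otimes> y \<otimes> inv m \<otimes> inv y \<in> N"
        using commutator_sym[OF N xy(2) c(3)] by simp
      show ?thesis
        unfolding x(3) commutator_mult[OF c(3,1) xy(2)]
        by (rule subgroup.m_closed[OF N cen[OF c(3) x(2) xy(2)] my])
    qed
    then have "derived G (carrier G) \<subseteq> N" by (simp add: derived_incl_iff[OF N])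
    then have "N = carrier G" using full_mod_derivedD[OF M N MN] by simp
    then have "g \<in> N" using less.prems by simp
    then show ?thesis unfolding N_def by blast
  qed
qed

end

section \<open>Self-similar groups\<close>

lemma sum_mod_reindex:
  fixes f :: "int \<Rightarrow> 'b::comm_monoid_add"
  assumes p: "p > 0" and r: "coprime r p" and f: "\<And>x. f (x mod p) = f x"
  shows "(\<Sum>i\<in>{0..<p}. f (c + i * r)) = (\<Sum>i\<in>{0..<p}. f i)"
proof -
  let ?g = "\<lambda>i. (c + i * r) mod p"
  have inj: "inj_on ?g {0..<p}"
  proof (rule inj_onI)
    fix i j assume ij: "i \<in> {0..<p}" "j \<in> {0..<p}" "?g i = ?g j"
    then have "p dvd (c + i * r) - (c + j * r)" by (simp only: mod_eq_dvd_iff)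
    then have "p dvd (i - j) * r" by (simp add: algebra_simps)
    then have "p dvd i - j" using r by (simp add: coprime_commute coprime_dvd_mult_left_iff)
    then have "i mod p = j mod p" by (simp only: mod_eq_dvd_iff)
    then show "i = j" using ij by simp
  qed
  have "?g ` {0..<p} \<subseteq> {0..<p}" using p by auto
  then have "?g ` {0..<p} = {0..<p}" using inj by (intro endo_inj_surj) auto
  then have "bij_betw ?g {0..<p} {0..<p}" using inj by (simp add: bij_betw_def)
  then have "(\<Sum>i\<in>{0..<p}. f (?g i)) = (\<Sum>i\<in>{0..<p}. f i)" by (rule sum.reindex_bij_betw)
  then show ?thesis by (simp add: f)
qed

text \<open>A group acting on the regular rooted tree whose vertices of level one are indexed by the
  integers modulo \<open>p\<close>: \<open>g\<close> shifts the first letter by \<open>rot g\<close>, and \<open>sec g x\<close> is its section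
  at \<open>x\<close>.\<close>

locale self_similar = group G for G (structure) +
  fixes p :: nat and rot :: "'a \<Rightarrow> int" and sec :: "'a \<Rightarrow> int \<Rightarrow> 'a"
  assumes p_pos: "p > 0"
    and rot_mult: "\<lbrakk>g \<in> carrier G; h \<in> carrier G\<rbrakk> \<Longrightarrow> rot (g \<otimes> h) = (rot g + rot h) mod int p"
    and sec_closed [simp]: "g \<in> carrier G \<Longrightarrow> sec g x \<in> carrier G"
    and sec_mod [simp]: "g \<in> carrier G \<Longrightarrow> sec g (x mod int p) = sec g x"
    and sec_mult: "\<lbrakk>g \<in> carrier G; h \<in> carrier G\<rbrakk> \<Longrightarrow> sec (g \<otimes> h) x = sec g x \<otimes> sec h (x + rot g)"
begin

lemma rot_bounds:
  assumes "g \<in> carrier G" shows "0 \<le> rot g" "rot g < int p"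
proof -
  have "rot g = (rot g + rot \<one>) mod int p" using rot_mult[OF assms one_closed] assms by simp
  then show "0 \<le> rot g" "rot g < int p"
    using p_pos pos_mod_sign[of "int p" "rot g + rot \<one>"] pos_mod_bound[of "int p" "rot g + rot \<one>"]
    by linarith+
qed

lemma rot_mod [simp]: "g \<in> carrier G \<Longrightarrow> rot g mod int p = rot g"
  using rot_bounds by simp

lemma rot_one [simp]: "rot \<one> = 0"
proof -
  have "(rot \<one> + rot \<one>) mod int p = rot \<one> mod int p" using rot_mult[of \<one> \<one>] by simp
  then have "int p dvd (rot \<one> + rot \<one>) - rot \<one>" by (simp only: mod_eq_dvd_iff)
  then have "int p dvd rot \<one>" by simp
  then show ?thesis using rot_mod[OF one_closed] by simp
qed

lemma sec_cong: "\<lbrakk>g \<in> carrier G; x mod int p = y mod int p\<rbrakk> \<Longrightarrow> sec g x = sec g y"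
  using sec_mod by metis

lemma sec_one [simp]: "sec \<one> x = \<one>"
  using sec_mult[of \<one> \<one> x] by simp

lemma rot_inv: "g \<in> carrier G \<Longrightarrow> rot (inv g) = (- rot g) mod int p"
proof -
  assume g: "g \<in> carrier G"
  have "(rot g + rot (inv g)) mod int p = 0" using rot_mult[of g "inv g"] g by simp
  then have "int p dvd rot (inv g) - (- rot g)" by (simp add: mod_eq_0_iff_dvd add.commute)
  then have "rot (inv g) mod int p = (- rot g) mod int p" by (simp only: mod_eq_dvd_iff)
  then show ?thesis using g by simp
qed

lemma sec_inv:
  assumes g: "g \<in> carrier G" shows "sec (inv g) x = inv (sec g (x - rot g))"
proof -
  have "sec g (x - rot g) \<otimes> sec (inv g) x = \<one>"
    using sec_mult[of g "inv g" "x - rot g"] g by simp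
  then have "inv (sec (inv g) x) = sec g (x - rot g)" using g by (intro inv_equality) auto
  then have "inv (inv (sec (inv g) x)) = inv (sec g (x - rot g))" by (rule arg_cong)
  then show ?thesis using g by simp
qed

lemma rot_nat_pow: "g \<in> carrier G \<Longrightarrow> rot (g [^] (n::nat)) = (int n * rot g) mod int p"
  by (induction n) (simp_all add: rot_mult mod_add_left_eq mod_add_right_eq distrib_right add.commute)

lemma rot_int_pow:
  assumes g: "g \<in> carrier G" shows "rot (g [^] (n::int)) = (n * rot g) mod int p"
proof (cases n)
  case (nonneg m)
  then show ?thesis using g rot_nat_pow[of g m] by (simp add: int_pow_int)
next
  case (neg m)
  then have "rot (g [^] n) = (- ((int (Suc m) * rot g) mod int p)) mod int p"
    using g rot_inv[of "g [^] Suc m"] rot_nat_pow[of g "Suc m"] int_pow_neg_int[of g "Suc m"]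
    by (simp del: nat_pow_Suc)
  also have "\<dots> = (- (int (Suc m) * rot g)) mod int p" by (rule mod_minus_eq)
  also have "- (int (Suc m) * rot g) = n * rot g" unfolding neg by (simp add: algebra_simps)
  finally show ?thesis .
qed

lemma sec_nat_pow: "\<lbrakk>g \<in> carrier G; rot g = 0\<rbrakk> \<Longrightarrow> sec (g [^] (n::nat)) x = sec g x [^] n"
  by (induction n) (simp_all add: sec_mult rot_nat_pow)

lemma rot_div: "\<lbrakk>g \<in> carrier G; h \<in> carrier G; rot g = rot h\<rbrakk> \<Longrightarrow> rot (g \<otimes> inv h) = 0"
  by (simp add: rot_mult rot_inv mod_simps)

lemma sec_div:
  assumes "g \<in> carrier G" "h \<in> carrier G" "rot g = rot h"
  shows "sec (g \<otimes> inv h) x = sec g x \<otimes> inv (sec h x)"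
  using assms by (simp add: sec_mult sec_inv)

lemma rot_conj:
  "\<lbrakk>g \<in> carrier G; h \<in> carrier G\<rbrakk> \<Longrightarrow> rot (g \<otimes> h \<otimes> inv g) = rot h"
  by (simp add: rot_mult rot_inv mod_simps)

lemma sec_conj:
  assumes "g \<in> carrier G" "h \<in> carrier G" "rot h = 0"
  shows "sec (g \<otimes> h \<otimes> inv g) x = sec g x \<otimes> sec h (x + rot g) \<otimes> inv (sec g x)"
proof -
  have "sec (g \<otimes> h \<otimes> inv g) x = sec g x \<otimes> sec h (x + rot g) \<otimes> inv (sec g (x + rot (g \<otimes> h) - rot g))"
    using assms by (simp add: sec_mult sec_inv)
  also have "sec g (x + rot (g \<otimes> h) - rot g) = sec g x"
    using assms by (intro sec_cong) (simp_all add: rot_mult mod_simps)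
  finally show ?thesis .
qed

lemma sec_commutator:
  assumes "g \<in> carrier G" "h \<in> carrier G" "rot g = 0" "rot h = 0"
  shows "sec (g \<otimes> h \<otimes> inv g \<otimes> inv h) x = sec g x \<otimes> sec h x \<otimes> inv (sec g x) \<otimes> inv (sec h x)"
    "rot (g \<otimes> h \<otimes> inv g \<otimes> inv h) = 0"
  using assms by (simp_all add: sec_mult sec_inv rot_mult rot_inv)

lemma rot_commutator:
  assumes "g \<in> carrier G" "h \<in> carrier G"
  shows "rot (g \<otimes> h \<otimes> inv g \<otimes> inv h) = 0"
  using assms by (simp add: rot_mult rot_inv mod_simps)

lemma subgroup_sec_in:
  assumes M: "subgroup M G" and Q: "subgroup Q G"
  shows "subgroup {h \<in> M. rot h = 0 \<and> (\<forall>y\<in>Y. sec h y \<in> Q)} G"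
proof -
  interpret M: subgroup M G by fact
  interpret Q: subgroup Q G by fact
  show ?thesis
  proof (rule subgroupI)
    show "{h \<in> M. rot h = 0 \<and> (\<forall>y\<in>Y. sec h y \<in> Q)} \<noteq> {}"
      by (rule ex_in_conv[THEN iffD1, OF exI, of \<one>]) simp
  qed (auto simp: rot_mult rot_inv sec_mult sec_inv)
qed

section \<open>Section subgroups, level stabilizers and rigid elements\<close>

text \<open>Elements act on the letters by translations, so fixing one letter means fixing all: this
  is the image of the stabilizer of \<open>x\<close> in \<open>M\<close> under the section
  map.\<close>

definition sect :: "'a set \<Rightarrow> int \<Rightarrow> 'a set" where
  "sect M x = {sec h x | h. h \<in> M \<and> rot h = 0}"

lemma sectI: "\<lbrakk>h \<in> M; rot h = 0\<rbrakk> \<Longrightarrow> sec h x \<in> sect M x"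
  by (auto simp: sect_def)

lemma sectE: "g \<in> sect M x \<Longrightarrow> (\<And>h. \<lbrakk>h \<in> M; rot h = 0; g = sec h x\<rbrakk> \<Longrightarrow> P) \<Longrightarrow> P"
  by (auto simp: sect_def)

lemma subgroup_sect:
  assumes M: "subgroup M G" shows "subgroup (sect M x) G"
proof -
  interpret M: subgroup M G by fact
  show ?thesis
  proof (rule subgroupI)
    show "sect M x \<subseteq> carrier G" by (auto elim!: sectE)
    show "sect M x \<noteq> {}" using sectI[OF M.one_closed rot_one] by blast
    fix g assume "g \<in> sect M x"
    then obtain h where h: "h \<in> M" "rot h = 0" "g = sec h x" by (rule sectE)
    have "inv g = sec (inv h) x" using h by (simp add: sec_inv)
    then show "inv g \<in> sect M x" using h sectI[of "inv h" M x] by (simp add: rot_inv)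
    fix g' assume "g' \<in> sect M x"
    then obtain h' where h': "h' \<in> M" "rot h' = 0" "g' = sec h' x" by (rule sectE)
    have "g \<otimes> g' = sec (h \<otimes> h') x" using h h' by (simp add: sec_mult)
    then show "g \<otimes> g' \<in> sect M x" using h h' sectI[of "h \<otimes> h'" M x] by (simp add: rot_mult)
  qed
qed

text \<open>Conjugation by \<open>g\<close> lifts to conjugation by an element of \<open>M\<close>
  with section \<open>g\<close> at \<open>x\<close>, which normalizes \<open>C\<close>.\<close>

lemma sect_normal:
  assumes C: "subgroup C G" and M: "subgroup M G" "sect M x = carrier G"
    and conj: "\<And>m c. \<lbrakk>m \<in> M; rot m = 0; c \<in> C\<rbrakk> \<Longrightarrow> m \<otimes> c \<otimes> inv m \<in> C"
  shows "sect C x \<lhd> G"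
  unfolding normal_inv_iff
proof (intro conjI ballI subgroup_sect C)
  interpret C: subgroup C G by fact
  interpret M: subgroup M G by fact
  fix g h assume g: "g \<in> carrier G" and h: "h \<in> sect C x"
  from g obtain m where m: "m \<in> M" "rot m = 0" "g = sec m x" using M(2) by (metis sectE)
  from h obtain c where c: "c \<in> C" "rot c = 0" "h = sec c x" by (rule sectE)
  have "g \<otimes> h \<otimes> inv g = sec (m \<otimes> c \<otimes> inv m) x" using m c by (simp add: sec_conj)
  then show "g \<otimes> h \<otimes> inv g \<in> sect C x"
    using m c conj sectI[of "m \<otimes> c \<otimes> inv m" C x] by (simp add: rot_conj)
qed

text \<open>The preimage of the direct power of \<open>P\<close> under the decomposition into
  sections; the direct power need not lie in the image.\<close>

definition lift_sub :: "'a set \<Rightarrow> 'a set" where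
  "lift_sub P = {g \<in> carrier G. rot g = 0 \<and> (\<forall>x. sec g x \<in> P)}"

lemma normal_lift_sub:
  assumes P: "P \<lhd> G" shows "lift_sub P \<lhd> G"
  unfolding normal_inv_iff
proof (intro conjI ballI)
  show "subgroup (lift_sub P) G"
    using subgroup_sec_in[OF subgroup_self normal_imp_subgroup[OF P], of UNIV] by (simp add: lift_sub_def)
  fix g h assume "g \<in> carrier G" "h \<in> lift_sub P"
  then show "g \<otimes> h \<otimes> inv g \<in> lift_sub P"
    using P by (auto simp: lift_sub_def rot_conj sec_conj normal_inv_iff)
qed

lemma finite_rcosets_lift_sub:
  assumes P: "P \<lhd> G" "finite (rcosets P)"
  shows "finite (rcosets (lift_sub P))"
proof (rule finite_rcosetsI[of _ "\<lambda>g. (rot g, \<lambda>x\<in>{0..<int p}. P #> sec g x)"])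
  show "subgroup (lift_sub P) G" using normal_lift_sub[OF P(1)] by (rule normal_imp_subgroup)
  have "(\<lambda>g. (rot g, \<lambda>x\<in>{0..<int p}. P #> sec g x)) ` carrier G
      \<subseteq> {0..<int p} \<times> PiE {0..<int p} (\<lambda>_. rcosets P)"
    by (auto simp: rot_bounds intro!: rcosetsI normal_imp_subgroup[OF P(1), THEN subgroup.subset])
  then show "finite ((\<lambda>g. (rot g, \<lambda>x\<in>{0..<int p}. P #> sec g x)) ` carrier G)"
    by (rule finite_subset) (intro finite_cartesian_product finite_PiE P finite_atLeastLessThan_int)
next
  fix g h assume gh: "g \<in> carrier G" "h \<in> carrier G"
    "(rot g, \<lambda>x\<in>{0..<int p}. P #> sec g x) = (rot h, \<lambda>x\<in>{0..<int p}. P #> sec h x)"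
  from gh(3) have r: "rot g = rot h"
    and eq: "(\<lambda>x\<in>{0..<int p}. P #> sec g x) = (\<lambda>x\<in>{0..<int p}. P #> sec h x)"
    by (simp_all only: prod.inject)
  have "P #> sec g x = P #> sec h x" for x
  proof -
    have "x mod int p \<in> {0..<int p}" using p_pos by simp
    then have "P #> sec g (x mod int p) = P #> sec h (x mod int p)"
      using fun_cong[OF eq, of "x mod int p"] by simp
    then show ?thesis using gh(1,2) by simp
  qed
  then have "sec g x \<otimes> inv (sec h x) \<in> P" for x
    using gh(1,2) by (simp add: rcos_eq_iff[OF normal_imp_subgroup[OF P(1)]])
  then show "g \<otimes> inv h \<in> lift_sub P"
    using gh(1,2) r by (simp add: lift_sub_def rot_div sec_div)
qed

text \<open>The recursion over sections stands in for the action on words of length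
  \<open>n\<close>, which the locale does not mention.\<close>

primrec level_stab :: "nat \<Rightarrow> 'a set" where
  "level_stab 0 = carrier G"
| "level_stab (Suc n) = lift_sub (level_stab n)"

lemma normal_level_stab: "level_stab n \<lhd> G"
  by (induction n) (simp_all add: normal_self normal_lift_sub)

lemma finite_rcosets_level_stab: "finite (rcosets (level_stab n))"
proof (induction n)
  case 0
  have "rcosets (carrier G) \<subseteq> {carrier G}"
    by (auto simp: RCOSETS_def coset_join2[OF _ subgroup_self])
  then show ?case by (simp add: finite_subset)
qed (simp add: finite_rcosets_lift_sub normal_level_stab)

text \<open>Membership of \<open>g\<close> in the rigid stabilizer of the letter \<open>x\<close>,
  with the section recorded separately so that one can ask which \<open>k\<close> a given subgroup
  realizes.\<close>

definition supported_at :: "int \<Rightarrow> 'a \<Rightarrow> 'a \<Rightarrow> bool" where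
  "supported_at x k g \<longleftrightarrow> g \<in> carrier G \<and> rot g = 0 \<and> sec g x = k \<and>
     (\<forall>y. y mod int p \<noteq> x mod int p \<longrightarrow> sec g y = \<one>)"

lemma supported_at_one: "supported_at x \<one> \<one>"
  by (simp add: supported_at_def)

lemma supported_at_mult: "\<lbrakk>supported_at x k g; supported_at x l h\<rbrakk> \<Longrightarrow> supported_at x (k \<otimes> l) (g \<otimes> h)"
  by (auto simp: supported_at_def rot_mult sec_mult)

lemma supported_at_inv: "supported_at x k g \<Longrightarrow> supported_at x (inv k) (inv g)"
  by (auto simp: supported_at_def rot_inv sec_inv)

lemma supported_at_commutator:
  assumes "supported_at x k g" "supported_at x l h"
  shows "supported_at x (k \<otimes> l \<otimes> inv k \<otimes> inv l) (g \<otimes> h \<otimes> inv g \<otimes> inv h)"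
  using assms by (intro supported_at_mult supported_at_inv)

lemma subgroup_supported:
  assumes M: "subgroup M G"
  shows "subgroup {k. \<exists>g\<in>M. supported_at x k g} G"
proof -
  interpret M: subgroup M G by fact
  let ?H = "{k. \<exists>g\<in>M. supported_at x k g}"
  show ?thesis
  proof (rule subgroupI)
    show "?H \<subseteq> carrier G" by (auto simp: supported_at_def)
    show "?H \<noteq> {}" using supported_at_one M.one_closed by blast
    fix k assume "k \<in> ?H"
    then obtain g where g: "g \<in> M" "supported_at x k g" by auto
    show "inv k \<in> ?H" using M.m_inv_closed[OF g(1)] supported_at_inv[OF g(2)] by auto
    fix l assume "l \<in> ?H"
    then obtain h where h: "h \<in> M" "supported_at x l h" by auto
    show "k \<otimes> l \<in> ?H"
      using M.m_closed[OF g(1) h(1)] supported_at_mult[OF g(2) h(2)] by auto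
  qed
qed

end

text \<open>The section of \<open>bb v\<close> at the vertex \<open>p\<close>, here the class of \<open>0\<close>, is \<open>bb v\<close> itself, and
  \<open>e v\<close> is the defining vector of \<open>bb v\<close>.\<close>

locale spinal = self_similar +
  fixes a :: 'a and bb :: "'v::ab_group_add \<Rightarrow> 'a" and e :: "'v \<Rightarrow> int \<Rightarrow> int"
  assumes prime_p: "Factorial_Ring.prime p"
    and separated: "\<lbrakk>g \<in> carrier G; \<And>n. g \<in> level_stab n\<rbrakk> \<Longrightarrow> g = \<one>"
    and a_closed [simp]: "a \<in> carrier G"
    and rot_a [simp]: "rot a = 1"
    and sec_a [simp]: "sec a x = \<one>"
    and bb_closed [simp]: "bb v \<in> carrier G"
    and rot_bb [simp]: "rot (bb v) = 0"
    and bb_add: "bb (u + v) = bb u \<otimes> bb v"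
    and sec_bb: "sec (bb v) x = (if int p dvd x then bb v else a [^] e v x)"
    and generators: "carrier G = generate G (insert a (range bb))"
    and nontrivial: "\<exists>v t. \<not> int p dvd t \<and> \<not> int p dvd e v t"
    and torsion: "g \<in> carrier G \<Longrightarrow> \<exists>n::nat. n > 0 \<and> g [^] n = \<one>"
begin

lemma eqI:
  assumes g: "g \<in> carrier G" and h: "h \<in> carrier G"
    and r: "rot g = rot h" and s: "\<And>x. sec g x = sec h x"
  shows "g = h"
proof -
  have "g \<otimes> inv h \<in> level_stab n" for n
  proof (cases n)
    case 0 then show ?thesis using g h by simp
  next
    case (Suc m)
    have "\<one> \<in> level_stab m" using normal_level_stab[THEN normal_imp_subgroup] by (rule subgroup.one_closed)
    then show ?thesis using g h r s Suc by (simp add: lift_sub_def rot_div sec_div)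
  qed
  then have "g \<otimes> inv h = \<one>" using g h by (intro separated) auto
  then show ?thesis using g h by (metis inv_closed inv_equality inv_inv)
qed

lemma p_gt_1: "1 < int p" using prime_p prime_gt_1_nat by auto

lemma prime_int_p: "Factorial_Ring.prime (int p)" using prime_p by simp

lemma sec_a_pow [simp]: "sec (a [^] (j::int)) x = \<one>"
proof -
  have 1: "sec (a [^] (n::nat)) x = \<one>" for n x by (induction n) (simp_all add: sec_mult)
  show ?thesis
  proof (cases j)
    case (nonneg n) then show ?thesis by (simp add: int_pow_int 1)
  next
    case (neg n)
    show ?thesis unfolding neg int_pow_neg_int[OF a_closed] by (subst sec_inv) (simp_all only: nat_pow_closed a_closed 1 inv_one)
  qed
qed

lemma rot_a_pow [simp]: "rot (a [^] (j::int)) = j mod int p"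
  by (simp add: rot_int_pow)

lemma a_pow_eq_iff: "a [^] (i::int) = a [^] j \<longleftrightarrow> i mod int p = j mod int p"
proof
  assume "a [^] i = a [^] j"
  then have "rot (a [^] i) = rot (a [^] j)" by (rule arg_cong)
  then show "i mod int p = j mod int p" by simp
next
  assume "i mod int p = j mod int p"
  then show "a [^] i = a [^] j" using eqI[of "a [^] i" "a [^] j"] by simp
qed

lemma a_pow_dvd: "int p dvd j \<Longrightarrow> a [^] (j::int) = \<one>"
  using a_pow_eq_iff[of j 0] by (simp add: mod_eq_0_iff_dvd)

lemma a_pow_p: "a [^] p = \<one>"
  using a_pow_dvd[of "int p"] by (simp add: int_pow_int)

lemma bb_zero [simp]: "bb 0 = \<one>"
  using bb_add[of 0 0] by simp

lemma bb_uminus: "bb (- v) = inv (bb v)"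
  by (rule inv_equality[symmetric]) (simp_all flip: bb_add)

lemma bb_comm: "bb u \<otimes> bb v = bb v \<otimes> bb u"
  by (simp flip: bb_add add: add.commute)

lemma e_mod: "\<not> int p dvd x \<Longrightarrow> x mod int p = y mod int p \<Longrightarrow> e v x mod int p = e v y mod int p"
proof -
  assume x: "\<not> int p dvd x" "x mod int p = y mod int p"
  then have "\<not> int p dvd y" by (simp add: dvd_eq_mod_eq_0)
  then have "a [^] e v x = a [^] e v y" using sec_cong[OF bb_closed x(2), of v] x(1) by (simp add: sec_bb)
  then show ?thesis by (simp only: a_pow_eq_iff)
qed

text \<open>The quotient of the two elements has trivial sections except at 0, where its section is
  itself; induction over the levels puts it into every level stabilizer.\<close>

lemma bb_eqI:
  assumes "\<And>t. \<not> int p dvd t \<Longrightarrow> e u t mod int p = e v t mod int p"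
  shows "bb u = bb v"
proof -
  have "bb u \<otimes> inv (bb v) \<in> level_stab n" for n
  proof (induction n)
    case (Suc n)
    have "\<one> \<in> level_stab n" using normal_level_stab[THEN normal_imp_subgroup] by (rule subgroup.one_closed)
    moreover have "a [^] e u t = a [^] e v t" if "\<not> int p dvd t" for t
      using assms[OF that] by (simp add: a_pow_eq_iff)
    ultimately show ?case using Suc by (simp add: lift_sub_def rot_div sec_div sec_bb)
  qed simp
  then have "bb u \<otimes> inv (bb v) = \<one>" by (intro separated) auto
  then show ?thesis by (metis bb_closed inv_closed inv_equality inv_inv)
qed

text \<open>Although \<open>'v\<close> may be infinite, \<open>bb v\<close> depends only on finitely
  many entries modulo \<open>p\<close>. This gives finite generation and later an induction
  measure.\<close>

lemma finite_range_bb: "finite (range bb)"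
proof -
  define f where "f v = (\<lambda>t\<in>{1..<int p}. e v t mod int p)" for v
  have "bb u = bb v" if "f u = f v" for u v
  proof (rule bb_eqI)
    fix t assume t: "\<not> int p dvd t"
    have "t mod int p \<noteq> 0" using t by (simp add: dvd_eq_mod_eq_0)
    moreover have "0 \<le> t mod int p" "t mod int p < int p" using p_pos by auto
    ultimately have "t mod int p \<in> {1..<int p}" by auto
    then have 1: "e u (t mod int p) mod int p = e v (t mod int p) mod int p"
      using fun_cong[OF that, of "t mod int p"] by (simp add: f_def)
    have 2: "e w t mod int p = e w (t mod int p) mod int p" for w by (rule e_mod[OF t]) simp
    show "e u t mod int p = e v t mod int p" using 1 2 by simp
  qed
  note inj = this
  have "range bb \<subseteq> (\<lambda>y. bb (SOME v. f v = y)) ` range f"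
  proof (rule image_subsetI)
    fix v
    have "f (SOME u. f u = f v) = f v" by (rule someI) (rule refl)
    then have "bb v = bb (SOME u. f u = f v)" using inj by metis
    then show "bb v \<in> (\<lambda>y. bb (SOME v. f v = y)) ` range f" by (intro image_eqI) auto
  qed
  moreover have "range f \<subseteq> PiE {1..<int p} (\<lambda>_. {0..<int p})" using p_pos by (auto simp: f_def)
  then have "finite (range f)" by (rule finite_subset) (intro finite_PiE finite_atLeastLessThan_int)
  ultimately show ?thesis by (meson finite_imageI finite_subset)
qed

lemma generator_subset: "insert a (range bb) \<subseteq> carrier G" by auto

lemma finite_generators: "finite (insert a (range bb))" using finite_range_bb by simp

lemma subgroup_eq_carrierI:
  assumes "subgroup H G" "a \<in> H" "\<And>v. bb v \<in> H"
  shows "H = carrier G"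
proof
  show "H \<subseteq> carrier G" using assms(1) by (rule subgroup.subset)
  have "generate G (insert a (range bb)) \<subseteq> H"
    using assms by (intro generate_subgroup_incl) auto
  then show "carrier G \<subseteq> H" by (simp only: generators)
qed

lemma a_in_subgroup:
  assumes H: "subgroup H G" and k: "a [^] (k::int) \<in> H" "\<not> int p dvd k"
  shows "a \<in> H"
proof -
  have "coprime k (int p)" using prime_imp_coprime[OF prime_int_p k(2)] by (simp add: coprime_commute)
  then obtain j where j: "[k * j = 1] (mod int p)" using cong_solve_coprime_int by blast
  have "(a [^] k) [^] j \<in> H" using H k(1) by (rule subgroup_int_pow_closed)
  also have "(a [^] k) [^] j = a [^] (k * j)" by (simp add: int_pow_pow)
  also have "\<dots> = a [^] (1::int)" using j unfolding cong_def by (simp only: a_pow_eq_iff)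
  finally show ?thesis by simp
qed

text \<open>Conjugating by a power of \<open>a\<close> moves the directed section from the letter 0
  to the letter \<open>x\<close>.\<close>

definition bb_at :: "'v \<Rightarrow> int \<Rightarrow> 'a" where
  "bb_at v x = a [^] (- x) \<otimes> bb v \<otimes> a [^] x"

lemma bb_at_closed [simp]: "bb_at v x \<in> carrier G"
  by (simp add: bb_at_def)

lemma rot_bb_at [simp]: "rot (bb_at v x) = 0"
  by (simp add: bb_at_def rot_mult mod_simps)

lemma sec_bb_at: "sec (bb_at v x) t = sec (bb v) (t - x)"
proof -
  have "sec (bb_at v x) t = sec (bb v) (t + (- x) mod int p)"
    by (simp add: bb_at_def sec_mult)
  also have "\<dots> = sec (bb v) (t - x)" by (rule sec_cong) (simp_all add: mod_simps)
  finally show ?thesis .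
qed

lemma sec_bb_at_self: "sec (bb_at v x) x = bb v"
  by (simp add: sec_bb_at sec_bb)

text \<open>\<open>G\<close> is self-replicating: conjugates of \<open>bb v\<close> show
  \<open>bb v\<close> itself below \<open>x\<close>, and a nonzero entry moved to \<open>x\<close>
  shows a nontrivial power of \<open>a\<close>.\<close>

lemma sect_carrier: "sect (carrier G) x = carrier G"
proof (rule subgroup_eq_carrierI)
  show S: "subgroup (sect (carrier G) x) G" by (rule subgroup_sect[OF subgroup_self])
  show "bb v \<in> sect (carrier G) x" for v
    using sectI[OF bb_at_closed rot_bb_at, of v x x] by (simp add: sec_bb_at_self)
  obtain v t where vt: "\<not> int p dvd t" "\<not> int p dvd e v t" using nontrivial by auto
  have "sec (bb_at v (x - t)) x = a [^] e v t" using vt(1) by (simp add: sec_bb_at sec_bb)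
  then have "a [^] e v t \<in> sect (carrier G) x"
    using sectI[OF bb_at_closed rot_bb_at, of v "x - t" x] by simp
  then show "a \<in> sect (carrier G) x" using a_in_subgroup[OF S _ vt(2)] by simp
qed

lemma ex_sec_eq:
  assumes "g \<in> carrier G"
  shows "\<exists>s\<in>carrier G. rot s = 0 \<and> sec s x = g"
proof -
  have "g \<in> sect (carrier G) x" using assms by (simp add: sect_carrier)
  then show ?thesis by (auto elim: sectE)
qed

text \<open>Taking sections maps a proper subset of \<open>G\<close>, the stabilizer of level one,
  onto all of \<open>G\<close>.\<close>

lemma infinite_carrier: "infinite (carrier G)"
proof
  assume fin: "finite (carrier G)"
  let ?S = "{h \<in> carrier G. rot h = 0}"
  have "carrier G \<subseteq> (\<lambda>h. sec h 0) ` ?S"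
  proof
    fix g assume "g \<in> carrier G"
    then obtain s where "s \<in> carrier G" "rot s = 0" "sec s 0 = g" using ex_sec_eq by blast
    then show "g \<in> (\<lambda>h. sec h 0) ` ?S" by (intro image_eqI[of _ _ s]) auto
  qed
  moreover have finS: "finite ?S" using fin by simp
  ultimately have "card (carrier G) \<le> card ?S" by (meson card_image_le card_mono finite_imageI le_trans)
  moreover have "a \<in> carrier G - ?S" by simp
  then have "?S \<subset> carrier G" by blast
  then have "card ?S < card (carrier G)" using fin by (intro psubset_card_mono)
  ultimately show False by simp
qed

text \<open>An exponent prime to \<open>p\<close> forces rotation 0, and the sections inherit the
  exponent, so the argument repeats on every level.\<close>

lemma trivial_of_coprime_pow:
  assumes "g \<in> carrier G" "g [^] (m::nat) = \<one>" "\<not> p dvd m"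
  shows "g = \<one>"
proof -
  have "g \<in> level_stab n" for n
    using assms(1,2)
  proof (induction n arbitrary: g)
    case (Suc n)
    have "(int m * rot g) mod int p = 0" using rot_nat_pow[OF Suc.prems(1), of m] Suc.prems(2) by simp
    then have "int p dvd int m * rot g" by (simp add: mod_eq_0_iff_dvd)
    then have "int p dvd rot g" using assms(3) prime_int_p by (simp add: prime_dvd_mult_iff)
    then have r: "rot g = 0" using Suc.prems(1) by (metis dvd_imp_mod_0 rot_mod)
    have "sec g x [^] m = \<one>" for x using sec_nat_pow[OF Suc.prems(1) r, of m x] Suc.prems(2) by simp
    then show ?case using Suc r by (simp add: lift_sub_def)
  qed simp
  then show ?thesis using assms(1) separated by blast
qed

lemma pow_prime_power:
  assumes g: "g \<in> carrier G" shows "\<exists>k::nat. g [^] (p ^ k) = \<one>"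
proof -
  obtain n :: nat where n: "n > 0" "g [^] n = \<one>" using torsion[OF g] by auto
  have "\<not> is_unit p" using prime_p by auto
  then obtain m where m: "n = p ^ multiplicity p n * m" "\<not> p dvd m"
    using multiplicity_decompose'[of n p] n(1) by auto
  define h where "h = g [^] (p ^ multiplicity p n)"
  have "h [^] m = g [^] n" unfolding h_def using g m(1) by (metis nat_pow_pow)
  then have "h = \<one>" using trivial_of_coprime_pow[of h m] g n m(2) by (simp add: h_def)
  then show ?thesis unfolding h_def by blast
qed

lemma supplement:
  assumes "full_mod_derived M" "K \<lhd> G" "finite (rcosets K)" "g \<in> carrier G"
  shows "\<exists>m\<in>M. \<exists>k\<in>K. g = m \<otimes> k"
  using full_mod_derived_supplement[OF prime_p pow_prime_power assms] .

lemma finite_rcosets_derived_normal: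
  assumes "J \<lhd> G" "finite (rcosets J)" shows "finite (rcosets (derived G J))"
  using finite_rcosets_derived[OF finite_generators generator_subset generators torsion assms] .

subsection \<open>Exponent sums\<close>

lemma nat_pow_conj:
  assumes "x \<in> carrier G" "y \<in> carrier G"
  shows "(x \<otimes> y \<otimes> inv x) [^] (n::nat) = x \<otimes> y [^] n \<otimes> inv x"
  using assms by (induction n) (simp_all add: m_assoc)

text \<open>If the entries of the defining vector of \<open>bb v\<close> have sum \<open>s\<close> prime to \<open>p\<close>, then the
  \<open>p\<close>-th power of \<open>a\<^sup>s\<close> times \<open>bb v\<close> has a section conjugate to that same element, which
  therefore has infinite order.\<close>

lemma sum_e: "int p dvd (\<Sum>t\<in>{1..<int p}. e v t)"
proof (rule ccontr)
  define s where "s = (\<Sum>t\<in>{1..<int p}. e v t)"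
  assume "\<not> int p dvd (\<Sum>t\<in>{1..<int p}. e v t)"
  then have s: "\<not> int p dvd s" by (simp add: s_def)
  then have cop: "coprime s (int p)" using prime_imp_coprime[OF prime_int_p] by (simp add: coprime_commute)
  define w where "w = a [^] s \<otimes> bb v"
  have w: "w \<in> carrier G" by (simp add: w_def)
  have rot_w: "rot w = s mod int p" by (simp add: w_def rot_mult)
  have sec_w: "sec w u = sec (bb v) (u + s)" for u
    unfolding w_def by (simp add: sec_mult) (rule sec_cong, simp_all add: mod_simps)
  \<comment> \<open>The orbit of \<open>- s\<close> under \<open>w\<close> runs through
    \<open>- s\<close>, 0, \<open>s\<close>, \<open>2 * s\<close> and so on. The first section met
    is that of \<open>bb v\<close> at 0, hence \<open>bb v\<close>; all later ones are powers of
    \<open>a\<close>.\<close>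
  have pow: "sec (w [^] Suc n) (- s) = bb v \<otimes> a [^] (\<Sum>i\<in>{1..int n}. e v (i * s))" if "n < p" for n
    using that
  proof (induction n)
    case 0 then show ?case using w by (simp add: sec_w sec_bb)
  next
    case (Suc n)
    have nd: "\<not> int p dvd int (Suc n)" using Suc.prems by (metis int_dvd_int_iff nat_dvd_not_less zero_less_Suc)
    have "sec (w [^] Suc (Suc n)) (- s) = sec (w [^] Suc n) (- s) \<otimes> sec w (- s + rot (w [^] Suc n))"
      using w by (simp only: nat_pow_Suc[of w "Suc n"] sec_mult nat_pow_closed)
    also have "sec w (- s + rot (w [^] Suc n)) = sec (bb v) (int (Suc n) * s)"
      unfolding sec_w rot_nat_pow[OF w] rot_w by (rule sec_cong) (simp_all add: mod_simps)
    also have "\<dots> = a [^] e v (int (Suc n) * s)"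
      using nd s prime_int_p by (simp add: sec_bb prime_dvd_mult_iff del: of_nat_Suc)
    finally have *: "sec (w [^] Suc (Suc n)) (- s)
        = bb v \<otimes> (a [^] (\<Sum>i\<in>{1..int n}. e v (i * s)) \<otimes> a [^] e v (int (Suc n) * s))"
      using Suc by (simp add: m_assoc)
    have "{1..int (Suc n)} = insert (int (Suc n)) {1..int n}" by auto
    then have "(\<Sum>i\<in>{1..int (Suc n)}. e v (i * s)) = (\<Sum>i\<in>{1..int n}. e v (i * s)) + e v (int (Suc n) * s)"
      by simp
    then show ?case unfolding * by (simp only: int_pow_mult[OF a_closed])
  qed
  have "bb v \<otimes> a [^] (\<Sum>i\<in>{1..int (p - 1)}. e v (i * s)) = bb v \<otimes> a [^] s"
  proof -
    \<comment> \<open>The value 0 at multiples of \<open>p\<close> extends the sum to all residues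
      without changing it, so that multiplication by \<open>s\<close> can permute the terms.\<close>
    define f where "f x = (if int p dvd x then 0 else e v x mod int p)" for x
    have f: "f (x mod int p) = f x" for x
      using e_mod[of x "x mod int p" v] by (auto simp: f_def dvd_mod_iff)
    have split: "{0..<int p} = insert 0 {1..<int p}" using p_gt_1 by auto
    have sub: "{1..int (p - 1)} = {1..<int p}" using p_gt_1 by auto
    have nd: "\<not> int p dvd i" if "i \<in> {1..<int p}" for i using that zdvd_not_zless by auto
    have "(\<Sum>i\<in>{1..<int p}. f (i * s)) = (\<Sum>i\<in>{1..<int p}. f i)"
      using sum_mod_reindex[of "int p" s f 0] p_gt_1 cop f by (simp add: split f_def)
    moreover have "(\<Sum>i\<in>{1..<int p}. f i) mod int p = s mod int p"
      using nd by (simp add: f_def s_def mod_sum_eq)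
    moreover have "(\<Sum>i\<in>{1..<int p}. f (i * s)) mod int p = (\<Sum>i\<in>{1..<int p}. e v (i * s)) mod int p"
      using nd s prime_int_p by (simp add: f_def prime_dvd_mult_iff mod_sum_eq)
    ultimately show ?thesis unfolding sub by (metis a_pow_eq_iff)
  qed
  then have "sec (w [^] p) (- s) = bb v \<otimes> a [^] s"
    using pow[of "p - 1"] p_gt_1 by simp
  also have "\<dots> = inv (a [^] s) \<otimes> w \<otimes> inv (inv (a [^] s))" by (simp add: w_def)
  finally have sec_wp: "sec (w [^] p) (- s) = inv (a [^] s) \<otimes> w \<otimes> inv (inv (a [^] s))" .
  have rot_wp: "rot (w [^] p) = 0" using rot_nat_pow[OF w, of p] by simp
  have pos: "ord w > 0" using torsion[OF w] w by (metis gr0I ord_eq_0 pow_eq_id neq0_conv)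
  have "(int (ord w) * rot w) mod int p = 0" using rot_nat_pow[OF w, of "ord w"] w by simp
  then have "int p dvd int (ord w) * s" by (simp add: rot_w mod_simps mod_eq_0_iff_dvd)
  then have "p dvd ord w" using s prime_int_p by (simp add: prime_dvd_mult_iff)
  \<comment> \<open>The section of the power with exponent \<open>p * m\<close> will show that
    already the \<open>m\<close>-th power of \<open>w\<close> is trivial.\<close>
  then obtain m where m: "ord w = p * m" by (rule dvdE)
  have "(w [^] p) [^] m = \<one>" using w m by (simp add: nat_pow_pow flip: m)
  then have "sec (w [^] p) (- s) [^] m = \<one>"
    using sec_nat_pow[of "w [^] p" m "- s"] rot_wp w by simp
  then have "inv (a [^] s) \<otimes> w [^] m \<otimes> inv (inv (a [^] s)) = \<one>"
    unfolding sec_wp using w by (subst (asm) nat_pow_conj) auto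
  then have "a [^] s \<otimes> (inv (a [^] s) \<otimes> w [^] m \<otimes> inv (inv (a [^] s))) \<otimes> inv (a [^] s) = \<one>"
    by simp
  then have "w [^] m = \<one>" using w by (simp add: m_assoc)
  then have "ord w dvd m" using w by (simp add: pow_eq_id)
  then show False using m pos p_gt_1 by (auto dest!: dvd_imp_le)
qed

text \<open>A single nonzero entry could not sum to 0 modulo \<open>p\<close>.\<close>

lemma ex_other_entry:
  assumes "\<not> int p dvd t" "\<not> int p dvd e v t"
  shows "\<exists>t'. \<not> int p dvd t' \<and> \<not> int p dvd e v t' \<and> t' mod int p \<noteq> t mod int p"
proof (rule ccontr)
  assume neg: "\<not> ?thesis"
  have nd: "\<not> int p dvd i" if "i \<in> {1..<int p}" for i using that zdvd_not_zless by auto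
  have "t mod int p \<noteq> 0" using assms(1) by (simp add: dvd_eq_mod_eq_0)
  moreover have "0 \<le> t mod int p" "t mod int p < int p" using p_pos by auto
  ultimately have tm: "t mod int p \<in> {1..<int p}" by auto
  have "int p dvd e v (t mod int p) + (\<Sum>i\<in>{1..<int p} - {t mod int p}. e v i)"
    using sum_e[of v] sum.remove[OF _ tm, of "e v"] by simp
  moreover have "int p dvd (\<Sum>i\<in>{1..<int p} - {t mod int p}. e v i)"
  proof (rule dvd_sum)
    fix i assume i: "i \<in> {1..<int p} - {t mod int p}"
    then have "i mod int p \<noteq> t mod int p" by auto
    then show "int p dvd e v i" using neg nd i by blast
  qed
  ultimately have "int p dvd e v (t mod int p)" by (simp add: dvd_add_left_iff)
  moreover have "e v t mod int p = e v (t mod int p) mod int p" by (rule e_mod[OF assms(1)]) simp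
  ultimately show False using assms(2) by (simp only: dvd_eq_mod_eq_0)
qed

end

section \<open>Conjugates of full subgroups\<close>

context group
begin

definition conj_set :: "'a \<Rightarrow> 'a set \<Rightarrow> 'a set" where
  "conj_set g M = (\<lambda>m. inv g \<otimes> m \<otimes> g) ` M"

lemma conj_setI: "m \<in> M \<Longrightarrow> inv g \<otimes> m \<otimes> g \<in> conj_set g M"
  by (simp add: conj_set_def)

lemma subgroup_conj_set:
  assumes M: "subgroup M G" and g: "g \<in> carrier G"
  shows "subgroup (conj_set g M) G"
proof -
  interpret M: subgroup M G by fact
  show ?thesis
  proof (rule subgroupI)
    show "conj_set g M \<subseteq> carrier G" using g by (auto simp: conj_set_def)
    show "conj_set g M \<noteq> {}" using conj_setI[OF M.one_closed] by blast
    fix x assume "x \<in> conj_set g M"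
    then obtain m where m: "m \<in> M" "x = inv g \<otimes> m \<otimes> g" by (auto simp: conj_set_def)
    have "inv x = inv g \<otimes> inv m \<otimes> g" using m g by (simp add: inv_mult_group m_assoc)
    then show "inv x \<in> conj_set g M" using conj_setI[OF M.m_inv_closed[OF m(1)], of g] by simp
    fix y assume "y \<in> conj_set g M"
    then obtain n where n: "n \<in> M" "y = inv g \<otimes> n \<otimes> g" by (auto simp: conj_set_def)
    have "x \<otimes> y = inv g \<otimes> (m \<otimes> n) \<otimes> g" using m n g by (simp add: m_assoc)
    then show "x \<otimes> y \<in> conj_set g M" using conj_setI[OF M.m_closed[OF m(1) n(1)], of g] by simp
  qed
qed

lemma conj_set_eq_carrier:
  assumes M: "subgroup M G" and g: "g \<in> carrier G" and eq: "conj_set g M = carrier G"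
  shows "M = carrier G"
proof
  show "M \<subseteq> carrier G" using M by (rule subgroup.subset)
  show "carrier G \<subseteq> M"
  proof
    fix x assume x: "x \<in> carrier G"
    then have "inv g \<otimes> x \<otimes> g \<in> conj_set g M" using g eq by simp
    then obtain m where m: "m \<in> M" "inv g \<otimes> x \<otimes> g = inv g \<otimes> m \<otimes> g" by (auto simp: conj_set_def)
    have mc: "m \<in> carrier G" using M m(1) by (rule subgroup.mem_carrier)
    have "x = m" using m(2) x g mc by simp
    then show "x \<in> M" using m(1) by simp
  qed
qed

text \<open>An overgroup of the derived subgroup is normal, so it contains a conjugate of
  \<open>M\<close> only if it contains \<open>M\<close>.\<close>

lemma full_mod_derived_conj_set:
  assumes M: "full_mod_derived M" and g: "g \<in> carrier G"
  shows "full_mod_derived (conj_set g M)"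
  unfolding full_mod_derived_def
proof (intro conjI allI impI, goal_cases)
  case 1 show ?case using full_mod_derived_subgroup[OF M] g by (rule subgroup_conj_set)
next
  case (2 N)
  then have N: "subgroup N G" "conj_set g M \<subseteq> N" "derived G (carrier G) \<subseteq> N" by auto
  have nN: "N \<lhd> G" using N(1,3) by (rule normal_if_derived_le)
  interpret M: subgroup M G using M by (rule full_mod_derived_subgroup)
  have "M \<subseteq> N"
  proof
    fix m assume m: "m \<in> M"
    have "inv g \<otimes> m \<otimes> g \<in> N" using conj_setI[OF m] N(2) by (rule subsetD[rotated])
    then have "g \<otimes> (inv g \<otimes> m \<otimes> g) \<otimes> inv g \<in> N" using nN g by (simp add: normal_inv_iff)
    then show "m \<in> N" using m g by (simp add: m_assoc)
  qed
  then show ?case using full_mod_derivedD[OF M N(1)] N(3) by simp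
qed

end

context spinal
begin

abbreviation "G' \<equiv> derived G (carrier G)"

lemma finite_rcosets_G': "finite (rcosets G')"
  using finite_rcosets_level_stab[of 0] by (intro finite_rcosets_derived_normal normal_self) simp

text \<open>Lift \<open>g\<close> to an element fixing level one with section \<open>g\<close> at
  \<open>x\<close>, and split the lift into a factor from \<open>M\<close> and one from
  \<open>lift_sub N\<close>: both factors have their section at \<open>x\<close> in
  \<open>N\<close>.\<close>

lemma full_mod_derived_sect:
  assumes M: "full_mod_derived M"
  shows "full_mod_derived (sect M x)"
  unfolding full_mod_derived_def
proof (intro conjI allI impI, goal_cases)
  case 1 show ?case using full_mod_derived_subgroup[OF M] by (rule subgroup_sect)
next
  case (2 N)
  then have N: "subgroup N G" "sect M x \<subseteq> N" "G' \<subseteq> N" by auto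
  interpret M: subgroup M G using M by (rule full_mod_derived_subgroup)
  have nN: "N \<lhd> G" using N(1,3) by (rule normal_if_derived_le)
  have "finite (rcosets N)"
    using finite_rcosets_mono[OF _ N(1,3) finite_rcosets_G'] derived_is_subgroup by simp
  note K = normal_lift_sub[OF nN] finite_rcosets_lift_sub[OF nN this]
  have "carrier G \<subseteq> N"
  proof
    fix g assume "g \<in> carrier G"
    then obtain s where s: "s \<in> carrier G" "rot s = 0" "sec s x = g" using ex_sec_eq by blast
    from supplement[OF M K s(1)] obtain m k where mk: "m \<in> M" "k \<in> lift_sub N" "s = m \<otimes> k"
      by (elim bexE)
    have k: "k \<in> carrier G" "rot k = 0" "sec k x \<in> N" using mk(2) by (auto simp: lift_sub_def)
    have "rot m = 0" using s(2) mk k by (simp add: rot_mult)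
    then have "sec m x \<in> N" using sectI[OF mk(1), of x] N(2) by blast
    moreover have "g = sec m x \<otimes> sec k x" using s(3) mk k \<open>rot m = 0\<close> by (simp add: sec_mult)
    ultimately show "g \<in> N" using k(3) N(1) by (simp add: subgroup.m_closed)
  qed
  then show ?case using subgroup.subset[OF N(1)] by blast
qed

lemma full_mod_derived_ex_rot:
  assumes M: "full_mod_derived M"
  shows "\<exists>m\<in>M. rot m = 1"
proof -
  from supplement[OF M normal_level_stab finite_rcosets_level_stab a_closed, of "Suc 0"]
  obtain m k where mk: "m \<in> M" "k \<in> level_stab (Suc 0)" "a = m \<otimes> k" by (elim bexE)
  interpret M: subgroup M G using M by (rule full_mod_derived_subgroup)
  have k: "k \<in> carrier G" "rot k = 0" using mk(2) by (auto simp: lift_sub_def)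
  have "rot m = 1" using rot_a mk k by (simp add: rot_mult)
  then show ?thesis using mk(1) by blast
qed

text \<open>\<open>M\<close> contains elements of every rotation, and conjugating by one of rotation
  \<open>x - y\<close> carries sections at \<open>x\<close> to \<open>y\<close>, up to an inner
  automorphism of \<open>G\<close>.\<close>

lemma sect_eq_carrier_all:
  assumes M: "full_mod_derived M" and x: "sect M x = carrier G"
  shows "sect M y = carrier G"
proof
  interpret M: subgroup M G using M by (rule full_mod_derived_subgroup)
  show "sect M y \<subseteq> carrier G" using subgroup_sect[OF M.subgroup_axioms] by (rule subgroup.subset)
  obtain m where m: "m \<in> M" "rot m = 1" using full_mod_derived_ex_rot[OF M] by blast
  define h where "h = m [^] (x - y)"
  have h: "h \<in> M" "rot h = (x - y) mod int p"
    using m by (auto simp: h_def subgroup_int_pow_closed[OF M.subgroup_axioms] rot_int_pow)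
  have hc: "h \<in> carrier G" using h by simp
  show "carrier G \<subseteq> sect M y"
  proof
    fix g assume g: "g \<in> carrier G"
    let ?q = "sec h y"
    have "inv ?q \<otimes> g \<otimes> ?q \<in> sect M x" using g hc x by simp
    then obtain s where s: "s \<in> M" "rot s = 0" "inv ?q \<otimes> g \<otimes> ?q = sec s x" by (rule sectE)
    have "sec s (y + rot h) = sec s x" using s(1) by (intro sec_cong) (simp_all add: h mod_simps)
    then have "sec (h \<otimes> s \<otimes> inv h) y = ?q \<otimes> (inv ?q \<otimes> g \<otimes> ?q) \<otimes> inv ?q"
      using s hc by (simp add: sec_conj)
    also have "\<dots> = g" using g hc by (simp add: m_assoc)
    finally have "sec (h \<otimes> s \<otimes> inv h) y = g" .
    moreover have "h \<otimes> s \<otimes> inv h \<in> M" "rot (h \<otimes> s \<otimes> inv h) = 0" using h s by (simp_all add: rot_conj)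
    ultimately show "g \<in> sect M y" using sectI[of "h \<otimes> s \<otimes> inv h" M y] by simp
  qed
qed

subsection \<open>Branching\<close>

lemma derived_le_bb_a:
  assumes N: "N \<lhd> G" and c: "\<And>v. bb v \<otimes> a \<otimes> inv (bb v) \<otimes> inv a \<in> N"
  shows "G' \<subseteq> N"
proof (rule derived_le_normal[OF N generator_subset generators])
  note sub = normal_imp_subgroup[OF N]
  note one = subgroup.one_closed[OF sub]
  have c': "a \<otimes> bb v \<otimes> inv a \<otimes> inv (bb v) \<in> N" for v
    using c commutator_sym[OF sub bb_closed a_closed] by simp
  have "bb u \<otimes> bb v \<otimes> inv (bb u) \<otimes> inv (bb v) = \<one>" for u v
    by (simp add: bb_comm[of u v] m_assoc)
  then have bbN: "bb u \<otimes> bb v \<otimes> inv (bb u) \<otimes> inv (bb v) \<in> N" for u v using one by simp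
  have aa: "a \<otimes> a \<otimes> inv a \<otimes> inv a \<in> N" using one by (simp add: m_assoc)
  fix x y assume "x \<in> insert a (range bb)" "y \<in> insert a (range bb)"
  then show "x \<otimes> y \<otimes> inv x \<otimes> inv y \<in> N" using c c' bbN aa by (elim insertE imageE) simp_all
qed

definition fixer :: "'a set \<Rightarrow> int set \<Rightarrow> 'a set" where
  "fixer M Y = {h \<in> M. rot h = 0 \<and> (\<forall>y\<in>Y. sec h y = \<one>)}"

lemma subgroup_fixer: "subgroup M G \<Longrightarrow> subgroup (fixer M Y) G"
  using subgroup_sec_in[OF _ triv_subgroup, of M Y] by (simp add: fixer_def)

lemma sect_fixer_normal:
  assumes M: "subgroup M G" "sect M x = carrier G"
  shows "sect (fixer M Y) x \<lhd> G"
proof (rule sect_normal[OF subgroup_fixer M])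
  interpret M: subgroup M G by fact
  fix m c assume "m \<in> M" "rot m = 0" "c \<in> fixer M Y"
  then show "m \<otimes> c \<otimes> inv m \<in> fixer M Y" by (simp add: fixer_def rot_conj sec_conj)
qed (rule M)

lemma sec_int_pow:
  assumes g: "g \<in> carrier G" "rot g = 0" shows "sec (g [^] (k::int)) x = sec g x [^] k"
proof (cases k)
  case (nonneg n) then show ?thesis using g by (simp add: int_pow_int sec_nat_pow)
next
  case (neg n)
  have r: "rot (g [^] Suc n) = 0" using g rot_nat_pow[of g "Suc n"] by simp
  have "sec (inv (g [^] Suc n)) x = inv (sec (g [^] Suc n) x)"
    using sec_inv[of "g [^] Suc n" x] r g(1) by (simp del: nat_pow_Suc)
  then show ?thesis unfolding neg int_pow_neg_int[OF g(1)] int_pow_neg_int[OF sec_closed[OF g(1)]]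
    by (simp only: sec_nat_pow[OF g])
qed

text \<open>Two nonzero entries of the defining vector are available, so one of them can be used to cancel
  the section at \<open>y\<close> without affecting the section at \<open>x\<close> by more than a power of \<open>a\<close>.\<close>

lemma ex_fixer_sec_bb:
  assumes xy: "x mod int p \<noteq> y mod int p"
  shows "\<exists>s\<in>fixer (carrier G) {y}. \<exists>j::int. sec s x = bb v \<otimes> a [^] j"
proof -
  obtain w t0 where t0: "\<not> int p dvd t0" "\<not> int p dvd e w t0" using nontrivial by auto
  obtain t1 where t1: "\<not> int p dvd t1" "\<not> int p dvd e w t1" "t1 mod int p \<noteq> t0 mod int p"
    using ex_other_entry[OF t0] by auto
  obtain t where t: "\<not> int p dvd t" "\<not> int p dvd e w t" "\<not> int p dvd x - (y - t)"
  proof (cases "int p dvd x - (y - t0)")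
    case True
    have "\<not> int p dvd x - (y - t1)"
    proof
      assume "int p dvd x - (y - t1)"
      then have "int p dvd (x - (y - t1)) - (x - (y - t0))" using True by (rule dvd_diff)
      then have "int p dvd t1 - t0" by (simp add: algebra_simps)
      then show False using t1(3) by (simp add: mod_eq_dvd_iff)
    qed
    then show ?thesis using that t1 by blast
  next
    case False then show ?thesis using that t0 by blast
  qed
  have nd: "\<not> int p dvd y - x" using xy by (metis dvd_diff_commute mod_eq_dvd_iff)
  have "coprime (e w t) (int p)"
    using prime_imp_coprime[OF prime_int_p t(2)] by (simp add: coprime_commute)
  then obtain k' where k': "[e w t * k' = 1] (mod int p)" using cong_solve_coprime_int by blast
  \<comment> \<open>Solves \<open>e v (y - x) + e w t * k = 0\<close> modulo \<open>p\<close>, so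
    that the sections of the two factors of \<open>s\<close> at \<open>y\<close> cancel.\<close>
  define k where "k = - k' * e v (y - x)"
  have "int p dvd e w t * k' - 1" using k' by (simp add: cong_iff_dvd_diff)
  then have "int p dvd (e w t * k' - 1) * (- e v (y - x))" by (rule dvd_mult2)
  also have "(e w t * k' - 1) * (- e v (y - x)) = e v (y - x) + e w t * k"
    by (simp add: k_def algebra_simps)
  finally have k: "int p dvd e v (y - x) + e w t * k" .
  define s where "s = bb_at v x \<otimes> bb_at w (y - t) [^] k"
  have s: "s \<in> carrier G" "rot s = 0" by (simp_all add: s_def rot_mult rot_int_pow)
  have sec_s: "sec s z = sec (bb v) (z - x) \<otimes> sec (bb w) (z - (y - t)) [^] k" for z
    by (simp add: s_def sec_mult sec_int_pow sec_bb_at)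
  have "sec s y = a [^] (e v (y - x) + e w t * k)"
    using nd t(1) by (simp add: sec_s sec_bb int_pow_mult int_pow_pow)
  then have "s \<in> fixer (carrier G) {y}" using s a_pow_dvd[OF k] by (simp add: fixer_def)
  moreover have "sec s x = bb v \<otimes> a [^] (e w (x - (y - t)) * k)"
    using t(3) by (simp add: sec_s sec_bb int_pow_pow)
  ultimately show ?thesis by blast
qed

text \<open>Modulo this normal subgroup every \<open>bb v\<close> is a power of \<open>a\<close> by
  \<open>ex_fixer_sec_bb\<close>, so the quotient is cyclic.\<close>

lemma derived_le_sect_fixer:
  assumes xy: "x mod int p \<noteq> y mod int p"
  shows "G' \<subseteq> sect (fixer (carrier G) {y}) x"
proof (rule derived_le_bb_a)
  let ?Q = "sect (fixer (carrier G) {y}) x"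
  show Q: "?Q \<lhd> G" by (rule sect_fixer_normal[OF subgroup_self sect_carrier])
  interpret Q: normal ?Q G by (rule Q)
  let ?H = "{h \<in> carrier G. h \<otimes> a \<otimes> inv h \<otimes> inv a \<in> ?Q}"
  have H: "subgroup ?H G" by (rule centralizer_mod_subgroup[OF Q a_closed])
  have aH: "a \<in> ?H" by (simp add: m_assoc)
  have QH: "q \<in> ?H" if q: "q \<in> ?Q" for q
  proof -
    have "q \<otimes> (a \<otimes> inv q \<otimes> inv a) \<in> ?Q"
      using q Q.inv_op_closed2[OF a_closed Q.m_inv_closed[OF q]] by (rule Q.m_closed)
    then show ?thesis using q by (simp add: m_assoc)
  qed
  fix v
  obtain s j where s: "s \<in> fixer (carrier G) {y}" "sec s x = bb v \<otimes> a [^] (j::int)"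
    using ex_fixer_sec_bb[OF xy] by blast
  have "sec s x \<in> ?Q" using s(1) by (intro sectI) (simp_all add: fixer_def)
  then have "bb v \<otimes> a [^] j \<in> ?H" using s(2) QH by simp
  moreover have "a [^] (- j) \<in> ?H" using H aH by (rule subgroup_int_pow_closed)
  ultimately have "(bb v \<otimes> a [^] j) \<otimes> a [^] (- j) \<in> ?H" by (rule subgroup.m_closed[OF H])
  moreover have "(bb v \<otimes> a [^] j) \<otimes> a [^] (- j) = bb v" by (simp add: m_assoc flip: int_pow_mult)
  ultimately have "bb v \<in> ?H" by simp
  then show "bb v \<otimes> a \<otimes> inv (bb v) \<otimes> inv a \<in> ?Q" by simp
qed

text \<open>Two conjugates of directed generators, directed at \<open>x\<close> and at
  \<open>y\<close>, have powers of \<open>a\<close> as sections at all other letters, so their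
  commutator is trivial there. At \<open>x\<close> it shows the commutator of \<open>bb v\<close>
  with a power of \<open>a\<close>, and \<open>y\<close> is chosen to make that power
  nontrivial.\<close>

lemma derived_le_sect_two:
  "\<exists>y. y mod int p \<noteq> x mod int p \<and>
    G' \<subseteq> sect (fixer (carrier G) {z. z mod int p \<noteq> x mod int p \<and> z mod int p \<noteq> y mod int p}) x"
proof -
  obtain w t where t: "\<not> int p dvd t" "\<not> int p dvd e w t" using nontrivial by auto
  define y where "y = x - t"
  have xy: "y mod int p \<noteq> x mod int p"
  proof
    assume "y mod int p = x mod int p"
    then have "int p dvd x - y" by (metis mod_eq_dvd_iff)
    then show False using t(1) by (simp add: y_def)
  qed
  let ?Y = "{z. z mod int p \<noteq> x mod int p \<and> z mod int p \<noteq> y mod int p}"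
  let ?Q = "sect (fixer (carrier G) ?Y) x"
  have "G' \<subseteq> ?Q"
  proof (rule derived_le_bb_a)
    show Q: "?Q \<lhd> G" by (rule sect_fixer_normal[OF subgroup_self sect_carrier])
    note sub = normal_imp_subgroup[OF Q]
    fix v
    define c where "c = bb_at v x \<otimes> bb_at w y \<otimes> inv (bb_at v x) \<otimes> inv (bb_at w y)"
    have c: "c \<in> carrier G" "rot c = 0" by (simp_all add: c_def sec_commutator)
    have sec_c: "sec c z = sec (bb v) (z - x) \<otimes> sec (bb w) (z - y)
        \<otimes> inv (sec (bb v) (z - x)) \<otimes> inv (sec (bb w) (z - y))" for z
      by (simp add: c_def sec_commutator sec_bb_at)
    have "sec c z = \<one>" if "z \<in> ?Y" for z
    proof -
      have "\<not> int p dvd z - x" "\<not> int p dvd z - y" using that by (simp_all add: mod_eq_dvd_iff)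
      moreover have "a [^] i \<otimes> a [^] k \<otimes> inv (a [^] i) \<otimes> inv (a [^] k) = \<one>" for i k :: int
        by (simp flip: int_pow_neg int_pow_mult)
      ultimately show ?thesis unfolding sec_c by (simp add: sec_bb)
    qed
    then have "c \<in> fixer (carrier G) ?Y" using c by (simp add: fixer_def)
    then have "sec c x \<in> ?Q" using c(2) by (rule sectI)
    then have "bb v \<otimes> a [^] e w t \<otimes> inv (bb v) \<otimes> inv (a [^] e w t) \<in> ?Q"
      using t(1) by (simp add: sec_c y_def sec_bb)
    then have "a [^] e w t \<in> {h \<in> carrier G. h \<otimes> bb v \<otimes> inv h \<otimes> inv (bb v) \<in> ?Q}"
      using commutator_sym[OF sub, of "bb v" "a [^] e w t"] by simp
    then have "a \<in> {h \<in> carrier G. h \<otimes> bb v \<otimes> inv h \<otimes> inv (bb v) \<in> ?Q}"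
      using centralizer_mod_subgroup[OF Q bb_closed] t(2) by (intro a_in_subgroup)
    then show "bb v \<otimes> a \<otimes> inv (bb v) \<otimes> inv a \<in> ?Q"
      using commutator_sym[OF sub, of "bb v" a] by simp
  qed
  then show ?thesis using xy by blast
qed

text \<open>An element trivial away from \<open>x\<close> and \<open>y\<close> and an element
  trivial at \<open>y\<close> have a commutator supported at \<open>x\<close> alone; their sections
  at \<open>x\<close> can be any two elements of \<open>G'\<close>.\<close>

lemma supported_in_derived:
  assumes "q \<in> derived G G'"
  shows "\<exists>g\<in>G'. supported_at x q g"
proof -
  have sub': "subgroup G' G" by (simp add: derived_is_subgroup)
  have "derived G G' \<subseteq> {k. \<exists>g\<in>G'. supported_at x k g}"
    unfolding derived_incl_iff[OF subgroup_supported[OF sub'] subgroup.subset[OF sub']]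
  proof (intro ballI CollectI)
    fix k l assume kl: "k \<in> G'" "l \<in> G'"
    obtain y where y: "y mod int p \<noteq> x mod int p"
      and Y: "G' \<subseteq> sect (fixer (carrier G) {z. z mod int p \<noteq> x mod int p \<and> z mod int p \<noteq> y mod int p}) x"
      using derived_le_sect_two[of x] by blast
    from subsetD[OF Y kl(1)] obtain d
      where d: "d \<in> fixer (carrier G) {z. z mod int p \<noteq> x mod int p \<and> z mod int p \<noteq> y mod int p}"
        "rot d = 0" "k = sec d x" by (rule sectE)
    from subsetD[OF derived_le_sect_fixer[OF y[symmetric]] kl(2)] obtain c
      where c: "c \<in> fixer (carrier G) {y}" "rot c = 0" "l = sec c x" by (rule sectE)
    have dc: "d \<in> carrier G" "c \<in> carrier G" "sec c y = \<one>" using d c by (auto simp: fixer_def)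
    have "sec (d \<otimes> c \<otimes> inv d \<otimes> inv c) z = \<one>" if z: "z mod int p \<noteq> x mod int p" for z
    proof (cases "z mod int p = y mod int p")
      case True
      then have "sec c z = \<one>" using sec_cong[OF dc(2) True] dc(3) by simp
      then show ?thesis using dc d(2) c(2) by (simp add: sec_commutator)
    next
      case False
      then have "sec d z = \<one>" using d(1) z by (simp add: fixer_def)
      then show ?thesis using dc d(2) c(2) by (simp add: sec_commutator)
    qed
    then have "supported_at x (k \<otimes> l \<otimes> inv k \<otimes> inv l) (d \<otimes> c \<otimes> inv d \<otimes> inv c)"
      using dc d c by (simp add: supported_at_def sec_commutator)
    moreover have "d \<otimes> c \<otimes> inv d \<otimes> inv c \<in> G'" using dc(1,2) by (rule commutator_in_derived)
    ultimately show "\<exists>g\<in>G'. supported_at x (k \<otimes> l \<otimes> inv k \<otimes> inv l) g" by (rule bexI)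
  qed
  then show ?thesis using assms by blast
qed

abbreviation der :: "nat \<Rightarrow> 'a set" where
  "der n \<equiv> (derived G ^^ n) (carrier G)"

lemma subgroup_der: "subgroup (der n) G"
  by (rule exp_of_derived_is_subgroup[OF subgroup_self])

lemma normal_der: "der n \<lhd> G"
  by (induction n) (simp_all add: normal_self derived_is_normal)

lemma finite_rcosets_der: "finite (rcosets (der n))"
proof (induction n)
  case 0 show ?case using finite_rcosets_level_stab[of 0] by simp
next
  case (Suc n) then show ?case using finite_rcosets_derived_normal[OF normal_der] by simp
qed

lemma der_Suc_le: "der (Suc n) \<subseteq> der n"
  using derived_incl[OF subset_refl subgroup_der] by simp

text \<open>Commutators of elements supported at \<open>x\<close> are supported there, so the
  inclusion propagates down the derived series with the same shift by one.\<close>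

lemma supported_in_der:
  assumes "q \<in> der (Suc (Suc n))"
  shows "\<exists>g\<in>der (Suc n). supported_at x q g"
  using assms
proof (induction n arbitrary: q)
  case 0 then show ?case using supported_in_derived by simp
next
  case (Suc n)
  have "derived G (der (Suc (Suc n))) \<subseteq> {k. \<exists>g\<in>der (Suc (Suc n)). supported_at x k g}"
    unfolding derived_incl_iff[OF subgroup_supported[OF subgroup_der] subgroup.subset[OF subgroup_der]]
  proof (intro ballI CollectI)
    fix k l assume kl: "k \<in> der (Suc (Suc n))" "l \<in> der (Suc (Suc n))"
    from Suc.IH[OF kl(1)] obtain g where g: "g \<in> der (Suc n)" "supported_at x k g" by (elim bexE)
    from Suc.IH[OF kl(2)] obtain h where h: "h \<in> der (Suc n)" "supported_at x l h" by (elim bexE)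
    have "g \<otimes> h \<otimes> inv g \<otimes> inv h \<in> der (Suc (Suc n))"
      using commutator_in_derived[OF g(1) h(1)] by simp
    with supported_at_commutator[OF g(2) h(2)]
    show "\<exists>g\<in>der (Suc (Suc n)). supported_at x (k \<otimes> l \<otimes> inv k \<otimes> inv l) g" by (rule bexI)
  qed
  then show ?case using Suc.prems by (simp add: subset_iff)
qed

text \<open>The supported pieces are multiplied up letter by letter to an element of
  \<open>M\<close> with the rotation and sections of \<open>k\<close>, which equals \<open>k\<close>
  by \<open>eqI\<close>.\<close>

lemma mem_of_supported:
  assumes M: "subgroup M G" and k: "k \<in> carrier G" "rot k = 0"
    and supp: "\<And>x. x \<in> {0..<int p} \<Longrightarrow> \<exists>g\<in>M. supported_at x (sec k x) g"
  shows "k \<in> M"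
proof -
  interpret M: subgroup M G by fact
  have "\<exists>g\<in>M. rot g = 0 \<and> (\<forall>x\<in>{0..<int p}. sec g x = (if x < int n then sec k x else \<one>))"
    if "n \<le> p" for n
    using that
  proof (induction n)
    case 0 show ?case by (intro bexI[of _ \<one>]) auto
  next
    case (Suc n)
    then obtain g where g: "g \<in> M" "rot g = 0"
      "\<And>x. x \<in> {0..<int p} \<Longrightarrow> sec g x = (if x < int n then sec k x else \<one>)" by auto
    from supp[of "int n"] Suc.prems obtain h where h: "h \<in> M" "supported_at (int n) (sec k (int n)) h"
      by auto
    have "sec (g \<otimes> h) x = (if x < int (Suc n) then sec k x else \<one>)" if x: "x \<in> {0..<int p}" for x
    proof (cases "x = int n")
      case True then show ?thesis using g h x k by (simp add: sec_mult supported_at_def)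
    next
      case False
      then have "x mod int p \<noteq> int n mod int p" using x Suc.prems by simp
      then have "sec h x = \<one>" using h(2) by (simp add: supported_at_def)
      then show ?thesis using g h x k False by (simp add: sec_mult)
    qed
    then show ?case using g h by (intro bexI[of _ "g \<otimes> h"]) (auto simp: rot_mult supported_at_def)
  qed
  from this[of p] obtain g where g: "g \<in> M" "rot g = 0" "\<And>x. x \<in> {0..<int p} \<Longrightarrow> sec g x = sec k x" by auto
  have "k = g"
  proof (rule eqI)
    fix x
    have "sec k (x mod int p) = sec g (x mod int p)" using g(3)[of "x mod int p"] p_pos by simp
    then show "sec k x = sec g x" using g(1) k by simp
  qed (use g k in simp_all)
  then show ?thesis using g(1) by simp
qed

subsection \<open>Normal subgroups\<close>

lemma finite_rcosets_of_lift_sub: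
  assumes N: "subgroup N G" and P: "P \<lhd> G" "finite (rcosets P)"
    and supp: "\<And>k x. k \<in> P \<Longrightarrow> \<exists>g\<in>N. supported_at x k g"
  shows "finite (rcosets N)"
proof (rule finite_rcosets_mono[OF _ N _ finite_rcosets_lift_sub[OF P]])
  show "subgroup (lift_sub P) G" using normal_lift_sub[OF P(1)] by (rule normal_imp_subgroup)
  show "lift_sub P \<subseteq> N"
    by (rule subsetI, rule mem_of_supported[OF N]) (auto simp: lift_sub_def intro: supp)
qed

lemma normal_supported:
  assumes N: "N \<lhd> G"
  shows "{k. \<exists>g\<in>N. supported_at x k g} \<lhd> G"
  unfolding normal_inv_iff
proof (intro conjI ballI)
  show "subgroup {k. \<exists>g\<in>N. supported_at x k g} G" using N by (intro subgroup_supported normal_imp_subgroup)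
  fix q k assume q: "q \<in> carrier G" and "k \<in> {k. \<exists>g\<in>N. supported_at x k g}"
  then obtain g where g: "g \<in> N" "supported_at x k g" by auto
  obtain s where s: "s \<in> carrier G" "rot s = 0" "sec s x = q" using ex_sec_eq[OF q] by blast
  have "supported_at x (q \<otimes> k \<otimes> inv q) (s \<otimes> g \<otimes> inv s)"
    using g(2) s by (auto simp: supported_at_def rot_conj sec_conj)
  moreover have "s \<otimes> g \<otimes> inv s \<in> N" using N g(1) s(1) by (simp add: normal_inv_iff)
  ultimately show "q \<otimes> k \<otimes> inv q \<in> {k. \<exists>g\<in>N. supported_at x k g}" by auto
qed

lemma supported_translate:
  assumes N: "N \<lhd> G" and g: "g \<in> N" "supported_at x k g"
  shows "\<exists>h\<in>N. supported_at y k h"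
proof (rule bexI)
  define c where "c = a [^] (x - y)"
  have c: "c \<in> carrier G" by (simp add: c_def)
  show "c \<otimes> g \<otimes> inv c \<in> N" using N g(1) c by (simp add: normal_inv_iff)
  have gc: "g \<in> carrier G" "rot g = 0" using g(2) by (auto simp: supported_at_def)
  have sec_c: "sec (c \<otimes> g \<otimes> inv c) z = sec g (z + (x - y))" for z
  proof -
    have "sec g (z + rot c) = sec g (z + (x - y))"
      using gc by (intro sec_cong) (simp_all add: c_def mod_simps)
    moreover have "sec c z = \<one>" by (simp add: c_def)
    ultimately show ?thesis using gc c by (simp add: sec_conj)
  qed
  have "sec g (z + (x - y)) = \<one>" if "z mod int p \<noteq> y mod int p" for z
  proof -
    have "\<not> int p dvd (z + (x - y)) - x" using that by (simp add: mod_eq_dvd_iff)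
    then have "(z + (x - y)) mod int p \<noteq> x mod int p" unfolding mod_eq_dvd_iff .
    then show ?thesis using g(2) by (simp add: supported_at_def)
  qed
  then show "supported_at y k (c \<otimes> g \<otimes> inv c)"
    using g(2) gc c by (auto simp: supported_at_def rot_conj sec_c)
qed

text \<open>If \<open>h\<close> moves \<open>x\<close> and \<open>k\<close>, \<open>l\<close> are supported below \<open>x\<close>, then the commutator of \<open>h\<close>
  and \<open>k\<close> agrees with the inverse of \<open>k\<close> below \<open>x\<close>, and commuting it with \<open>l\<close> removes its other
  part.\<close>

lemma finite_rcosets_of_double_commutators:
  assumes "h \<in> carrier G" "h \<notin> level_stab n" "N \<lhd> G"
    and "\<And>k l. \<lbrakk>k \<in> der m; l \<in> der m\<rbrakk> \<Longrightarrow>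
      (h \<otimes> k \<otimes> inv h \<otimes> inv k) \<otimes> l \<otimes> inv (h \<otimes> k \<otimes> inv h \<otimes> inv k) \<otimes> inv l \<in> N"
  shows "finite (rcosets N)"
  using assms
proof (induction n arbitrary: h m N)
  case 0 then show ?case by simp
next
  case (Suc n)
  note h = Suc.prems(1) and N = Suc.prems(3)
  note sub = normal_imp_subgroup[OF N]
  have supp: "\<exists>k\<in>der m. supported_at x q k" if "q \<in> der (Suc (Suc m))" for q x
    using supported_in_der[OF that, of x] der_Suc_le[of m] by blast
  have derc: "q \<in> carrier G" if "q \<in> der m" for q m using subgroup.subset[OF subgroup_der] that by blast
  show ?case
  proof (cases "rot h = 0")
    case False
    have com: "supported_at x (inv q \<otimes> q' \<otimes> inv (inv q) \<otimes> inv q')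
        ((h \<otimes> k \<otimes> inv h \<otimes> inv k) \<otimes> l \<otimes> inv (h \<otimes> k \<otimes> inv h \<otimes> inv k) \<otimes> inv l)"
      if k: "supported_at x q k" and l: "supported_at x q' l" for x q q' k l
    proof -
      have kl: "k \<in> carrier G" "rot k = 0" "l \<in> carrier G" "rot l = 0" "sec k x = q" "sec l x = q'"
        using k l by (auto simp: supported_at_def)
      define c where "c = h \<otimes> k \<otimes> inv h \<otimes> inv k"
      have c: "c \<in> carrier G" "rot c = 0" using h kl by (simp_all add: c_def rot_commutator)
      have qc: "q \<in> carrier G" using kl(1,5) by auto
      have "(x + rot h) mod int p \<noteq> x mod int p"
      proof
        assume "(x + rot h) mod int p = x mod int p"
        then have "int p dvd rot h" by (simp add: mod_eq_dvd_iff)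
        then show False using False rot_mod[OF h] by (metis dvd_imp_mod_0)
      qed
      then have "sec k (x + rot h) = \<one>" using k by (simp add: supported_at_def)
      then have "sec (h \<otimes> k \<otimes> inv h) x = \<one>" using h kl by (simp add: sec_conj)
      then have cx: "sec c x = inv q"
        using h kl qc by (simp add: c_def sec_mult[of "h \<otimes> k \<otimes> inv h"] rot_conj sec_inv)
      have cl: "sec (c \<otimes> l \<otimes> inv c \<otimes> inv l) z = sec c z \<otimes> sec l z \<otimes> inv (sec c z) \<otimes> inv (sec l z)" for z
        using c kl by (simp add: sec_commutator)
      have "sec (c \<otimes> l \<otimes> inv c \<otimes> inv l) z = \<one>" if "z mod int p \<noteq> x mod int p" for z
      proof -
        have "sec l z = \<one>" using l that by (simp add: supported_at_def)
        then show ?thesis unfolding cl using c by simp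
      qed
      moreover have "sec (c \<otimes> l \<otimes> inv c \<otimes> inv l) x = inv q \<otimes> q' \<otimes> inv (inv q) \<otimes> inv q'"
        unfolding cl cx kl(6) by (rule refl)
      moreover have "c \<otimes> l \<otimes> inv c \<otimes> inv l \<in> carrier G" "rot (c \<otimes> l \<otimes> inv c \<otimes> inv l) = 0"
        using c kl by (simp_all add: rot_commutator)
      ultimately show ?thesis unfolding c_def[symmetric] supported_at_def by simp
    qed
    have "\<exists>g\<in>N. supported_at x q g" if q: "q \<in> derived G (der (Suc (Suc m)))" for q x
    proof -
      have "derived G (der (Suc (Suc m))) \<subseteq> {k. \<exists>g\<in>N. supported_at x k g}"
        unfolding derived_incl_iff[OF subgroup_supported[OF sub] subgroup.subset[OF subgroup_der]]
      proof (intro ballI CollectI)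
        fix r s assume rs: "r \<in> der (Suc (Suc m))" "s \<in> der (Suc (Suc m))"
        \<comment> \<open>Below \<open>x\<close> the commutator of \<open>h\<close> and
          \<open>k\<close> shows the inverse of the section of \<open>k\<close>, hence the choice of
          \<open>inv r\<close>.\<close>
        have "inv r \<in> der (Suc (Suc m))" using subgroup_der rs(1) by (rule subgroup.m_inv_closed)
        from supp[OF this, of x] obtain k where k: "k \<in> der m" "supported_at x (inv r) k" by (elim bexE)
        from supp[OF rs(2), of x] obtain l where l: "l \<in> der m" "supported_at x s l" by (elim bexE)
        have "inv (inv r) = r" using derc[OF rs(1)] by simp
        with com[OF k(2) l(2)] Suc.prems(4)[OF k(1) l(1)]
        show "\<exists>g\<in>N. supported_at x (r \<otimes> s \<otimes> inv r \<otimes> inv s) g" by (intro bexI) simp_all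
      qed
      then show ?thesis using q by blast
    qed
    then show ?thesis
      using finite_rcosets_of_lift_sub[OF sub derived_is_normal[OF normal_der]
          finite_rcosets_derived_normal[OF normal_der finite_rcosets_der]] by blast
  next
    case True
    then obtain x where x: "sec h x \<notin> level_stab n"
      using Suc.prems(2) h by (auto simp: lift_sub_def)
    \<comment> \<open>Descend to the section of \<open>h\<close>, with \<open>N\<close> replaced by
      what it realizes at \<open>x\<close>. Elements below \<open>x\<close> are lifted from two
      derived steps further down, which is why \<open>m\<close> varies in the induction.\<close>
    let ?N = "{q. \<exists>g\<in>N. supported_at x q g}"
    have "finite (rcosets ?N)"
    proof (rule Suc.IH[OF _ x normal_supported[OF N]])
      show "sec h x \<in> carrier G" using h by simp
      fix q r assume qr: "q \<in> der (Suc (Suc m))" "r \<in> der (Suc (Suc m))"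
      from supp[OF qr(1), of x] obtain k where k: "k \<in> der m" "supported_at x q k" by (elim bexE)
      from supp[OF qr(2), of x] obtain l where l: "l \<in> der m" "supported_at x r l" by (elim bexE)
      have kc: "k \<in> carrier G" "rot k = 0" "sec k x = q" using k by (auto simp: supported_at_def)
      have "supported_at x (sec h x \<otimes> q \<otimes> inv (sec h x) \<otimes> inv q) (h \<otimes> k \<otimes> inv h \<otimes> inv k)"
        using k(2) kc h True by (auto simp: supported_at_def sec_commutator)
      from supported_at_commutator[OF this l(2)] Suc.prems(4)[OF k(1) l(1)]
      show "(sec h x \<otimes> q \<otimes> inv (sec h x) \<otimes> inv q) \<otimes> r \<otimes>
          inv (sec h x \<otimes> q \<otimes> inv (sec h x) \<otimes> inv q) \<otimes> inv r \<in> ?N" by blast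
    qed
    then show ?thesis
      using finite_rcosets_of_lift_sub[OF sub normal_supported[OF N]] supported_translate[OF N] by blast
  qed
qed

text \<open>Some level is moved by \<open>h\<close>, and normality puts all its double commutators
  into \<open>N\<close>, so \<open>m = 0\<close> works.\<close>

lemma finite_rcosets_normal:
  assumes N: "N \<lhd> G" and h: "h \<in> N" "h \<noteq> \<one>"
  shows "finite (rcosets N)"
proof -
  interpret N: normal N G by fact
  have hc: "h \<in> carrier G" using h by simp
  obtain n where n: "h \<notin> level_stab n" using separated[OF hc] h(2) by blast
  show ?thesis
  proof (rule finite_rcosets_of_double_commutators[OF hc n N])
    have com: "x \<otimes> y \<otimes> inv x \<otimes> inv y \<in> N" if "x \<in> N" "y \<in> carrier G" for x y
    proof -
      have "x \<otimes> (y \<otimes> inv x \<otimes> inv y) \<in> N"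
        using that(1) N.inv_op_closed2[OF that(2) N.m_inv_closed[OF that(1)]] by (rule N.m_closed)
      then show ?thesis using that by (simp add: m_assoc)
    qed
    fix k l assume "k \<in> der 0" "l \<in> der 0"
    then have kl: "k \<in> carrier G" "l \<in> carrier G" by simp_all
    show "(h \<otimes> k \<otimes> inv h \<otimes> inv k) \<otimes> l \<otimes> inv (h \<otimes> k \<otimes> inv h \<otimes> inv k) \<otimes> inv l \<in> N"
      by (rule com[OF com[OF h(1) kl(1)] kl(2)])
  qed
qed

text \<open>Otherwise the intersection, which has finite index, would be abelian; its trivial
  derived subgroup would have finite index too, and \<open>G\<close> would be finite.\<close>

lemma normal_subgroups_do_not_commute:
  assumes N: "N1 \<lhd> G" "N2 \<lhd> G" and nt: "x1 \<in> N1" "x1 \<noteq> \<one>" "x2 \<in> N2" "x2 \<noteq> \<one>"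
  shows "\<exists>n1\<in>N1. \<exists>n2\<in>N2. n1 \<otimes> n2 \<otimes> inv n1 \<otimes> inv n2 \<noteq> \<one>"
proof (rule ccontr)
  assume neg: "\<not> ?thesis"
  define J where "J = (\<Inter>i\<in>{N1, N2}. i)"
  have J: "J \<lhd> G" "finite (rcosets J)"
    unfolding J_def
    using finite_rcosets_INT[of "{N1, N2}" "\<lambda>i. i"] N
      finite_rcosets_normal[OF N(1) nt(1,2)] finite_rcosets_normal[OF N(2) nt(3,4)] by auto
  have "derived G J \<subseteq> {\<one>}"
    using derived_incl_iff[OF triv_subgroup subgroup.subset[OF normal_imp_subgroup[OF J(1)]]] neg
    by (auto simp: J_def)
  then have fin: "finite (rcosets {\<one>})"
    using finite_rcosets_mono[OF _ triv_subgroup _ finite_rcosets_derived_normal[OF J]]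
      derived_is_subgroup subgroup.subset[OF normal_imp_subgroup[OF J(1)]] by blast
  have "inj_on (\<lambda>x. {\<one>} #> x) (carrier G)"
  proof (rule inj_onI)
    fix x y assume xy: "x \<in> carrier G" "y \<in> carrier G" "{\<one>} #> x = {\<one>} #> y"
    then have "x \<otimes> inv y = \<one>" by (simp add: rcos_eq_iff[OF triv_subgroup])
    then have "x \<otimes> inv y \<otimes> y = \<one> \<otimes> y" by (rule arg_cong)
    then show "x = y" using xy by (simp add: m_assoc)
  qed
  then have "finite (carrier G)" using fin unfolding finite_rcosets_iff by (simp add: finite_image_iff)
  then show False using infinite_carrier by simp
qed

subsection \<open>Sections of subgroups supplementing the derived subgroup\<close>

lemma rot_derived:
  assumes "d \<in> G'" shows "rot d = 0"
proof -
  have "G' \<subseteq> level_stab (Suc 0)"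
    using derived_incl_iff[OF normal_imp_subgroup[OF normal_level_stab] subset_refl, of "Suc 0"]
    by (auto simp: lift_sub_def rot_commutator)
  then show ?thesis using assms by (auto simp: lift_sub_def)
qed

text \<open>Otherwise every \<open>bb v\<close> would lie in \<open>G'\<close>, as rotations force
  the power of \<open>a\<close> to be trivial. The cyclic group generated by \<open>a\<close> would
  then be full and supplement the stabilizer of level two, although a nonzero entry of the vector of
  \<open>bb w\<close> is visible on that level.\<close>

lemma ex_bb_notin_derived: "\<exists>v. \<forall>j::int. bb v \<otimes> a [^] j \<notin> G'"
proof (rule ccontr)
  assume "\<not> ?thesis"
  then have all: "\<exists>j::int. bb v \<otimes> a [^] j \<in> G'" for v by blast
  have bbG': "bb v \<in> G'" for v
  proof -
    obtain j :: int where j: "bb v \<otimes> a [^] j \<in> G'" using all by blast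
    then have "j mod int p = 0" using rot_derived[OF j] by (simp add: rot_mult)
    then have "a [^] j = \<one>" by (intro a_pow_dvd) (simp add: mod_eq_0_iff_dvd)
    then show ?thesis using j by simp
  qed
  let ?A = "generate G {a}"
  have A: "full_mod_derived ?A"
    unfolding full_mod_derived_def
  proof (intro conjI allI impI)
    show "subgroup ?A G" by (rule generate_is_subgroup) simp
    fix N assume N: "subgroup N G \<and> ?A \<subseteq> N \<and> G' \<subseteq> N"
    show "N = carrier G"
    proof (rule subgroup_eq_carrierI)
      show "subgroup N G" using N by simp
      show "a \<in> N" using N generate.incl[of a "{a}" G] by blast
      show "bb v \<in> N" for v using N bbG' by blast
    qed
  qed
  obtain w t where t: "\<not> int p dvd t" "\<not> int p dvd e w t" using nontrivial by auto
  from supplement[OF A normal_level_stab finite_rcosets_level_stab bb_closed, of "Suc (Suc 0)" w]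
  obtain g k where gk: "g \<in> ?A" "k \<in> level_stab (Suc (Suc 0))" "bb w = g \<otimes> k" by (elim bexE)
  obtain j :: int where j: "g = a [^] j" using gk(1) by (auto simp: generate_pow[OF a_closed])
  have k: "k \<in> carrier G" "rot k = 0" "\<And>x. rot (sec k x) = 0" using gk(2) by (auto simp: lift_sub_def)
  have "rot (bb w) = j mod int p" unfolding gk(3) j using k by (simp add: rot_mult)
  then have "j mod int p = 0" by simp
  then have "a [^] j = \<one>" by (intro a_pow_dvd) (simp add: mod_eq_0_iff_dvd)
  then have "bb w = k" using gk(3) j k by simp
  then have "rot (sec (bb w) t) = 0" using k by simp
  then have "e w t mod int p = 0" using t(1) by (simp add: sec_bb)
  then show False using t(2) by (simp add: mod_eq_0_iff_dvd)
qed

text \<open>A section at \<open>y\<close> that lies in the derived subgroup can be corrected to the identity, because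
  the derived subgroup is generated by commutators of sections at \<open>y\<close> of elements of \<open>M\<close>.\<close>

lemma ex_fixer_sec_nontrivial:
  assumes M: "full_mod_derived M" and My: "sect M y = carrier G"
    and xy: "x mod int p \<noteq> y mod int p"
  shows "\<exists>g\<in>sect (fixer M {y}) x. g \<noteq> \<one>"
proof -
  interpret M: subgroup M G using M by (rule full_mod_derived_subgroup)
  have sub': "subgroup G' G" by (simp add: derived_is_subgroup)
  obtain v where v: "\<And>j::int. bb v \<otimes> a [^] j \<notin> G'" using ex_bb_notin_derived by blast
  \<comment> \<open>An element of \<open>G\<close> with the desired behaviour: trivial at
    \<open>y\<close>, and with section at \<open>x\<close> outside \<open>G'\<close>. Its factor
    \<open>m\<close> in \<open>M\<close> behaves in the same way modulo \<open>G'\<close>.\<close>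
  obtain s j where s: "s \<in> fixer (carrier G) {y}" "sec s x = bb v \<otimes> a [^] (j::int)"
    using ex_fixer_sec_bb[OF xy] by blast
  have s': "s \<in> carrier G" "rot s = 0" "sec s y = \<one>" using s(1) by (auto simp: fixer_def)
  note K = normal_lift_sub[OF derived_self_is_normal] finite_rcosets_lift_sub[OF derived_self_is_normal finite_rcosets_G']
  from supplement[OF M K s'(1)] obtain m k where mk: "m \<in> M" "k \<in> lift_sub G'" "s = m \<otimes> k" by (elim bexE)
  have k: "k \<in> carrier G" "rot k = 0" "\<And>z. sec k z \<in> G'" using mk(2) by (auto simp: lift_sub_def)
  have rm: "rot m = 0" using s'(2) mk k by (simp add: rot_mult)
  have sec_s: "sec s z = sec m z \<otimes> sec k z" for z using mk k rm by (simp add: sec_mult)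
  have my: "sec m y \<in> G'"
  proof -
    have "sec m y = inv (sec k y)"
      using sec_s[of y] s'(3) mk(1) k(1) by (intro inv_equality[symmetric]) simp_all
    then show ?thesis using subgroup.m_inv_closed[OF sub' k(3)] by simp
  qed
  have mx: "sec m x \<notin> G'"
  proof
    assume "sec m x \<in> G'"
    then have "sec s x \<in> G'" unfolding sec_s using k(3) by (rule subgroup.m_closed[OF sub'])
    then show False using s(2) v by simp
  qed
  define Z where "Z = sect {h \<in> M. rot h = 0 \<and> (\<forall>z\<in>{x}. sec h z \<in> G')} y"
  have Z: "subgroup Z G"
    unfolding Z_def by (intro subgroup_sect subgroup_sec_in M.subgroup_axioms sub')
  have "G' \<subseteq> Z"
    unfolding derived_incl_iff[OF Z subset_refl]
  proof (intro ballI)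
    fix g1 g2 assume "g1 \<in> carrier G" "g2 \<in> carrier G"
    then have "g1 \<in> sect M y" "g2 \<in> sect M y" using My by simp_all
    then obtain h1 h2 where h: "h1 \<in> M" "rot h1 = 0" "g1 = sec h1 y" "h2 \<in> M" "rot h2 = 0" "g2 = sec h2 y"
      by (elim sectE)
    have "g1 \<otimes> g2 \<otimes> inv g1 \<otimes> inv g2 = sec (h1 \<otimes> h2 \<otimes> inv h1 \<otimes> inv h2) y"
      using h by (simp add: sec_commutator)
    moreover have "sec (h1 \<otimes> h2 \<otimes> inv h1 \<otimes> inv h2) x \<in> G'"
      using h commutator_in_derived[of "sec h1 x" "carrier G" "sec h2 x"] by (simp add: sec_commutator)
    ultimately show "g1 \<otimes> g2 \<otimes> inv g1 \<otimes> inv g2 \<in> Z"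
      unfolding Z_def using h by (auto intro!: sectI simp: rot_commutator)
  qed
  then have "sec m y \<in> Z" using my by blast
  then obtain h where h: "h \<in> M" "rot h = 0" "sec h x \<in> G'" "sec m y = sec h y"
    unfolding Z_def by (auto elim!: sectE)
  define c where "c = m \<otimes> inv h"
  have c: "c \<in> M" "rot c = 0" "\<And>z. sec c z = sec m z \<otimes> inv (sec h z)"
    using mk(1) h rm by (simp_all add: c_def rot_div sec_div)
  have "sec c y = \<one>" using c(3)[of y] h mk(1) by simp
  then have "c \<in> fixer M {y}" using c by (simp add: fixer_def)
  then have "sec c x \<in> sect (fixer M {y}) x" using c(2) by (rule sectI)
  moreover have "sec c x \<noteq> \<one>"
  proof
    assume "sec c x = \<one>"
    then have "sec m x \<otimes> inv (sec h x) \<otimes> sec h x = \<one> \<otimes> sec h x" using c(3)[of x] by simp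
    then have "sec m x = sec h x" using mk(1) h(1) by (simp add: m_assoc)
    then show False using mx h(3) by simp
  qed
  ultimately show ?thesis by blast
qed

text \<open>The sections at \<open>x\<close> of elements trivial on \<open>Y\<close>, and of those
  trivial at \<open>y\<close>, form two nontrivial normal subgroups of \<open>G\<close>. These do
  not commute, and a commutator of lifts is trivial on \<open>insert y Y\<close>.\<close>

lemma ex_fixer_all:
  assumes M: "full_mod_derived M" and Ms: "\<And>y. sect M y = carrier G"
    and Y: "finite Y" "\<And>y. y \<in> Y \<Longrightarrow> x mod int p \<noteq> y mod int p"
  shows "\<exists>g\<in>sect (fixer M Y) x. g \<noteq> \<one>"
  using Y
proof (induction Y)
  case empty
  have "a \<in> sect (fixer M {}) x" using Ms[of x] a_closed by (auto simp: sect_def fixer_def)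
  moreover have "a \<noteq> \<one>" using rot_a rot_one by force
  ultimately show ?case by blast
next
  case (insert y Y)
  interpret M: subgroup M G using M by (rule full_mod_derived_subgroup)
  obtain g1 where g1: "g1 \<in> sect (fixer M Y) x" "g1 \<noteq> \<one>" using insert by auto
  obtain g2 where g2: "g2 \<in> sect (fixer M {y}) x" "g2 \<noteq> \<one>"
    using ex_fixer_sec_nontrivial[OF M Ms, of x y] insert.prems by auto
  from normal_subgroups_do_not_commute[OF sect_fixer_normal[OF M.subgroup_axioms Ms]
      sect_fixer_normal[OF M.subgroup_axioms Ms] g1 g2]
  obtain n1 n2 where n: "n1 \<in> sect (fixer M Y) x" "n2 \<in> sect (fixer M {y}) x"
    "n1 \<otimes> n2 \<otimes> inv n1 \<otimes> inv n2 \<noteq> \<one>" by (elim bexE)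
  from n(1) obtain h1 where h1: "h1 \<in> fixer M Y" "n1 = sec h1 x" by (rule sectE)
  from n(2) obtain h2 where h2: "h2 \<in> fixer M {y}" "n2 = sec h2 x" by (rule sectE)
  have h: "h1 \<in> M" "rot h1 = 0" "h2 \<in> M" "rot h2 = 0" using h1 h2 by (auto simp: fixer_def)
  have "h1 \<otimes> h2 \<otimes> inv h1 \<otimes> inv h2 \<in> fixer M (insert y Y)"
    using h h1(1) h2(1) by (auto simp: fixer_def rot_commutator sec_commutator)
  moreover have "sec (h1 \<otimes> h2 \<otimes> inv h1 \<otimes> inv h2) x = n1 \<otimes> n2 \<otimes> inv n1 \<otimes> inv n2"
    using h by (simp add: sec_commutator h1 h2)
  moreover have "rot (h1 \<otimes> h2 \<otimes> inv h1 \<otimes> inv h2) = 0" using h by (simp add: rot_commutator)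
  ultimately have "n1 \<otimes> n2 \<otimes> inv n1 \<otimes> inv n2 \<in> sect (fixer M (insert y Y)) x"
    using sectI[of "h1 \<otimes> h2 \<otimes> inv h1 \<otimes> inv h2" _ x] by simp
  then show ?case using n(3) by blast
qed

theorem full_if_sect_full:
  assumes M: "full_mod_derived M" and Mx: "sect M x = carrier G"
  shows "M = carrier G"
proof -
  interpret M: subgroup M G using M by (rule full_mod_derived_subgroup)
  note Ms = sect_eq_carrier_all[OF M Mx]
  define L where "L x = sect (fixer M ({0..<int p} - {x})) x" for x
  have L: "L x \<lhd> G" "finite (rcosets (L x))" if x: "x \<in> {0..<int p}" for x
  proof -
    show N: "L x \<lhd> G" unfolding L_def by (rule sect_fixer_normal[OF M.subgroup_axioms Ms])
    have "\<exists>g\<in>L x. g \<noteq> \<one>"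
      unfolding L_def by (rule ex_fixer_all[OF M Ms]) (use x in auto)
    then show "finite (rcosets (L x))" using finite_rcosets_normal[OF N] by blast
  qed
  \<comment> \<open>Each \<open>L x\<close> consists of the elements that \<open>M\<close> realizes
    with support at \<open>x\<close>. The intersection serves all letters at once and still has
    finite index.\<close>
  define P where "P = (\<Inter>x\<in>{0..<int p}. L x)"
  have P: "P \<lhd> G" "finite (rcosets P)"
    using finite_rcosets_INT[of "{0..<int p}" L] L p_pos by (auto simp: P_def)
  have "lift_sub P \<subseteq> M"
  proof
    fix k assume k: "k \<in> lift_sub P"
    show "k \<in> M"
    proof (rule mem_of_supported[OF M.subgroup_axioms])
      fix x assume x: "x \<in> {0..<int p}"
      have "sec k x \<in> L x" using k x by (auto simp: lift_sub_def P_def)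
      then obtain g where g: "g \<in> fixer M ({0..<int p} - {x})" "sec k x = sec g x"
        unfolding L_def by (rule sectE)
      have gM: "g \<in> M" "rot g = 0" using g(1) by (auto simp: fixer_def)
      have "sec g y = \<one>" if "y mod int p \<noteq> x mod int p" for y
      proof -
        have "y mod int p \<in> {0..<int p} - {x}" using that x p_pos by auto
        then have "sec g (y mod int p) = \<one>" using g(1) unfolding fixer_def by blast
        then show ?thesis using gM by simp
      qed
      then have "supported_at x (sec k x) g" using gM g(2) by (simp add: supported_at_def)
      then show "\<exists>g\<in>M. supported_at x (sec k x) g" using gM(1) by blast
    qed (use k in \<open>auto simp: lift_sub_def\<close>)
  qed
  show ?thesis
  proof
    show "M \<subseteq> carrier G" by (rule M.subset)
    show "carrier G \<subseteq> M"
    proof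
      fix g assume "g \<in> carrier G"
      from supplement[OF M normal_lift_sub[OF P(1)] finite_rcosets_lift_sub[OF P] this]
      obtain m k where "m \<in> M" "k \<in> lift_sub P" "g = m \<otimes> k" by (elim bexE)
      then show "g \<in> M" using \<open>lift_sub P \<subseteq> M\<close> by (simp add: subset_iff)
    qed
  qed
qed

subsection \<open>Syllable lengths\<close>

text \<open>\<open>n\<close> is the length of some expression, not of a shortest one, and
  \<open>v\<close> is the total of its vectors. The total is carried along because it splits
  additively over the sections and so shows which of them remain relevant.\<close>

inductive syllables :: "'a \<Rightarrow> nat \<Rightarrow> 'v \<Rightarrow> bool" where
  syllables_pow: "syllables (a [^] (j::int)) 0 0"
| syllables_bb: "syllables g n v \<Longrightarrow> syllables (g \<otimes> bb u \<otimes> a [^] (j::int)) (Suc n) (v + u)"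

lemma syllables_closed: "syllables g n v \<Longrightarrow> g \<in> carrier G"
  by (induction rule: syllables.induct) auto

lemma syllables_mult_pow:
  assumes "syllables g n v" shows "syllables (g \<otimes> a [^] (j::int)) n v"
  using assms
proof cases
  case (syllables_pow i)
  have "a [^] i \<otimes> a [^] j = a [^] (i + j)" by (simp add: int_pow_mult)
  then show ?thesis using syllables_pow syllables.syllables_pow[of "i + j"] by simp
next
  case (syllables_bb h m u' u i)
  have "h \<otimes> bb u \<otimes> a [^] i \<otimes> a [^] j = h \<otimes> bb u \<otimes> a [^] (i + j)"
    using syllables_closed[OF syllables_bb(4)] by (simp add: int_pow_mult m_assoc)
  then show ?thesis using syllables_bb syllables.syllables_bb[of h m u' u "i + j"] by simp
qed

lemma syllables_mult:
  assumes "syllables h m u" "syllables g n v"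
  shows "syllables (g \<otimes> h) (n + m) (v + u)"
  using assms(1)
proof (induction rule: syllables.induct)
  case (syllables_pow j) then show ?case using syllables_mult_pow[OF assms(2)] by simp
next
  case (syllables_bb h m u w j)
  have "g \<otimes> (h \<otimes> bb w \<otimes> a [^] j) = g \<otimes> h \<otimes> bb w \<otimes> a [^] j"
    using syllables_closed[OF syllables_bb.hyps] syllables_closed[OF assms(2)] by (simp add: m_assoc)
  then show ?case using syllables.syllables_bb[OF syllables_bb.IH, of w j] by (simp add: add.assoc)
qed

lemma syllables_of_bb: "syllables (bb v) 1 v"
  using syllables_bb[OF syllables_pow[of 0], of v 0] by simp

lemma syllables_inv: "syllables g n v \<Longrightarrow> syllables (inv g) n (- v)"
proof (induction rule: syllables.induct)
  case (syllables_pow j)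
  then show ?case using syllables.syllables_pow[of "- j"] by (simp add: int_pow_neg)
next
  case (syllables_bb g n v u j)
  have g: "g \<in> carrier G" using syllables_bb.hyps by (rule syllables_closed)
  have "syllables (a [^] (- j) \<otimes> (bb (- u) \<otimes> inv g)) (0 + (1 + n)) (0 + (- u + - v))"
    by (intro syllables_mult syllables_bb.IH syllables_of_bb syllables.syllables_pow)
  moreover have "inv (g \<otimes> bb u \<otimes> a [^] j) = a [^] (- j) \<otimes> (bb (- u) \<otimes> inv g)"
    using g by (simp add: inv_mult_group bb_uminus int_pow_neg)
  ultimately show ?case by (simp add: add.commute)
qed

lemma ex_syllables:
  assumes "g \<in> carrier G" shows "\<exists>n v. syllables g n v"
proof -
  let ?H = "{g. \<exists>n v. syllables g n v}"
  have "?H = carrier G"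
  proof (rule subgroup_eq_carrierI)
    show "subgroup ?H G"
    proof (rule subgroupI)
      show "?H \<noteq> {}" using syllables_of_bb by blast
    qed (use syllables_closed syllables_mult syllables_inv in blast)+
    show "a \<in> ?H" using syllables_pow[of 1] by auto
    show "bb v \<in> ?H" for v using syllables_of_bb by blast
  qed
  then show ?thesis using assms by blast
qed

lemma ex_syllables_derived:
  assumes "g \<in> G'" shows "\<exists>n. syllables g n 0"
proof -
  let ?H = "{g. \<exists>n. syllables g n 0}"
  have H: "subgroup ?H G"
  proof (rule subgroupI)
    show "?H \<subseteq> carrier G" using syllables_closed by blast
    show "?H \<noteq> {}" using syllables_pow by blast
    fix g assume "g \<in> ?H"
    then obtain n where n: "syllables g n 0" by blast
    show "inv g \<in> ?H" using syllables_inv[OF n] by auto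
    fix h assume "h \<in> ?H"
    then obtain m where m: "syllables h m 0" by blast
    show "g \<otimes> h \<in> ?H" using syllables_mult[OF m n] by auto
  qed
  have "G' \<subseteq> ?H"
    unfolding derived_incl_iff[OF H subset_refl]
  proof (intro ballI)
    fix x y assume "x \<in> carrier G" "y \<in> carrier G"
    then obtain n v m u where x: "syllables x n v" and y: "syllables y m u" using ex_syllables by meson
    have "syllables (x \<otimes> y \<otimes> inv x \<otimes> inv y) (n + m + n + m) (v + u + - v + - u)"
      by (intro syllables_mult syllables_inv x y)
    then show "x \<otimes> y \<otimes> inv x \<otimes> inv y \<in> ?H" by auto
  qed
  then show ?thesis using assms by blast
qed

text \<open>Elements of \<open>G'\<close> have expressions of total 0, so splitting off such a
  factor from \<open>bb v\<close> leaves an element of \<open>M\<close> that still has total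
  \<open>v\<close>.\<close>

lemma full_mod_derived_ex_syllables:
  assumes M: "full_mod_derived M"
  shows "\<exists>g\<in>M. \<exists>n. syllables g n v \<and> rot g = 0"
proof -
  interpret M: subgroup M G using M by (rule full_mod_derived_subgroup)
  from supplement[OF M derived_self_is_normal finite_rcosets_G' bb_closed, of v]
  obtain g d where gd: "g \<in> M" "d \<in> G'" "bb v = g \<otimes> d" by (elim bexE)
  have d: "d \<in> carrier G" "rot d = 0" using gd(2) rot_derived derived_in_carrier by auto
  obtain n where n: "syllables d n 0" using ex_syllables_derived[OF gd(2)] by blast
  have "syllables (bb v \<otimes> inv d) (1 + n) (v + - 0)" by (intro syllables_mult syllables_inv n syllables_of_bb)
  moreover have "bb v \<otimes> inv d = g" using gd d by (simp add: m_assoc)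
  moreover have "rot g = 0" using rot_bb[of v] gd d by (simp add: rot_mult)
  ultimately show ?thesis using gd(1) by auto
qed

abbreviation "I \<equiv> {0..<int p}"

lemma mod_in_I: "x mod int p \<in> I"
  using p_pos by simp

text \<open>The last clause describes the only case in which the sections are not all shorter.\<close>

lemma syllables_sec:
  assumes "syllables g n v"
  shows "\<exists>N V. (\<forall>x\<in>I. syllables (sec g x) (N x) (V x)) \<and> (\<Sum>x\<in>I. N x) = n \<and> (\<Sum>x\<in>I. V x) = v \<and>
    (\<forall>x\<in>I. N x = n \<longrightarrow> (\<exists>j::int. g = a [^] (- x) \<otimes> bb v \<otimes> a [^] j))"
  using assms
proof (induction rule: syllables.induct)
  case (syllables_pow j)
  have "a [^] j = a [^] (- x) \<otimes> bb 0 \<otimes> a [^] (j + x)" for x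
    by (simp flip: int_pow_mult)
  moreover have "syllables (sec (a [^] j) x) 0 0" for x
    using syllables.syllables_pow[of 0] by simp
  ultimately show ?case by (intro exI[of _ "\<lambda>_. 0"]) auto
next
  case (syllables_bb g n v u j)
  have g: "g \<in> carrier G" using syllables_bb.hyps by (rule syllables_closed)
  from syllables_bb.IH obtain N V where NV: "\<And>x. x \<in> I \<Longrightarrow> syllables (sec g x) (N x) (V x)"
    "(\<Sum>x\<in>I. N x) = n" "(\<Sum>x\<in>I. V x) = v"
    "\<And>x. x \<in> I \<Longrightarrow> N x = n \<Longrightarrow> \<exists>j::int. g = a [^] (- x) \<otimes> bb v \<otimes> a [^] j" by blast
  \<comment> \<open>The letter that \<open>g\<close> carries to 0: only below it does the new
    syllable survive.\<close>
  define x0 where "x0 = (- rot g) mod int p"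
  have x0: "x0 \<in> I" unfolding x0_def by (rule mod_in_I)
  have x0_iff: "int p dvd x + rot g \<longleftrightarrow> x = x0" if "x \<in> I" for x
  proof -
    have "int p dvd x + rot g \<longleftrightarrow> x mod int p = (- rot g) mod int p" by (simp add: mod_eq_dvd_iff)
    then show ?thesis using that by (simp add: x0_def)
  qed
  let ?N = "\<lambda>x. N x + (if x = x0 then 1 else 0)"
  let ?V = "\<lambda>x. V x + (if x = x0 then u else 0)"
  have "syllables (sec (g \<otimes> bb u \<otimes> a [^] j) x) (?N x) (?V x)" if x: "x \<in> I" for x
  proof (cases "x = x0")
    case True
    then have "sec (g \<otimes> bb u \<otimes> a [^] j) x = sec g x \<otimes> bb u \<otimes> a [^] (0::int)"
      using g x0_iff[OF x] by (simp add: sec_mult sec_bb)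
    then show ?thesis using True syllables.syllables_bb[OF NV(1)[OF x], of u 0] by simp
  next
    case False
    then have "sec (g \<otimes> bb u \<otimes> a [^] j) x = sec g x \<otimes> a [^] e u (x + rot g)"
      using g x0_iff[OF x] by (simp add: sec_mult sec_bb)
    then show ?thesis using False syllables_mult_pow[OF NV(1)[OF x]] by simp
  qed
  moreover have "(\<Sum>x\<in>I. ?N x) = Suc n" "(\<Sum>x\<in>I. ?V x) = v + u"
    using NV(2,3) x0 by (simp_all add: sum.distrib)
  moreover have "\<exists>i::int. g \<otimes> bb u \<otimes> a [^] j = a [^] (- x) \<otimes> bb (v + u) \<otimes> a [^] i"
    if x: "x \<in> I" and N: "?N x = Suc n" for x
  proof -
    have "N x \<le> n" unfolding NV(2)[symmetric] using x by (intro member_le_sum) auto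
    then have xx: "x = x0" "N x = n" using N by (auto split: if_splits)
    then obtain i :: int where i: "g = a [^] (- x) \<otimes> bb v \<otimes> a [^] i" using NV(4)[OF x] by blast
    \<comment> \<open>All earlier syllables and the new one fall below \<open>x\<close>. Comparing
      rotations makes \<open>i\<close> a multiple of \<open>p\<close>, so the two directed
      generators become adjacent and merge.\<close>
    have "rot g = (- x + i) mod int p" by (simp add: i rot_mult mod_simps)
    then have "(x + rot g) mod int p = i mod int p" by (simp add: mod_simps)
    then have "int p dvd i" using x0_iff[OF x] xx(1) by (simp add: mod_eq_0_iff_dvd)
    then have "g = a [^] (- x) \<otimes> bb v" using i by (simp add: a_pow_dvd)
    then show ?thesis by (intro exI[of _ j]) (simp add: bb_add m_assoc)
  qed
  ultimately show ?case by (intro exI[of _ ?N] exI[of _ ?V]) blast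
qed

text \<open>Modulo \<open>p\<close> the sum is a homomorphism, since the first factor merely
  permutes the sections of the second. It kills \<open>a\<close>, whose sections are trivial, and
  \<open>bb v\<close>, by \<open>sum_e\<close>.\<close>

lemma sum_rot_sec:
  assumes "g \<in> carrier G" shows "int p dvd (\<Sum>x\<in>I. rot (sec g x))"
proof -
  define T where "T g = (\<Sum>x\<in>I. rot (sec g x))" for g
  have T: "T (g \<otimes> h) mod int p = (T g + T h) mod int p" if gh: "g \<in> carrier G" "h \<in> carrier G" for g h
  proof -
    have "T (g \<otimes> h) mod int p = (\<Sum>x\<in>I. rot (sec g x) + rot (sec h (x + rot g))) mod int p"
      using gh by (simp add: T_def sec_mult rot_mult mod_sum_eq)
    also have "(\<Sum>x\<in>I. rot (sec h (x + rot g))) = T h"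
      using sum_mod_reindex[of "int p" 1 "\<lambda>x. rot (sec h x)" "rot g"] gh p_pos
      by (simp add: T_def add.commute)
    then have "(\<Sum>x\<in>I. rot (sec g x) + rot (sec h (x + rot g))) = T g + T h"
      by (simp add: sum.distrib T_def)
    finally show ?thesis .
  qed
  have T1: "T \<one> = 0" by (simp add: T_def)
  have "{g \<in> carrier G. int p dvd T g} = carrier G"
  proof (rule subgroup_eq_carrierI)
    show "subgroup {g \<in> carrier G. int p dvd T g} G"
    proof (rule subgroupI)
      show "{g \<in> carrier G. int p dvd T g} \<noteq> {}" using T1 by (intro ex_in_conv[THEN iffD1] exI[of _ \<one>]) simp
      fix g assume g: "g \<in> {g \<in> carrier G. int p dvd T g}"
      have "(T g + T (inv g)) mod int p = 0" using T[of g "inv g"] g T1 by simp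
      then have "int p dvd T g + T (inv g)" by (simp add: mod_eq_0_iff_dvd)
      then show "inv g \<in> {g \<in> carrier G. int p dvd T g}" using g by (simp add: dvd_add_right_iff)
      fix h assume h: "h \<in> {g \<in> carrier G. int p dvd T g}"
      then show "g \<otimes> h \<in> {g \<in> carrier G. int p dvd T g}"
        using g T[of g h] by (auto simp: dvd_eq_mod_eq_0 mod_add_eq[of "T g" "int p" "T h", symmetric])
    qed auto
    show "a \<in> {g \<in> carrier G. int p dvd T g}" by (simp add: T_def)
    show "bb v \<in> {g \<in> carrier G. int p dvd T g}" for v
    proof -
      have "I = insert 0 {1..<int p}" using p_gt_1 by auto
      moreover have "\<not> int p dvd i" if "i \<in> {1..<int p}" for i using that zdvd_not_zless by auto
      ultimately have "T (bb v) = (\<Sum>i\<in>{1..<int p}. e v i mod int p)"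
        by (simp add: T_def sec_bb)
      moreover have "(\<Sum>i\<in>{1..<int p}. e v i mod int p) mod int p = 0"
        using sum_e[of v] by (simp add: mod_sum_eq mod_eq_0_iff_dvd)
      ultimately show ?thesis by (simp add: mod_eq_0_iff_dvd)
    qed
  qed
  then show ?thesis using assms unfolding T_def by blast
qed

text \<open>As \<open>p\<close> is prime, \<open>h\<close> cycles through all letters, so the
  section of its \<open>p\<close>-th power at 0 is the product of all sections of \<open>h\<close>,
  each taken once. Length and total are preserved, and the rotation vanishes by
  \<open>sum_rot_sec\<close>.\<close>

lemma syllables_sec_pow:
  assumes syl: "syllables h n v" and r: "rot h \<noteq> 0"
  shows "syllables (sec (h [^] p) 0) n v" "rot (sec (h [^] p) 0) = 0"
proof -
  have h: "h \<in> carrier G" using syl by (rule syllables_closed)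
  obtain N V where NV: "\<And>x. x \<in> I \<Longrightarrow> syllables (sec h x) (N x) (V x)"
    "(\<Sum>x\<in>I. N x) = n" "(\<Sum>x\<in>I. V x) = v"
    using syllables_sec[OF syl] by blast
  have "\<not> int p dvd rot h" using r rot_mod[OF h] by (metis dvd_imp_mod_0)
  then have cop: "coprime (rot h) (int p)"
    using prime_imp_coprime[OF prime_int_p, of "rot h"] coprime_commute by blast
  have sec_Suc: "sec (h [^] Suc k) 0 = sec (h [^] k) 0 \<otimes> sec h ((int k * rot h) mod int p)" for k
    using h by (simp add: sec_mult rot_nat_pow)
  have img: "(\<Sum>i<p. f (int i)) = (\<Sum>i\<in>I. f i)" for f :: "int \<Rightarrow> 'z::comm_monoid_add"
    using sum.reindex[of int "{..<p}" f] by (simp add: image_int_atLeastLessThan lessThan_atLeast0)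
  have reindex: "(\<Sum>i<p. f ((int i * rot h) mod int p)) = (\<Sum>i\<in>I. f i)" for f :: "int \<Rightarrow> 'z::comm_monoid_add"
  proof -
    have "(\<Sum>i<p. f ((int i * rot h) mod int p)) = (\<Sum>i\<in>I. f ((i * rot h) mod int p))" by (rule img)
    also have "\<dots> = (\<Sum>i\<in>I. f (i mod int p))"
      using sum_mod_reindex[of "int p" "rot h" "\<lambda>x. f (x mod int p)" 0] cop p_pos by simp
    finally show ?thesis by simp
  qed
  have "syllables (sec (h [^] k) 0) (\<Sum>i<k. N ((int i * rot h) mod int p)) (\<Sum>i<k. V ((int i * rot h) mod int p))" for k
  proof (induction k)
    case 0 then show ?case using syllables_pow[of 0] by simp
  next
    case (Suc k)
    then show ?case unfolding sec_Suc sum.lessThan_Suc by (intro syllables_mult NV(1) mod_in_I)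
  qed
  from this[of p] show "syllables (sec (h [^] p) 0) n v" by (simp only: reindex NV(2,3))
  have "rot (sec (h [^] k) 0) = (\<Sum>i<k. rot (sec h ((int i * rot h) mod int p))) mod int p" for k
  proof (induction k)
    case (Suc k)
    then show ?case unfolding sec_Suc sum.lessThan_Suc using h by (simp add: rot_mult mod_simps)
  qed simp
  from this[of p] show "rot (sec (h [^] p) 0) = 0"
    using sum_rot_sec[OF h] unfolding reindex[of "\<lambda>x. rot (sec h x)"] by simp
qed

subsection \<open>Descent\<close>

text \<open>Used backwards: if \<open>bb\<close> of a sum lies outside \<open>M\<close>, so does
  \<open>bb\<close> of some summand.\<close>

lemma bb_sum_in_subgroup:
  assumes "subgroup M G" "finite A" "\<And>x. x \<in> A \<Longrightarrow> bb (V x) \<in> M"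
  shows "bb (\<Sum>x\<in>A. V x) \<in> M"
  using assms(2,3)
  by (induction A) (simp_all add: bb_add subgroup.one_closed[OF assms(1)] subgroup.m_closed[OF assms(1)])

text \<open>One power of \<open>a\<close> cancels the rotation of \<open>h\<close>, and conjugation
  by another moves the letter \<open>x\<close> to 0.\<close>

lemma sec_in_sect_zero:
  assumes M: "subgroup M G" and a: "a \<in> M" and h: "h \<in> M"
  shows "sec h x \<in> sect M 0"
proof -
  interpret M: subgroup M G by fact
  define c where "c = a [^] x"
  define d where "d = a [^] (- rot h)"
  have cd: "c \<in> M" "d \<in> M" using a M by (simp_all add: c_def d_def subgroup_int_pow_closed)
  have r: "rot (h \<otimes> d) = 0" using h by (simp add: d_def rot_mult mod_simps)
  have "sec (c \<otimes> (h \<otimes> d) \<otimes> inv c) 0 = sec (h \<otimes> d) (x mod int p)"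
    using h cd r by (subst sec_conj) (simp_all add: c_def)
  also have "\<dots> = sec h x" using h cd by (simp add: sec_mult) (simp add: d_def)
  finally show ?thesis
    using sectI[of "c \<otimes> (h \<otimes> d) \<otimes> inv c" M 0] h cd r by (simp add: rot_conj)
qed

text \<open>Two nested descents to \<open>sect M 0\<close>, which contains \<open>a\<close> and
  every \<open>bb u\<close> in \<open>M\<close>. The outer one counts the directed generators
  missing from \<open>M\<close>. The inner one keeps an element of \<open>M\<close> whose total
  \<open>v\<close> has \<open>bb v\<close> missing: a section of full length would make it
  \<open>bb v\<close> up to powers of \<open>a\<close>, so all sections are shorter, and one of them
  still has a missing total.\<close>

lemma full_of_a_bb:
  assumes w: "\<not> int p dvd t" "\<not> int p dvd e w t"
    and "full_mod_derived M" "a \<in> M" "bb w \<in> M"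
  shows "M = carrier G"
  using assms(3-)
proof (induction "card (range bb - M)" arbitrary: M rule: less_induct)
  case less
  have claim: "M = carrier G"
    if "full_mod_derived M" "a \<in> M" "bb w \<in> M" "card (range bb - M) = c"
      and outer: "\<And>M. \<lbrakk>card (range bb - M) < c; full_mod_derived M; a \<in> M; bb w \<in> M\<rbrakk> \<Longrightarrow> M = carrier G"
      and "syllables g n v" "g \<in> M" "bb v \<notin> M" for M c g n v
    using that(1-4,6-)
  proof (induction n arbitrary: M g v rule: less_induct)
    case (less n)
    interpret M: subgroup M G using less.prems(1) by (rule full_mod_derived_subgroup)
    let ?M = "sect M 0"
    have sec_M: "sec h x \<in> ?M" if "h \<in> M" for h x
      using M.subgroup_axioms less.prems(2) that by (rule sec_in_sect_zero)
    have full: "full_mod_derived ?M" using less.prems(1) by (rule full_mod_derived_sect)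
    have sub: "subgroup ?M G" using full by (rule full_mod_derived_subgroup)
    have "a [^] e w t \<in> ?M" using sec_M[OF less.prems(3), of t] w(1) by (simp add: sec_bb)
    then have aM: "a \<in> ?M" using a_in_subgroup[OF sub _ w(2)] by simp
    have bbM: "bb u \<in> ?M" if "bb u \<in> M" for u using sec_M[OF that, of 0] by (simp add: sec_bb)
    have "?M = carrier G"
    proof (cases "card (range bb - ?M) < c")
      case True
      then show ?thesis using outer full aM bbM[OF less.prems(3)] by blast
    next
      case False
      \<comment> \<open>Nothing was gained in the section, so the same directed generators are
        missing from \<open>?M\<close> and from \<open>M\<close>, and the inner induction continues
        with \<open>?M\<close>.\<close>
      have "range bb - ?M \<subseteq> range bb - M" using bbM by auto
      then have eq: "range bb - ?M = range bb - M"
        using False less.prems(4) finite_range_bb by (intro card_seteq) auto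
      obtain N V where NV: "\<And>x. x \<in> I \<Longrightarrow> syllables (sec g x) (N x) (V x)"
        "(\<Sum>x\<in>I. N x) = n" "(\<Sum>x\<in>I. V x) = v"
        "\<And>x. x \<in> I \<Longrightarrow> N x = n \<Longrightarrow> \<exists>j::int. g = a [^] (- x) \<otimes> bb v \<otimes> a [^] j"
        using syllables_sec[OF less.prems(5)] by blast
      have apow: "a [^] i \<in> M" for i :: int
        using M.subgroup_axioms less.prems(2) by (rule subgroup_int_pow_closed)
      have lt: "N x < n" if x: "x \<in> I" for x
      proof (rule ccontr)
        assume "\<not> N x < n"
        moreover have "N x \<le> n" unfolding NV(2)[symmetric] using x by (intro member_le_sum) auto
        ultimately obtain j :: int where j: "g = a [^] (- x) \<otimes> bb v \<otimes> a [^] j" using NV(4)[OF x] by auto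
        have "bb v = inv (a [^] (- x)) \<otimes> g \<otimes> inv (a [^] j)" by (simp add: j m_assoc)
        also have "\<dots> \<in> M" using less.prems(6) apow by simp
        finally show False using less.prems(7) by simp
      qed
      obtain x where x: "x \<in> I" "bb (V x) \<notin> M"
        using bb_sum_in_subgroup[OF M.subgroup_axioms, of I V] less.prems(7) NV(3) by auto
      have "bb (V x) \<in> range bb - ?M" using x(2) eq by blast
      then have "bb (V x) \<notin> ?M" by blast
      moreover have "card (range bb - ?M) = c" using eq less.prems(4) by simp
      ultimately show ?thesis
        using less.IH[OF lt[OF x(1)] full aM bbM[OF less.prems(3)] _ NV(1)[OF x(1)] sec_M[OF less.prems(6)]]
        by blast
    qed
    then show ?case using less.prems(1) full_if_sect_full by blast
  qed
  show ?case
  proof (cases "range bb \<subseteq> M")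
    case True
    show ?thesis
      using full_mod_derived_subgroup[OF less.prems(1)] less.prems(2) True
      by (intro subgroup_eq_carrierI) auto
  next
    case False
    then obtain v where v: "bb v \<notin> M" by blast
    obtain g n where "g \<in> M" "syllables g n v" using full_mod_derived_ex_syllables[OF less.prems(1)] by blast
    then show ?thesis using claim[OF less.prems refl less.hyps _ _ v] by blast
  qed
qed

text \<open>In a section, conjugated so that it contains \<open>a\<close> again, the conjugator
  becomes a quotient of two sections of \<open>g\<close>, taken at the letters carried to 0 and to a
  nonzero entry of \<open>w\<close>. Two such entries give a choice; if neither shortens the
  conjugator, then \<open>g\<close> is a power of \<open>a\<close> times \<open>bb v\<close>, and
  \<open>bb v\<close> commutes with \<open>bb w\<close>.\<close>

lemma full_of_a_conj_bb:
  assumes w: "\<not> int p dvd t" "\<not> int p dvd e w t"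
    and "full_mod_derived M" "a \<in> M" "syllables g n v" "g \<otimes> bb w \<otimes> inv g \<in> M"
  shows "M = carrier G"
  using assms(3-)
proof (induction n arbitrary: M g v rule: less_induct)
  case (less n)
  interpret M: subgroup M G using less.prems(1) by (rule full_mod_derived_subgroup)
  have g: "g \<in> carrier G" using less.prems(3) by (rule syllables_closed)
  obtain t' where t': "\<not> int p dvd t'" "\<not> int p dvd e w t'" "t' mod int p \<noteq> t mod int p"
    using ex_other_entry[OF w] by blast
  obtain N V where NV: "\<And>x. x \<in> I \<Longrightarrow> syllables (sec g x) (N x) (V x)" "(\<Sum>x\<in>I. N x) = n"
    "\<And>x. x \<in> I \<Longrightarrow> N x = n \<Longrightarrow> \<exists>j::int. g = a [^] (- x) \<otimes> bb v \<otimes> a [^] j"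
    using syllables_sec[OF less.prems(3)] by blast
  \<comment> \<open>The letter that \<open>g\<close> carries to \<open>s\<close>: there the
    conjugate of \<open>bb w\<close> shows a conjugate of its section at \<open>s\<close>.\<close>
  define z where "z s = (s - rot g) mod int p" for s
  have z: "z s \<in> I" for s unfolding z_def by (rule mod_in_I)
  have z_eq: "z s = z s' \<longleftrightarrow> s mod int p = s' mod int p" for s s'
    by (simp add: z_def mod_eq_dvd_iff)
  have sec_h: "sec g (z s) \<otimes> sec (bb w) s \<otimes> inv (sec g (z s)) \<in> sect M 0" for s
  proof -
    have "sec (bb w) (z s + rot g) = sec (bb w) s" by (rule sec_cong) (simp_all add: z_def mod_simps)
    then have "sec (g \<otimes> bb w \<otimes> inv g) (z s) = sec g (z s) \<otimes> sec (bb w) s \<otimes> inv (sec g (z s))"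
      using g by (simp add: sec_conj)
    then show ?thesis using sec_in_sect_zero[OF M.subgroup_axioms less.prems(2,4), of "z s"] by simp
  qed
  have descend: "M = carrier G" if s: "\<not> int p dvd s" "\<not> int p dvd e w s" and lt: "N (z s) + N (z 0) < n" for s
  proof -
    let ?q = "sec g (z s)" and ?r = "sec g (z 0)"
    let ?M = "conj_set ?q (sect M 0)"
    have q: "?q \<in> carrier G" "?r \<in> carrier G" using g by simp_all
    have full0: "full_mod_derived (sect M 0)" using less.prems(1) by (rule full_mod_derived_sect)
    have full: "full_mod_derived ?M" using full0 q(1) by (rule full_mod_derived_conj_set)
    have "inv ?q \<otimes> (?q \<otimes> a [^] e w s \<otimes> inv ?q) \<otimes> ?q \<in> ?M"
      using conj_setI[OF sec_h[of s], of ?q] s(1) by (simp add: sec_bb)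
    then have "a [^] e w s \<in> ?M" using q by (simp add: m_assoc)
    then have aM: "a \<in> ?M" using a_in_subgroup[OF full_mod_derived_subgroup[OF full] _ s(2)] by simp
    have "inv ?q \<otimes> (?r \<otimes> bb w \<otimes> inv ?r) \<otimes> ?q \<in> ?M"
      using conj_setI[OF sec_h[of 0], of ?q] by (simp add: sec_bb)
    also have "inv ?q \<otimes> (?r \<otimes> bb w \<otimes> inv ?r) \<otimes> ?q = (inv ?q \<otimes> ?r) \<otimes> bb w \<otimes> inv (inv ?q \<otimes> ?r)"
      using q by (simp add: m_assoc inv_mult_group)
    finally have bM: "(inv ?q \<otimes> ?r) \<otimes> bb w \<otimes> inv (inv ?q \<otimes> ?r) \<in> ?M" .
    have "syllables (inv ?q \<otimes> ?r) (N (z s) + N (z 0)) (- V (z s) + V (z 0))"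
      by (intro syllables_mult syllables_inv NV(1) z)
    from less.IH[OF lt full aM this bM] have "sect M 0 = carrier G"
      by (rule conj_set_eq_carrier[OF full_mod_derived_subgroup[OF full0] q(1)])
    then show ?thesis by (rule full_if_sect_full[OF less.prems(1)])
  qed
  show ?case
  proof (cases "N (z t) + N (z 0) < n \<or> N (z t') + N (z 0) < n")
    case True then show ?thesis using descend w t' by blast
  next
    case False
    have "z t \<noteq> z 0" "z t' \<noteq> z 0" "z t' \<noteq> z t"
      \<comment> \<open>Three distinct letters share at most \<open>n\<close> syllables. As neither
        choice descends, \<open>z t\<close> and \<open>z t'\<close> carry none and
        \<open>z 0\<close> carries all.\<close>
      using w(1) t'(1,3) by (simp_all add: z_eq dvd_eq_mod_eq_0)
    then have "N (z t) + N (z t') + N (z 0) = (\<Sum>x\<in>{z t, z t', z 0}. N x)" by simp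
    also have "\<dots> \<le> (\<Sum>x\<in>I. N x)" by (rule sum_mono2) (use z in auto)
    finally have le: "N (z t) + N (z t') + N (z 0) \<le> n" by (simp only: NV(2))
    then have "N (z 0) = n" using False by linarith
    then obtain j :: int where j: "g = a [^] (- z 0) \<otimes> bb v \<otimes> a [^] j" using NV(3)[OF z] by blast
    have "rot g = (- z 0 + j) mod int p" by (simp add: j rot_mult mod_simps)
    also have "\<dots> = (rot g + j) mod int p" by (simp add: z_def mod_simps add.commute)
    finally have "rot g mod int p = (rot g + j) mod int p" using g by simp
    then have "int p dvd j" by (simp add: mod_eq_dvd_iff)
    then have "g = a [^] (- z 0) \<otimes> bb v" using j by (simp add: a_pow_dvd)
    moreover have "bb v \<otimes> bb w \<otimes> inv (bb v) = bb w" by (simp add: bb_comm[of v w] m_assoc)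
    ultimately have "g \<otimes> bb w \<otimes> inv g = a [^] (- z 0) \<otimes> bb w \<otimes> inv (a [^] (- z 0))"
      by (simp add: inv_mult_group m_assoc) (simp flip: m_assoc)
    then have "bb w = inv (a [^] (- z 0)) \<otimes> (g \<otimes> bb w \<otimes> inv g) \<otimes> a [^] (- z 0)"
      by (simp add: m_assoc)
    also have "\<dots> \<in> M"
    proof -
      have ap: "a [^] (- z 0) \<in> M" using M.subgroup_axioms less.prems(2) by (rule subgroup_int_pow_closed)
      show ?thesis by (rule M.m_closed[OF M.m_closed[OF M.m_inv_closed[OF ap] less.prems(4)] ap])
    qed
    finally show ?thesis using full_of_a_bb[OF w less.prems(1,2)] by blast
  qed
qed

text \<open>Conjugating \<open>bb w\<close> by an element of \<open>M\<close> of rotation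
  \<open>t\<close> makes a nontrivial power of \<open>a\<close> appear at the letter 0, up to
  conjugation by \<open>?q\<close>. Undoing that conjugation puts \<open>a\<close> into
  \<open>?M\<close>, at the price that \<open>bb w\<close> is there only up to conjugation.\<close>

lemma full_of_bb:
  assumes w: "\<not> int p dvd t" "\<not> int p dvd e w t"
    and M: "full_mod_derived M" and b: "bb w \<in> M"
  shows "M = carrier G"
proof -
  interpret M: subgroup M G using M by (rule full_mod_derived_subgroup)
  obtain m where m: "m \<in> M" "rot m = 1" using full_mod_derived_ex_rot[OF M] by blast
  define h where "h = m [^] t"
  have h: "h \<in> M" "rot h = t mod int p"
    using m by (simp_all add: h_def subgroup_int_pow_closed[OF M.subgroup_axioms] rot_int_pow)
  let ?q = "sec h 0"
  let ?M = "conj_set ?q (sect M 0)"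
  have q: "?q \<in> carrier G" using h by simp
  have full0: "full_mod_derived (sect M 0)" using M by (rule full_mod_derived_sect)
  have full: "full_mod_derived ?M" using full0 q by (rule full_mod_derived_conj_set)
  have "sec (h \<otimes> bb w \<otimes> inv h) 0 = ?q \<otimes> a [^] e w t \<otimes> inv ?q"
    using h w(1) by (simp add: sec_conj) (simp add: sec_bb)
  then have "?q \<otimes> a [^] e w t \<otimes> inv ?q \<in> sect M 0"
    using sectI[of "h \<otimes> bb w \<otimes> inv h" M 0] h b by (simp add: rot_conj)
  then have "inv ?q \<otimes> (?q \<otimes> a [^] e w t \<otimes> inv ?q) \<otimes> ?q \<in> ?M" by (rule conj_setI)
  then have "a [^] e w t \<in> ?M" using q by (simp add: m_assoc)
  then have aM: "a \<in> ?M" using a_in_subgroup[OF full_mod_derived_subgroup[OF full] _ w(2)] by simp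
  have "bb w \<in> sect M 0" using sectI[OF b, of 0] by (simp add: sec_bb)
  then have bM: "inv ?q \<otimes> bb w \<otimes> inv (inv ?q) \<in> ?M" using conj_setI[of "bb w" "sect M 0" ?q] q by simp
  obtain n v where "syllables (inv ?q) n v" using ex_syllables[of "inv ?q"] q by blast
  from full_of_a_conj_bb[OF w full aM this bM] have "sect M 0 = carrier G"
    by (rule conj_set_eq_carrier[OF full_mod_derived_subgroup[OF full0] q])
  then show ?thesis by (rule full_if_sect_full[OF M])
qed

lemma a_pow_eq_one_iff: "a [^] (j::int) = \<one> \<longleftrightarrow> int p dvd j"
  using a_pow_eq_iff[of j 0] by (simp add: dvd_eq_mod_eq_0)

lemma ex_entry:
  assumes "bb v \<noteq> \<one>" shows "\<exists>t. \<not> int p dvd t \<and> \<not> int p dvd e v t"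
proof (rule ccontr)
  assume neg: "\<not> ?thesis"
  have "bb v = bb 0"
  proof (rule bb_eqI)
    fix t assume t: "\<not> int p dvd t"
    have "a [^] e 0 t = \<one>" using sec_bb[of 0 t] t by simp
    then have "int p dvd e 0 t" by (simp only: a_pow_eq_one_iff)
    moreover have "int p dvd e v t" using neg t by blast
    ultimately show "e v t mod int p = e 0 t mod int p" by (simp only: dvd_eq_mod_eq_0)
  qed
  then show False using assms by simp
qed

text \<open>If one section carries all syllables, \<open>g\<close> is conjugate to
  \<open>bb v\<close> by a power of \<open>a\<close>. Otherwise the totals of the sections add up to
  \<open>v\<close>, so a shorter one has a nontrivial directed generator as total; if it moves the
  letters, its \<open>p\<close>-th power supplies, one level further down, an element of the same
  length and total that fixes them.\<close>

lemma full_of_syllables: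
  assumes "full_mod_derived M" "syllables g n v" "g \<in> M" "rot g = 0" "bb v \<noteq> \<one>"
  shows "M = carrier G"
  using assms
proof (induction n arbitrary: M g v rule: less_induct)
  case (less n)
  note M = less.prems(1)
  interpret M: subgroup M G using M by (rule full_mod_derived_subgroup)
  obtain N V where NV: "\<And>x. x \<in> I \<Longrightarrow> syllables (sec g x) (N x) (V x)"
    "(\<Sum>x\<in>I. N x) = n" "(\<Sum>x\<in>I. V x) = v"
    "\<And>x. x \<in> I \<Longrightarrow> N x = n \<Longrightarrow> \<exists>j::int. g = a [^] (- x) \<otimes> bb v \<otimes> a [^] j"
    using syllables_sec[OF less.prems(2)] by blast
  show ?case
  proof (cases "\<exists>x\<in>I. N x = n")
    case True
    then obtain x where x: "x \<in> I" "N x = n" by blast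
    obtain j :: int where j: "g = a [^] (- x) \<otimes> bb v \<otimes> a [^] j" using NV(4)[OF x] by blast
    have "(- x + j) mod int p = 0" using less.prems(4) by (simp add: j rot_mult mod_simps)
    then have "int p dvd j - x" by (simp add: mod_eq_0_iff_dvd)
    then have "a [^] j = a [^] x" by (simp add: a_pow_eq_iff mod_eq_dvd_iff)
    then have "inv (a [^] (- x)) \<otimes> g \<otimes> a [^] (- x) = bb v" by (simp add: j m_assoc int_pow_neg)
    then have b: "bb v \<in> conj_set (a [^] (- x)) M" using conj_setI[OF less.prems(3), of "a [^] (- x)"] by simp
    obtain t where t: "\<not> int p dvd t" "\<not> int p dvd e v t" using ex_entry[OF less.prems(5)] by blast
    have ac: "a [^] (- x) \<in> carrier G" by simp
    show ?thesis
      using full_of_bb[OF t full_mod_derived_conj_set[OF M ac] b]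
      by (rule conj_set_eq_carrier[OF M.subgroup_axioms ac])
  next
    case False
    obtain x where x: "x \<in> I" "bb (V x) \<noteq> \<one>"
      using bb_sum_in_subgroup[OF triv_subgroup, of I V] NV(3) less.prems(5) by auto
    have "N x \<le> n" unfolding NV(2)[symmetric] using x(1) by (intro member_le_sum) auto
    then have lt: "N x < n" using False x(1) by (simp add: order_less_le)
    define h where "h = sec g x"
    have hM: "h \<in> sect M x" unfolding h_def using less.prems(3,4) by (rule sectI)
    have full: "full_mod_derived (sect M x)" using M by (rule full_mod_derived_sect)
    have syl: "syllables h (N x) (V x)" unfolding h_def by (rule NV(1)[OF x(1)])
    have "sect M x = carrier G"
    proof (cases "rot h = 0")
      case True
      then show ?thesis using less.IH[OF lt full syl hM _ x(2)] by simp
    next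
      case False
      interpret S: subgroup "sect M x" G using full by (rule full_mod_derived_subgroup)
      have hp: "h [^] p \<in> sect M x" using subgroup_int_pow_closed[OF S.subgroup_axioms hM, of "int p"]
        by (simp add: int_pow_int)
      have "rot (h [^] p) = 0" using hM by (simp add: rot_nat_pow)
      then have "sec (h [^] p) 0 \<in> sect (sect M x) 0" using hp by (intro sectI)
      with less.IH[OF lt full_mod_derived_sect[OF full] syllables_sec_pow(1)[OF syl False] _
          syllables_sec_pow(2)[OF syl False] x(2)]
      have "sect (sect M x) 0 = carrier G" by blast
      then show ?thesis by (rule full_if_sect_full[OF full])
    qed
    then show ?thesis by (rule full_if_sect_full[OF M])
  qed
qed

theorem full_mod_derived_eq_carrier:
  assumes M: "full_mod_derived M" shows "M = carrier G"
proof -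
  obtain v t where t: "\<not> int p dvd t" "\<not> int p dvd e v t" using nontrivial by blast
  have "bb v \<noteq> \<one>"
  proof
    assume "bb v = \<one>"
    then have "a [^] e v t = \<one>" using sec_bb[of v t] t(1) by simp
    then show False using t(2) by (simp only: a_pow_eq_one_iff)
  qed
  moreover obtain g n where "g \<in> M" "syllables g n v" "rot g = 0"
    using full_mod_derived_ex_syllables[OF M] by blast
  ultimately show ?thesis using full_of_syllables[OF M] by blast
qed

subsection \<open>Maximal subgroups\<close>

lemma bb_pow_p: "bb v [^] p = \<one>"
proof -
  have r: "rot (bb v [^] p) = 0" by (simp add: rot_nat_pow)
  have "bb v [^] p \<in> level_stab n" for n
  proof (induction n)
    case (Suc n)
    have one: "\<one> \<in> level_stab n" using normal_level_stab[THEN normal_imp_subgroup] by (rule subgroup.one_closed)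
    have "(a [^] e v x) [^] p = \<one>" for x
    proof -
      have "(a [^] e v x) [^] int p = a [^] (e v x * int p)" by (simp add: int_pow_pow)
      also have "\<dots> = \<one>" by (rule a_pow_dvd) simp
      finally show ?thesis by (simp add: int_pow_int)
    qed
    then have "sec (bb v [^] p) x \<in> level_stab n" for x
      using Suc one by (simp add: sec_nat_pow sec_bb)
    then show ?case using r by (simp add: lift_sub_def)
  qed simp
  then show ?thesis by (intro separated) auto
qed

lemma maximal_subgroup_normal_index:
  assumes max: "maximal_subgroup M G"
  shows "M \<lhd> G \<and> card (rcosets M) = p"
proof -
  have M: "subgroup M G" and ne: "M \<noteq> carrier G"
    and maxK: "\<And>K. \<lbrakk>subgroup K G; M \<subseteq> K\<rbrakk> \<Longrightarrow> K = M \<or> K = carrier G"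
    using max by (auto simp: maximal_subgroup_def)
  interpret M: subgroup M G by fact
  have "\<not> full_mod_derived M" using ne full_mod_derived_eq_carrier by blast
  then obtain N where N: "subgroup N G" "M \<subseteq> N" "G' \<subseteq> N" "N \<noteq> carrier G"
    using M by (auto simp: full_mod_derived_def)
  then have G'M: "G' \<subseteq> M" using maxK[OF N(1,2)] by simp
  have nM: "M \<lhd> G" using M G'M by (rule normal_if_derived_le)
  interpret nM: normal M G by fact
  \<comment> \<open>Some generator lies outside \<open>M\<close>. Its \<open>p\<close>-th power is
    trivial, and by maximality its powers represent all cosets of \<open>M\<close>.\<close>
  obtain c where c: "c \<in> carrier G" "c [^] p = \<one>" "c \<notin> M"
  proof (cases "a \<in> M")
    case False show ?thesis by (rule that[OF a_closed a_pow_p False])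
  next
    case True
    then obtain v where "bb v \<notin> M" using subgroup_eq_carrierI[OF M] ne by blast
    then show ?thesis by (rule that[OF bb_closed bb_pow_p])
  qed
  have c_pow: "\<not> (c [^] k \<in> M)" if k: "\<not> int p dvd k" for k :: int
  proof
    assume ck: "c [^] k \<in> M"
    have "coprime k (int p)" using prime_imp_coprime[OF prime_int_p k] by (simp add: coprime_commute)
    then obtain j where "[k * j = 1] (mod int p)" using cong_solve_coprime_int by blast
    then have "int p dvd k * j - 1" by (simp add: cong_iff_dvd_diff)
    then obtain q where "k * j - 1 = int p * q" by (rule dvdE)
    then have kj: "k * j = int p * q + 1" by simp
    have "(c [^] k) [^] j = c [^] (int p * q) \<otimes> c"
      unfolding int_pow_pow[OF c(1)] kj using c(1) by (simp add: int_pow_mult)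
    also have "c [^] (int p * q) = (c [^] int p) [^] q" using c(1) by (simp add: int_pow_pow)
    also have "c [^] int p = \<one>" using c(2) by (simp add: int_pow_int)
    finally have "(c [^] k) [^] j = c" using c(1) by simp
    then show False using subgroup_int_pow_closed[OF M ck, of j] c(3) by simp
  qed
  let ?C = "generate G {c}"
  have C: "subgroup ?C G" using c(1) by (intro generate_is_subgroup) simp
  let ?K = "{u \<otimes> m | u m. u \<in> ?C \<and> m \<in> M}"
  have KI: "u \<otimes> m \<in> ?K" if "u \<in> ?C" "m \<in> M" for u m using that by blast
  have K: "subgroup ?K G" using C nM by (rule subgroup_mult_normal)
  have MK: "M \<subseteq> ?K"
  proof
    fix m assume "m \<in> M"
    then show "m \<in> ?K" using KI[OF subgroup.one_closed[OF C], of m] by simp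
  qed
  have "c \<in> ?K" using KI[OF generate.incl[of c "{c}" G] M.one_closed] c(1) by simp
  then have Kc: "?K = carrier G" using maxK[OF K MK] c(3) by blast
  define f where "f i = M #> c [^] i" for i :: int
  have "rcosets M = f ` {0..<int p}"
  proof
    show "f ` {0..<int p} \<subseteq> rcosets M" using c(1) by (auto simp: f_def intro!: rcosetsI M.subset)
    show "rcosets M \<subseteq> f ` {0..<int p}"
    proof
      fix D assume "D \<in> rcosets M"
      then obtain x where x: "x \<in> carrier G" "D = M #> x" by (auto simp: RCOSETS_def)
      then have "x \<in> ?K" using Kc by simp
      then obtain u m where um: "x = u \<otimes> m" "u \<in> ?C" "m \<in> M" by blast
      obtain i :: int where i: "u = c [^] i" using um(2) by (auto simp: generate_pow[OF c(1)])
      have uc: "u \<in> carrier G" using i c(1) by simp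
      have ci: "c [^] i = c [^] (i mod int p)"
      proof -
        have "c [^] i = c [^] (int p * (i div int p) + i mod int p)" by simp
        also have "\<dots> = (c [^] int p) [^] (i div int p) \<otimes> c [^] (i mod int p)"
          using c(1) by (simp only: int_pow_mult int_pow_pow)
        also have "c [^] int p = \<one>" using c(2) by (simp add: int_pow_int)
        finally show ?thesis using c(1) by simp
      qed
      have "x \<otimes> inv (c [^] (i mod int p)) = u \<otimes> m \<otimes> inv u" using um(1) i ci by simp
      then have "x \<otimes> inv (c [^] (i mod int p)) \<in> M" using nM.inv_op_closed2[OF uc um(3)] by simp
      then have "D = f (i mod int p)" using x c(1) by (simp add: f_def rcos_eq_iff[OF M])
      then show "D \<in> f ` {0..<int p}" using mod_in_I by blast
    qed
  qed
  moreover have "inj_on f {0..<int p}"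
  proof (rule inj_onI)
    fix i j assume ij: "i \<in> {0..<int p}" "j \<in> {0..<int p}" "f i = f j"
    then have "c [^] i \<otimes> inv (c [^] j) \<in> M" using c(1) by (simp add: f_def rcos_eq_iff[OF M])
    then have "c [^] (i - j) \<in> M" using c(1) by (simp add: int_pow_diff)
    then have "int p dvd i - j" using c_pow by blast
    then have "i mod int p = j mod int p" by (simp only: mod_eq_dvd_iff)
    then show "i = j" using ij by simp
  qed
  ultimately have "card (rcosets M) = p" by (simp add: card_image)
  then show ?thesis using nM by simp
qed

end

section \<open>Multi-edge spinal groups as self-similar groups\<close>

text \<open>The letter congruent to \<open>x\<close>; the letter \<open>p\<close> represents the class of \<open>0\<close>.\<close>

definition letter :: "nat \<Rightarrow> int \<Rightarrow> nat" where
  "letter p x = nat ((x - 1) mod int p) + 1"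

context
  fixes p :: nat
  assumes p_pos: "p > 0"
begin

lemma letter_in_letters [simp]: "letter p x \<in> letters p"
  using p_pos pos_mod_bound[of "int p" "x - 1"] by (auto simp: letter_def letters_def nat_less_iff Suc_le_eq)

lemma letter_words [simp]: "[letter p x] \<in> words p"
  by simp

lemma int_letter: "int (letter p x) = (x - 1) mod int p + 1"
  using p_pos by (simp add: letter_def)

lemma int_letter_mod: "int (letter p x) mod int p = x mod int p"
  by (simp add: int_letter mod_simps)

lemma letter_cong: "x mod int p = y mod int p \<Longrightarrow> letter p x = letter p y"
  unfolding letter_def by (metis mod_diff_left_eq)

lemma letter_of_letter: "c \<in> letters p \<Longrightarrow> letter p (int c) = c"
  by (auto simp: letter_def letters_def nat_diff_distrib)

lemma letter_less_iff: "letter p x < p \<longleftrightarrow> \<not> int p dvd x"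
proof -
  have l: "1 \<le> letter p x" "letter p x \<le> p" using letter_in_letters[of x] by (simp_all add: letters_def)
  then have "p dvd letter p x \<longleftrightarrow> letter p x = p" by (auto dest: dvd_imp_le)
  then have "letter p x < p \<longleftrightarrow> \<not> p dvd letter p x" using l(2) by (simp add: order_less_le)
  also have "p dvd letter p x \<longleftrightarrow> int p dvd int (letter p x)" by simp
  also have "\<dots> \<longleftrightarrow> int p dvd x" using int_letter_mod[of x] by (simp only: dvd_eq_mod_eq_0)
  finally show ?thesis .
qed

lemma letter_add_one: "letter p (x + 1) = (if letter p x = p then 1 else letter p x + 1)"
proof (cases "int p dvd x")
  case True
  then have "letter p x = p"
    using letter_less_iff[of x] letter_in_letters[of x] by (auto simp: letters_def)
  then show ?thesis using True by (simp add: letter_def mod_eq_0_iff_dvd)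
next
  case False
  then have "letter p x < p" by (simp add: letter_less_iff)
  moreover have "letter p (x + 1) = letter p (int (letter p x + 1))"
    using mod_add_cong[OF int_letter_mod[of x] refl, of 1] by (intro letter_cong) (simp add: add.commute)
  ultimately show ?thesis
    using letter_of_letter[of "letter p x + 1"] letter_in_letters[of x] by (simp add: letters_def)
qed

end

section \<open>Sections of products and sums of directed generators\<close>

lemma mult_Aut_tree: "f \<otimes>\<^bsub>Aut_tree p\<^esub> g = compose (words p) g f"
  by (simp add: Aut_tree_def)

lemma carrier_Aut_tree: "carrier (Aut_tree p) = tree_auts p"
  by (simp add: Aut_tree_def)

lemma one_Aut_tree: "\<one>\<^bsub>Aut_tree p\<^esub> = (\<lambda>u\<in>words p. u)"
  by (simp add: Aut_tree_def)

lemma section_at_mult: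
  assumes f: "f \<in> tree_auts p" and g: "g \<in> tree_auts p" and u: "u \<in> words p"
  shows "section_at p (f \<otimes>\<^bsub>Aut_tree p\<^esub> g) u =
    section_at p f u \<otimes>\<^bsub>Aut_tree p\<^esub> section_at p g (f u)"
proof (rule ext)
  fix v
  show "section_at p (f \<otimes>\<^bsub>Aut_tree p\<^esub> g) u v =
    (section_at p f u \<otimes>\<^bsub>Aut_tree p\<^esub> section_at p g (f u)) v"
  proof (cases "v \<in> words p")
    case True
    have fuv: "f (u @ v) = f u @ section_at p f u v" using f u True by (rule section_eq)
    have fu: "f u \<in> words p" using f u by (rule tree_auts_mem)
    have "f (u @ v) \<in> words p" using f u True by (simp add: tree_auts_mem)
    then have s: "section_at p f u v \<in> words p" using fuv by simp
    have "g (f u @ section_at p f u v) = g (f u) @ section_at p g (f u) (section_at p f u v)"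
      using g fu s by (rule section_eq)
    moreover have "length (g (f u)) = length u"
      using tree_auts_length[OF g fu] tree_auts_length[OF f u] by simp
    ultimately have "drop (length u) (g (f (u @ v))) = section_at p g (f u) (section_at p f u v)"
      using fuv by simp
    moreover have "section_at p h u v = drop (length u) (h (u @ v))" for h
      using True by (simp add: section_at_def)
    ultimately show ?thesis using True u by (simp add: mult_Aut_tree compose_def)
  next
    case False
    then show ?thesis by (simp add: mult_Aut_tree compose_def section_at_def)
  qed
qed

lemma directed_gen_eqI:
  assumes "b \<in> level_one_stab p"
    and "psi1 p b = (\<lambda>x\<in>letters p. if x < p then rooted_gen p [^]\<^bsub>Aut_tree p\<^esub> e x else b)"
  shows "directed_gen p e = b"
  using ex1_directed_gen[of p e] directed_gen[of p e] assms by blast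

text \<open>The product satisfies the recursive description of the directed generator for the sum,
  and that description has only one solution.\<close>

lemma directed_gen_add:
  fixes e e' :: "nat \<Rightarrow> int"
  shows "directed_gen p (\<lambda>x. e x + e' x) = directed_gen p e \<otimes>\<^bsub>Aut_tree p\<^esub> directed_gen p e'"
proof (rule directed_gen_eqI)
  interpret A: group "Aut_tree p" by (rule group_Aut_tree)
  have a: "rooted_gen p \<in> carrier (Aut_tree p)" by (simp add: carrier_Aut_tree rooted_gen_tree_auts)
  have d: "directed_gen p e \<in> tree_auts p" "directed_gen p e' \<in> tree_auts p"
    using directed_gen(1)[of p e] directed_gen(1)[of p e'] by (simp_all add: level_one_stab_def)
  have fix1: "directed_gen p e u = u" "directed_gen p e' u = u" if "u \<in> words p" "length u = 1" for u
    using directed_gen(1)[of p e] directed_gen(1)[of p e'] that by (simp_all add: level_one_stab_def)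
  have mem: "directed_gen p e \<otimes>\<^bsub>Aut_tree p\<^esub> directed_gen p e' \<in> tree_auts p"
    using A.m_closed d by (simp add: carrier_Aut_tree)
  then show "directed_gen p e \<otimes>\<^bsub>Aut_tree p\<^esub> directed_gen p e' \<in> level_one_stab p"
    using fix1 by (simp add: level_one_stab_def mult_Aut_tree compose_def)
  show "psi1 p (directed_gen p e \<otimes>\<^bsub>Aut_tree p\<^esub> directed_gen p e') =
    (\<lambda>x\<in>letters p. if x < p then rooted_gen p [^]\<^bsub>Aut_tree p\<^esub> (e x + e' x)
      else directed_gen p e \<otimes>\<^bsub>Aut_tree p\<^esub> directed_gen p e')"
  proof (rule ext)
    fix x
    show "psi1 p (directed_gen p e \<otimes>\<^bsub>Aut_tree p\<^esub> directed_gen p e') x =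
      (\<lambda>x\<in>letters p. if x < p then rooted_gen p [^]\<^bsub>Aut_tree p\<^esub> (e x + e' x)
        else directed_gen p e \<otimes>\<^bsub>Aut_tree p\<^esub> directed_gen p e') x"
    proof (cases "x \<in> letters p")
      case True
      then have sec: "section_at p (directed_gen p e) [x]
          = (if x < p then rooted_gen p [^]\<^bsub>Aut_tree p\<^esub> e x else directed_gen p e)"
        "section_at p (directed_gen p e') [x]
          = (if x < p then rooted_gen p [^]\<^bsub>Aut_tree p\<^esub> e' x else directed_gen p e')"
        using fun_cong[OF directed_gen(2)[of p e], of x] fun_cong[OF directed_gen(2)[of p e'], of x]
        by (simp_all add: psi1_def)
      have "psi1 p (directed_gen p e \<otimes>\<^bsub>Aut_tree p\<^esub> directed_gen p e') x =
          section_at p (directed_gen p e) [x] \<otimes>\<^bsub>Aut_tree p\<^esub> section_at p (directed_gen p e') [x]"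
        using section_at_mult[OF d, of "[x]"] fix1(1)[of "[x]"] True by (simp add: psi1_def)
      also have "\<dots> = (if x < p then rooted_gen p [^]\<^bsub>Aut_tree p\<^esub> (e x + e' x)
          else directed_gen p e \<otimes>\<^bsub>Aut_tree p\<^esub> directed_gen p e')"
        unfolding sec using A.int_pow_mult[OF a] by simp
      finally show ?thesis using True by simp
    qed (simp add: psi1_def)
  qed
qed

text \<open>Group elements turn out to translate the letters, so the image of the letter 1
  determines the translation; subtracting 1 removes the starting point.\<close>

definition first_rot :: "nat \<Rightarrow> (nat list \<Rightarrow> nat list) \<Rightarrow> int" where
  "first_rot p g = (int (hd (g [1])) - 1) mod int p"

definition letter_section :: "nat \<Rightarrow> (nat list \<Rightarrow> nat list) \<Rightarrow> int \<Rightarrow> nat list \<Rightarrow> nat list" where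
  "letter_section p g x = section_at p g [letter p x]"

section \<open>The self-similar structure of a multi-edge spinal group\<close>

context
  fixes p r :: nat and E :: "nat \<Rightarrow> nat \<Rightarrow> int"
  assumes prime: "Factorial_Ring.prime p" and r: "r \<ge> 1" and indep: "lin_indep_mod p r E"
    and tor: "torsion_group (multi_edge_spinal_group p r E)"
begin

abbreviation (input) "\<G> \<equiv> multi_edge_spinal_group p r E"
abbreviation (input) "lt \<equiv> letter p"
abbreviation (input) "comb c \<equiv> \<lambda>j. \<Sum>i\<in>{1..r}. (c :: nat \<Rightarrow> int) i * E i j"
abbreviation (input) "rotation \<equiv> first_rot p"
abbreviation (input) "sect_at \<equiv> letter_section p"

lemma prime_pos: "p > 0"
  using prime by (simp add: prime_gt_0_nat)

lemmas letter_facts [simp] = letter_in_letters[OF prime_pos] letter_words[OF prime_pos]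

lemma generators_subset: "insert (rooted_gen p) ((\<lambda>i. directed_gen p (E i)) ` {1..r}) \<subseteq> carrier (Aut_tree p)"
  using directed_gen(1) rooted_gen_tree_auts by (auto simp: carrier_Aut_tree level_one_stab_def)

lemma group_spinal: "group \<G>"
  unfolding multi_edge_spinal_group_def by (rule group.group_subgroup_generated[OF group_Aut_tree])

lemma carrier_spinal:
  "carrier \<G> = generate (Aut_tree p) (insert (rooted_gen p) ((\<lambda>i. directed_gen p (E i)) ` {1..r}))"
  unfolding multi_edge_spinal_group_def carrier_subgroup_generated
  using generators_subset by (simp add: Int_absorb1)

lemma mult_spinal: "f \<otimes>\<^bsub>\<G>\<^esub> g = f \<otimes>\<^bsub>Aut_tree p\<^esub> g"
  by (simp add: multi_edge_spinal_group_def)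

lemma one_spinal: "\<one>\<^bsub>\<G>\<^esub> = \<one>\<^bsub>Aut_tree p\<^esub>"
  by (simp add: multi_edge_spinal_group_def)

lemma spinal_tree_auts: "g \<in> carrier \<G> \<Longrightarrow> g \<in> tree_auts p"
  unfolding carrier_spinal using group.generate_in_carrier[OF group_Aut_tree generators_subset] by (simp add: carrier_Aut_tree)

lemma rooted_gen_spinal: "rooted_gen p \<in> carrier \<G>"
  unfolding carrier_spinal by (simp add: generate.incl)

lemma directed_gen_spinal: "i \<in> {1..r} \<Longrightarrow> directed_gen p (E i) \<in> carrier \<G>"
  unfolding carrier_spinal by (simp add: generate.incl)

lemma int_pow_spinal: "g \<in> carrier \<G> \<Longrightarrow> g [^]\<^bsub>\<G>\<^esub> (k::int) = g [^]\<^bsub>Aut_tree p\<^esub> k"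
  unfolding multi_edge_spinal_group_def by (rule group.int_pow_subgroup_generated[OF group_Aut_tree])

lemma sect_at_directed_gen:
  "sect_at (directed_gen p e) x
    = (if int p dvd x then directed_gen p e else rooted_gen p [^]\<^bsub>Aut_tree p\<^esub> e (lt x))"
  using fun_cong[OF directed_gen(2)[of p e], of "lt x"] letter_less_iff[OF prime_pos, of x]
  by (simp add: psi1_def letter_section_def)

lemma directed_gen_lt: "directed_gen p e [lt x] = [lt x]"
  using directed_gen(1)[of p e] by (simp add: level_one_stab_def)

lemma comb_spinal: "directed_gen p (comb c) \<in> carrier \<G>"
proof -
  interpret G: group \<G> by (rule group_spinal)
  have smult: "directed_gen p (\<lambda>j. k * E i j) \<in> carrier \<G>" if i: "i \<in> {1..r}" for i k
  proof -
    note d = directed_gen_spinal[OF i]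
    have add: "directed_gen p (\<lambda>j. (k + l) * E i j)
        = directed_gen p (\<lambda>j. k * E i j) \<otimes>\<^bsub>\<G>\<^esub> directed_gen p (\<lambda>j. l * E i j)" for k l
      unfolding mult_spinal directed_gen_add[symmetric] by (simp add: distrib_right)
    have tc: "directed_gen p e \<in> carrier (Aut_tree p)" for e
      using directed_gen(1)[of p e] by (simp add: level_one_stab_def carrier_Aut_tree)
    interpret A: group "Aut_tree p" by (rule group_Aut_tree)
    have zero: "directed_gen p (\<lambda>j. 0 * E i j) = \<one>\<^bsub>\<G>\<^esub>"
      using add[of 0 0] A.l_cancel_one'[of "directed_gen p (\<lambda>j. 0)" "directed_gen p (\<lambda>j. 0)"] tc
      unfolding mult_spinal one_spinal by simp
    show ?thesis
    proof (induction k rule: int_induct[where k = 0])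
      case base show ?case unfolding zero by simp
    next
      case (step1 k)
      then show ?case unfolding add using d by simp
    next
      case (step2 k)
      have eq: "directed_gen p (\<lambda>j. k * E i j) = directed_gen p (\<lambda>j. (k - 1) * E i j) \<otimes>\<^bsub>\<G>\<^esub> directed_gen p (E i)"
        using add[of "k - 1" 1] by simp
      have "directed_gen p (\<lambda>j. (k - 1) * E i j)
          = directed_gen p (\<lambda>j. k * E i j) \<otimes>\<^bsub>Aut_tree p\<^esub> inv\<^bsub>Aut_tree p\<^esub> (directed_gen p (E i))"
        unfolding eq mult_spinal using tc by (simp add: A.m_assoc)
      also have "inv\<^bsub>Aut_tree p\<^esub> (directed_gen p (E i)) = inv\<^bsub>\<G>\<^esub> (directed_gen p (E i))"
        unfolding multi_edge_spinal_group_def using d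
        by (subst group.inv_subgroup_generated[OF group_Aut_tree]) (simp_all add: multi_edge_spinal_group_def)
      finally show ?case using step2.IH d G.m_closed unfolding mult_spinal[symmetric] by simp
    qed
  qed
  have "directed_gen p (\<lambda>j. \<Sum>i\<in>K. c i * E i j) \<in> carrier \<G>" if "finite K" "K \<subseteq> {1..r}" for K
    using that
  proof (induction K)
    case empty
    have "directed_gen p (\<lambda>j. 0 * E 1 j) \<in> carrier \<G>" using r by (intro smult) simp
    then show ?case by simp
  next
    case (insert i K)
    then show ?case
      using G.m_closed[OF smult[of i "c i"] insert.IH] by (simp add: mult_spinal directed_gen_add)
  qed
  then show ?thesis by blast
qed

lemma rotation_sections:
  assumes "g \<in> carrier \<G>"
  shows "(\<exists>j. \<forall>x. g [lt x] = [lt (x + j)]) \<and> (\<forall>x. sect_at g x \<in> carrier \<G>)"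
proof -
  interpret G: group \<G> by (rule group_spinal)
  define P where "P g \<longleftrightarrow> (\<exists>j. \<forall>x. g [lt x] = [lt (x + j)]) \<and> (\<forall>x. sect_at g x \<in> carrier \<G>)" for g
  have P_one: "P \<one>\<^bsub>\<G>\<^esub>"
  proof -
    have "\<one>\<^bsub>\<G>\<^esub> [lt x] = [lt (x + 0)]" for x by (simp add: one_spinal one_Aut_tree)
    moreover have "sect_at \<one>\<^bsub>\<G>\<^esub> x = \<one>\<^bsub>\<G>\<^esub>" for x
      by (auto simp: one_spinal one_Aut_tree letter_section_def section_at_def)
    ultimately show ?thesis unfolding P_def using G.one_closed by metis
  qed
  have P_mult: "P (g \<otimes>\<^bsub>\<G>\<^esub> h)" if g: "g \<in> carrier \<G>" "P g" and h: "h \<in> carrier \<G>" "P h" for g h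
  proof -
    obtain j k where jk: "\<And>x. g [lt x] = [lt (x + j)]" "\<And>x. h [lt x] = [lt (x + k)]"
      using g(2) h(2) unfolding P_def by blast
    have "(g \<otimes>\<^bsub>\<G>\<^esub> h) [lt x] = [lt (x + (j + k))]" for x
      by (simp add: mult_spinal mult_Aut_tree compose_def jk add.assoc)
    moreover have "sect_at (g \<otimes>\<^bsub>\<G>\<^esub> h) x \<in> carrier \<G>" for x
      using section_at_mult[OF spinal_tree_auts[OF g(1)] spinal_tree_auts[OF h(1)], of "[lt x]"]
        G.m_closed g(2) h(2) by (simp add: P_def letter_section_def jk mult_spinal)
    ultimately show ?thesis unfolding P_def by blast
  qed
  \<comment> \<open>Torsion makes the inverse a power with natural exponent, so it is covered by
    closure under products.\<close>
  have P_inv: "P (inv\<^bsub>\<G>\<^esub> g)" if g: "g \<in> carrier \<G>" "P g" for g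
  proof -
    have pow: "P (g [^]\<^bsub>\<G>\<^esub> n)" for n :: nat
      by (induction n) (simp_all add: P_one P_mult g)
    obtain n :: nat where n: "n > 0" "g [^]\<^bsub>\<G>\<^esub> n = \<one>\<^bsub>\<G>\<^esub>"
      using tor g(1) by (auto simp: torsion_group_def)
    then have "g [^]\<^bsub>\<G>\<^esub> (n - 1) \<otimes>\<^bsub>\<G>\<^esub> g = \<one>\<^bsub>\<G>\<^esub>" by (metis G.nat_pow_Suc Suc_pred' )
    then have "inv\<^bsub>\<G>\<^esub> g = g [^]\<^bsub>\<G>\<^esub> (n - 1)" using g(1) by (intro G.inv_equality) auto
    then show ?thesis using pow by simp
  qed
  have P_gen: "P g" if g: "g \<in> insert (rooted_gen p) ((\<lambda>i. directed_gen p (E i)) ` {1..r})" for g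
    using g
  proof (elim insertE imageE)
    assume g: "g = rooted_gen p"
    have "rooted_gen p [lt x] = [lt (x + 1)]" for x
      by (simp add: rooted_gen_def letter_add_one[OF prime_pos])
    moreover have "sect_at (rooted_gen p) x = \<one>\<^bsub>\<G>\<^esub>" for x
      by (auto simp: one_spinal one_Aut_tree letter_section_def section_at_def rooted_gen_def)
    ultimately show "P g" unfolding P_def g using G.one_closed by metis
  next
    fix i assume g: "g = directed_gen p (E i)" and i: "i \<in> {1..r}"
    have "directed_gen p (E i) [lt x] = [lt (x + 0)]" for x by (simp add: directed_gen_lt)
    moreover have "sect_at (directed_gen p (E i)) x \<in> carrier \<G>" for x
      using directed_gen_spinal[OF i] G.int_pow_closed[OF rooted_gen_spinal]
      by (simp add: sect_at_directed_gen int_pow_spinal[OF rooted_gen_spinal])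
    ultimately show "P g" unfolding P_def g by blast
  qed
  have "P g"
    using assms unfolding carrier_spinal
  proof (induction g rule: generate.induct)
    case one show ?case using P_one by (simp add: one_spinal)
  next
    case (incl h) then show ?case by (rule P_gen)
  next
    case (inv h)
    have h: "h \<in> carrier \<G>" unfolding carrier_spinal using inv by (rule generate.incl)
    have "inv\<^bsub>Aut_tree p\<^esub> h = inv\<^bsub>\<G>\<^esub> h"
      unfolding multi_edge_spinal_group_def using h
      by (subst group.inv_subgroup_generated[OF group_Aut_tree]) (simp_all add: multi_edge_spinal_group_def)
    then show ?case using P_inv[OF h P_gen[OF inv]] by simp
  next
    case (eng g h)
    then show ?case using P_mult[of g h] unfolding carrier_spinal mult_spinal by blast
  qed
  then show ?thesis by (simp add: P_def)
qed

lemma act_letter: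
  assumes g: "g \<in> carrier \<G>" shows "g [lt x] = [lt (x + rotation g)]"
proof -
  obtain j where j: "\<And>x. g [lt x] = [lt (x + j)]" using rotation_sections[OF g] by blast
  have "lt 1 = 1" by (simp add: letter_def)
  then have "g [1] = [lt (1 + j)]" using j[of 1] by simp
  then have rot: "rotation g = j mod int p" by (simp add: first_rot_def int_letter[OF prime_pos])
  have "lt (x + j) = lt (x + rotation g)"
    unfolding rot by (rule letter_cong[OF prime_pos]) (simp add: mod_simps)
  then show ?thesis unfolding j by simp
qed

interpretation G: self_similar \<G> p rotation sect_at
proof (rule self_similar.intro[OF group_spinal], unfold_locales)
  show "p > 0" by (rule prime_pos)
  fix g assume g: "g \<in> carrier \<G>"
  show "sect_at g x \<in> carrier \<G>" for x using rotation_sections[OF g] by blast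
  show "sect_at g (x mod int p) = sect_at g x" for x
    using letter_cong[OF prime_pos, of "x mod int p" x] by (simp add: letter_section_def)
  fix h assume h: "h \<in> carrier \<G>"
  show "sect_at (g \<otimes>\<^bsub>\<G>\<^esub> h) x = sect_at g x \<otimes>\<^bsub>\<G>\<^esub> sect_at h (x + rotation g)" for x
    using section_at_mult[OF spinal_tree_auts[OF g] spinal_tree_auts[OF h], of "[lt x]"]
      act_letter[OF g, of x] by (simp add: letter_section_def mult_spinal)
  have "lt 1 = 1" by (simp add: letter_def)
  then have "(g \<otimes>\<^bsub>\<G>\<^esub> h) [1] = [lt (1 + rotation g + rotation h)]"
    using act_letter[OF g, of 1] act_letter[OF h, of "1 + rotation g"] letter_words[OF prime_pos, of 1]
    by (simp add: mult_spinal mult_Aut_tree compose_def)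
  then show "rotation (g \<otimes>\<^bsub>\<G>\<^esub> h) = (rotation g + rotation h) mod int p"
    by (simp add: first_rot_def[of _ "_ \<otimes>\<^bsub>\<G>\<^esub> _"] int_letter[OF prime_pos] mod_simps)
qed

lemma level_stab_fixes:
  assumes "g \<in> G.level_stab n" "w \<in> words p" "length w \<le> n"
  shows "g w = w"
  using assms
proof (induction n arbitrary: g w)
  case 0
  then have "w = []" "g \<in> carrier \<G>" by simp_all
  then show ?case using tree_auts_Nil[OF spinal_tree_auts] by simp
next
  case (Suc n)
  then have g: "g \<in> carrier \<G>" "rotation g = 0" "\<And>x. sect_at g x \<in> G.level_stab n"
    by (auto simp: G.lift_sub_def)
  show ?case
  proof (cases w)
    case Nil then show ?thesis using tree_auts_Nil[OF spinal_tree_auts[OF g(1)]] by simp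
  next
    case (Cons c v)
    have c: "c \<in> letters p" "v \<in> words p" "length v \<le> n" using Suc.prems Cons by auto
    have lc: "lt (int c) = c" using letter_of_letter[OF prime_pos c(1)] .
    have "g ([c] @ v) = g [c] @ section_at p g [c] v"
      using spinal_tree_auts[OF g(1)] c by (intro section_eq) auto
    also have "g [c] = [c]" using act_letter[OF g(1), of "int c"] g(2) lc by simp
    also have "section_at p g [c] v = v" using Suc.IH[OF g(3)[of "int c"] c(2,3)] lc by (simp add: letter_section_def)
    finally show ?thesis using Cons by simp
  qed
qed

lemma maximal_subgroup_multi_edge_spinal_group:
  assumes "maximal_subgroup M \<G>"
  shows "M \<lhd> \<G> \<and> card (rcosets\<^bsub>\<G>\<^esub> M) = p"
proof -
  have unit: "comb (\<lambda>k. if k = i then 1 else 0) = E i" if "i \<in> {1..r}" for i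
    using that by (auto simp: fun_eq_iff if_distrib[of "\<lambda>x. x * _"] cong: if_cong)
  \<comment> \<open>The vectors \<open>E i\<close> alone are not closed under addition. Indexing by
    all coefficient functions, an abelian group under pointwise addition, makes the directed
    generators additive on a whole type.\<close>
  interpret spinal \<G> p rotation sect_at "rooted_gen p"
    "\<lambda>c. directed_gen p (comb c)" "\<lambda>c x. comb c (lt x)"
  proof unfold_locales
    show "Factorial_Ring.prime p" by (rule prime)
    fix g assume g: "g \<in> carrier \<G>"
    show "\<exists>n::nat. n > 0 \<and> g [^]\<^bsub>\<G>\<^esub> n = \<one>\<^bsub>\<G>\<^esub>" using tor g by (auto simp: torsion_group_def)
    show "g = \<one>\<^bsub>\<G>\<^esub>" if "\<And>n. g \<in> G.level_stab n"
    proof -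
      have "g w = w" if "w \<in> words p" for w using level_stab_fixes[OF \<open>\<And>n. g \<in> G.level_stab n\<close> that order_refl] .
      moreover have "g w = undefined" if "w \<notin> words p" for w
        using tree_auts_ext[OF spinal_tree_auts[OF g]] that by (simp add: extensional_def)
      ultimately show ?thesis by (auto simp: one_spinal one_Aut_tree restrict_def fun_eq_iff)
    qed
  next
    show "rooted_gen p \<in> carrier \<G>" by (rule rooted_gen_spinal)
    have "lt 1 = 1" by (simp add: letter_def)
    moreover have "1 \<noteq> p" using prime by auto
    ultimately show "rotation (rooted_gen p) = 1"
      using prime_gt_1_nat[OF prime] letter_words[OF prime_pos, of 1] by (simp add: first_rot_def rooted_gen_def)
    show "sect_at (rooted_gen p) x = \<one>\<^bsub>\<G>\<^esub>" for x
      by (auto simp: one_spinal one_Aut_tree letter_section_def section_at_def rooted_gen_def)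
    fix c :: "nat \<Rightarrow> int"
    show "directed_gen p (comb c) \<in> carrier \<G>" by (rule comb_spinal)
    show "rotation (directed_gen p (comb c)) = 0"
      using directed_gen_lt[of "comb c" 1] \<open>lt 1 = 1\<close> by (simp add: first_rot_def)
    show "directed_gen p (comb (c + d)) = directed_gen p (comb c) \<otimes>\<^bsub>\<G>\<^esub> directed_gen p (comb d)" for d
      unfolding mult_spinal directed_gen_add[symmetric] by (simp add: distrib_right sum.distrib)
    show "sect_at (directed_gen p (comb c)) x =
        (if int p dvd x then directed_gen p (comb c) else rooted_gen p [^]\<^bsub>\<G>\<^esub> comb c (lt x))" for x
      by (simp add: sect_at_directed_gen int_pow_spinal[OF rooted_gen_spinal])
  next
    let ?S = "insert (rooted_gen p) (range (\<lambda>c. directed_gen p (comb c)))"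
    have sub: "?S \<subseteq> carrier \<G>" using rooted_gen_spinal comb_spinal by auto
    have "insert (rooted_gen p) ((\<lambda>i. directed_gen p (E i)) ` {1..r}) \<subseteq> ?S"
    proof -
      have "directed_gen p (E i) \<in> ?S" if "i \<in> {1..r}" for i
      proof -
        have "directed_gen p (comb (\<lambda>k. if k = i then 1 else 0)) \<in> ?S" by (intro insertI2 rangeI)
        then show ?thesis by (simp only: unit[OF that])
      qed
      then show ?thesis by (intro insert_subsetI image_subsetI) simp_all
    qed
    then have "carrier \<G> \<subseteq> generate (Aut_tree p) ?S"
      unfolding carrier_spinal by (rule group.mono_generate[OF group_Aut_tree])
    also have "\<dots> = generate \<G> ?S"
    proof -
      have "subgroup (carrier \<G>) (Aut_tree p)"
        unfolding carrier_spinal by (rule group.generate_is_subgroup[OF group_Aut_tree generators_subset])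
      then have "generate (Aut_tree p\<lparr>carrier := carrier \<G>\<rparr>) ?S = generate (Aut_tree p) ?S"
        using sub by (intro group.generate_consistent[OF group_Aut_tree])
      moreover have "Aut_tree p\<lparr>carrier := carrier \<G>\<rparr> = \<G>"
        by (simp add: multi_edge_spinal_group_def subgroup_generated_def)
      ultimately show ?thesis by simp
    qed
    finally show "carrier \<G> = generate \<G> ?S"
      using group.generate_incl[OF group_spinal sub] by blast
  next
    \<comment> \<open>If the first vector vanished modulo \<open>p\<close>, the coefficients with 1
      at index 1 and 0 elsewhere would be a nontrivial relation.\<close>
    have "\<exists>j\<in>{1..p-1}. \<not> int p dvd E 1 j"
    proof (rule ccontr)
      assume neg: "\<not> ?thesis"
      have "\<forall>j\<in>{1..p-1}. [comb (\<lambda>k. if k = 1 then 1 else 0) j = 0] (mod int p)"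
        using neg r unit[of 1] by (simp add: cong_0_iff fun_eq_iff)
      with indep[unfolded lin_indep_mod_def, THEN spec, of "\<lambda>k. if k = 1 then 1 else 0"]
      have "\<forall>i\<in>{1..r}. [(if i = 1 then 1 else 0) = 0] (mod int p)" by (rule mp)
      then have "[1 = 0] (mod int p)" using r by (auto dest: bspec[of _ _ 1])
      then show False using prime by (simp add: cong_0_iff)
    qed
    then obtain j where j: "j \<in> {1..p-1}" "\<not> int p dvd E 1 j" by blast
    have lj: "lt (int j) = j" using j(1) by (intro letter_of_letter[OF prime_pos]) (auto simp: letters_def)
    have nj: "\<not> int p dvd int j" using j(1) by (auto dest: dvd_imp_le)
    have "(1::nat) \<in> {1..r}" using r by simp
    then have "comb (\<lambda>k. if k = 1 then 1 else 0) (lt (int j)) = E 1 (lt (int j))"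
      by (intro fun_cong[OF unit])
    then have "\<not> int p dvd comb (\<lambda>k. if k = 1 then 1 else 0) (lt (int j))"
      using j(2) by (simp only: lj) simp
    with nj show "\<exists>c t. \<not> int p dvd t \<and> \<not> int p dvd comb c (lt t)" by (intro exI conjI)
  qed
  show ?thesis using assms by (rule maximal_subgroup_normal_index)
qed

end

theorem theorem1p2:
  fixes p r :: nat and E :: "nat \<Rightarrow> nat \<Rightarrow> int" and M :: "(nat list \<Rightarrow> nat list) set"
  assumes "Factorial_Ring.prime p" and "odd p"
    and "r \<ge> 1"
    and "lin_indep_mod p r E"
    and "torsion_group (multi_edge_spinal_group p r E)"
    and "maximal_subgroup M (multi_edge_spinal_group p r E)"
  shows "M \<lhd> multi_edge_spinal_group p r E \<and>
         card (rcosets\<^bsub>multi_edge_spinal_group p r E\<^esub> M) = p"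
  by (rule maximal_subgroup_multi_edge_spinal_group[OF assms(1,3-6)])

end
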